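(* Let $n\ge 2$ be an integer and let $\alpha<\beta$ be real numbers. Let $f$ be a real-valued function that is $2n+3$ times continuously differentiable on $[\alpha,\beta]$, and let $g$ be a real-valued function that is $2n+1$ times continuously differentiable on $[\alpha,\beta]$. Assume there are positive parameters $M,N,T,U$ with $M\ge\beta-\alpha$ and positive constants $C_0,C_1,\ldots,C_{2n+3}$ such that for all $\alpha\le x\le\beta$ $$|f^{(r)}(x)|\le C_r\frac{T}{M^r}\quad(2\le r\le 2n+3),\qquad f''(x)\ge\frac{T}{C_2M^2},\qquad |g^{(s)}(x)|\le C_s\frac{U}{N^s}\quad(0\le s\le 2n+1).$$ Suppose that $f'(x)$ changes sign only at $x=\gamma$, from negative to positive, where $\alpha<\gamma<\beta$. Let $$\Delta=\min\Big\{\frac{\log 2}{C_2},\ \frac{1}{C_2^2\max_{2\le k\le 2n+3}C_k}\Big\},$$ and suppose $T$ is so large that $T^{\frac1{2n+3}}\Delta>1$. Put $\lambda_k=f^{(k)}(\gamma)/k!$ and $\eta_k=g^{(k)}(\gamma)/k!$. Then there are numerical constants $C_{k\ell j}$ (depending only on $k,\ell,j$) such that, with $$\varpi_k=\eta_k+\sum_{\ell=0}^{k-1}\eta_\ell\sum_{j=1}^{k-\ell}\frac{C_{k\ell j}}{\lambda_2^j}\sum_{\substack{3\le n_1,\ldots,n_j\le 2n+3\\ n_1+\cdots+n_j=k-\ell+2j}}\lambda_{n_1}\cdots\lambda_{n_j}\qquad(0\le k\le 2n),$$ one has $$\begin{aligned}\int_\alpha^\beta g(x)e(f(x))\,dx=\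 &\frac{e\big(f(\gamma)+\frac18\big)}{\sqrt{f''(\gamma)}}\Big(g(\gamma)+\sum_{j=1}^{n}\varpi_{2j}\frac{(-1)^j(2j-1)!!}{(4\pi i\lambda_2)^j}\Big)+\Big[e(f(x))\sum_{t=1}^{n+1}H_t(x)\Big]_\alpha^\beta\\ &+O\Big(\frac{UM^{2n+5}}{T^{n+2}N^{n+2}}\Big(\frac1{(\gamma-\alpha)^{n+2}}+\frac1{(\beta-\gamma)^{n+2}}\Big)\Big)\\ &+O\Big(\frac{UM^{2n+4}}{T^{n+2}}\Big(\frac1{(\gamma-\alpha)^{2n+3}}+\frac1{(\beta-\gamma)^{2n+3}}\Big)\Big)\\ &+O\Big(\frac{UM^{2n+4}}{T^{n+2}N^{2n}}\Big(\frac1{(\gamma-\alpha)^{3}}+\frac1{(\beta-\gamma)^{3}}\Big)\Big)+O\Big(\frac{U}{T^{n+1}}\Big(\frac{M^{2n+2}}{N^{2n+1}}+M\Big)\Big),\end{aligned}$$ where the implied constants depend only on $n$ and $C_0,\ldots,C_{2n+3}$.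
   Context: Notation: $e(x)=e^{2\pi i x}$; $[F(x)]_\alpha^\beta=F(\beta)-F(\alpha)$; $(2j-1)!!=1\cdot3\cdots(2j-1)$. At points where $f'(x)\ne0$ the functions $H_t$ are defined recursively by $$H_1(x)=\frac{g(x)}{2\pi i f'(x)},\qquad H_t(x)=-\frac{H_{t-1}'(x)}{2\pi i f'(x)}\quad(2\le t\le n+1).$$ In the definition of $\varpi_k$ only $\lambda_m$ with $m\le 2n+2$ actually occur. *)

theory Defs
  imports "HOL-Analysis.Analysis"
begin

text \<open>
  Derivatives of functions given on a closed interval are taken within that interval, hence are
  one-sided at its endpoints and independent of the values of the function outside of it.
\<close>

primrec deriv_on :: "real set \<Rightarrow> nat \<Rightarrow> (real \<Rightarrow> 'a::real_normed_vector) \<Rightarrow> real \<Rightarrow> 'a" where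
  "deriv_on S 0 f = f"
| "deriv_on S (Suc k) f = (\<lambda>x. vector_derivative (deriv_on S k f) (at x within S))"

definition Ck_on :: "nat \<Rightarrow> (real \<Rightarrow> 'a::real_normed_vector) \<Rightarrow> real set \<Rightarrow> bool" where
  "Ck_on k f S \<longleftrightarrow>
     (\<forall>j<k. \<forall>x\<in>S. deriv_on S j f differentiable (at x within S)) \<and>
     continuous_on S (deriv_on S k f)"

definition e :: "real \<Rightarrow> complex" where
  "e x = exp (2 * of_real pi * \<i> * of_real x)"

definition bracket :: "(real \<Rightarrow> complex) \<Rightarrow> real \<Rightarrow> real \<Rightarrow> complex" where
  "bracket F a b = F b - F a"

text \<open>The product $1 \cdot 3 \cdots (2j-1)$.\<close>

definition odd_double_fact :: "nat \<Rightarrow> nat" where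
  "odd_double_fact j = (\<Prod>i=1..j. 2 * i - 1)"

text \<open>
  The functions $H_t$, $t \ge 1$, for $f$ and $g$ on the interval \<open>S\<close>; the index \<open>0\<close> is not
  used. The values are meaningful only at points where $f'$ does not vanish.
\<close>

fun H :: "real set \<Rightarrow> (real \<Rightarrow> real) \<Rightarrow> (real \<Rightarrow> real) \<Rightarrow> nat \<Rightarrow> real \<Rightarrow> complex" where
  "H S f g 0 = (\<lambda>x. 0)"
| "H S f g (Suc 0) = (\<lambda>x. of_real (g x) / (2 * of_real pi * \<i> * of_real (deriv_on S 1 f x)))"
| "H S f g (Suc (Suc t)) =
     (\<lambda>x. - vector_derivative (H S f g (Suc t)) (at x within S) /
            (2 * of_real pi * \<i> * of_real (deriv_on S 1 f x)))"

definition taylor_coeff :: "real set \<Rightarrow> (real \<Rightarrow> real) \<Rightarrow> real \<Rightarrow> nat \<Rightarrow> real" where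
  "taylor_coeff S f \<gamma> k = deriv_on S k f \<gamma> / fact k"

text \<open>
  The tuples $(n_1, \dots, n_j)$ with $3 \le n_i \le m$ and $n_1 + \dots + n_j = s$, as lists.
\<close>

definition index_tuples :: "nat \<Rightarrow> nat \<Rightarrow> nat \<Rightarrow> nat list set" where
  "index_tuples m j s = {ns. length ns = j \<and> set ns \<subseteq> {3..m} \<and> sum_list ns = s}"

text \<open>\<open>c k l j\<close> are the numerical constants, \<open>lam\<close> and \<open>eta\<close> the Taylor coefficients.\<close>

definition varpi ::
  "(nat \<Rightarrow> nat \<Rightarrow> nat \<Rightarrow> real) \<Rightarrow> nat \<Rightarrow> (nat \<Rightarrow> real) \<Rightarrow> (nat \<Rightarrow> real) \<Rightarrow> nat \<Rightarrow> real" where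
  "varpi c n lam eta k =
     eta k + (\<Sum>l<k. eta l * (\<Sum>j=1..k - l. c k l j / lam 2 ^ j *
       (\<Sum>ns\<in>index_tuples (2 * n + 3) j (k - l + 2 * j). \<Prod>i<j. lam (ns ! i))))"

definition Delta :: "nat \<Rightarrow> (nat \<Rightarrow> real) \<Rightarrow> real" where
  "Delta n C = min (ln 2 / C 2) (1 / (C 2 ^ 2 * Max (C ` {2..2 * n + 3})))"

end

theory Submission
  imports Defs "HOL-Complex_Analysis.Complex_Analysis" "HOL-Probability.Distributions"
begin

text \<open>
  Put \<open>\<lambda> = f''(\<gamma>) / 2\<close> and let \<open>y\<close> be the increasing coordinate with \<open>f(x) = f(\<gamma>) + \<lambda> y\<^sup>2\<close>.
  By Lagrange inversion the \<open>\<varpi>\<^sub>k\<close> are the coefficients for which the remainder \<open>R = g - \<Sum>\<^sub>k \<varpi>\<^sub>k y\<^sup>k y'\<close>,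
  \<open>k \<le> 2 n\<close>, vanishes to order \<open>2 n + 1\<close> at \<open>\<gamma>\<close>. The \<open>H\<^sub>t\<close> are linear in \<open>g\<close> and invariant under
  changes of variable, so the contribution of \<open>y\<^sup>k y'\<close> is that of a Fresnel integral over \<open>y\<^sup>k\<close>:
  integration by parts is exact for odd \<open>k\<close>, and for even \<open>k\<close> it leaves the main term and a tail of
  order \<open>\<lambda>\<close> to the power \<open>- n - 2\<close> at each endpoint. The integral of \<open>R\<close> is cut at distance
  \<open>M / sqrt T\<close> from \<open>\<gamma>\<close>: inside it is bounded trivially, outside by \<open>n + 2\<close> integrations by parts.
  The coordinate \<open>y\<close> is not shown to be smooth at \<open>\<gamma>\<close>; functions are only compared with their Taylor
  polynomials, with estimates for the derivatives away from \<open>\<gamma>\<close>.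
\<close>

section \<open>Uniform symbol estimates\<close>

text \<open>The implied constants may depend only on \<open>n\<close> and the C_r.

  The obstacle is regularity at \<gamma>. To describe y one divides f(x) - f(\<gamma>) by (x -
  \<gamma>)^2, which lowers the order of Taylor expansion from 2n+3 to 2n+1 and leaves derivative
  bounds that degenerate at \<gamma>. Estimates in which a derivative costs 1/|x - \<gamma>| are
  stable under sums, products, inverses, real powers and integration by parts, and these operations
  suffice: with y = (x - \<gamma>) sqrt(1 + z) the weight y^k y' is a product of a power of x -
  \<gamma>, a quotient formed from f', and a real power of 1 + z, where 1 + z stays in a fixed
  compact subset of the positive axis.

  At the radius M / sqrt T the phase has moved by about 1. The trivial bound inside and the
  integrated bound outside both give V M / T^(n+1) there, where V = U (1 + M/N)^(2n+1) is the size
  of R on the scale M.\<close>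

text \<open>
  All estimates are uniform over a family \<open>P\<close> of parameters. That \<open>symbol m W q\<close> holds means
  that the derivatives satisfy \<open>\<bar>x - c\<bar>\<^sup>j \<bar>q\<^sup>(\<^sup>j\<^sup>)(x)\<bar> \<le> K W(x)\<close> for \<open>j \<le> m\<close> and \<open>x \<noteq> c\<close>.
\<close>

locale pointed_intervals =
  fixes P :: "'p set" and a b c M :: "'p \<Rightarrow> real"
  assumes a_less_c: "p \<in> P \<Longrightarrow> a p < c p"
    and c_less_b: "p \<in> P \<Longrightarrow> c p < b p"
    and length_le: "p \<in> P \<Longrightarrow> b p - a p \<le> M p"
begin

text \<open>The endpoints stay in \<open>D p\<close> because the boundary terms are evaluated
  there.\<close>

definition D :: "'p \<Rightarrow> real set" where
  "D p = {a p..b p} - {c p}"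

abbreviation r :: "'p \<Rightarrow> real \<Rightarrow> real" where
  "r p x \<equiv> \<bar>x - c p\<bar>"

definition dominated :: "('p \<Rightarrow> real \<Rightarrow> 'b::real_normed_vector) \<Rightarrow> ('p \<Rightarrow> real \<Rightarrow> real) \<Rightarrow> bool" where
  "dominated q W \<longleftrightarrow> (\<exists>K\<ge>0. \<forall>p\<in>P. \<forall>x\<in>D p. norm (q p x) \<le> K * W p x)"

primrec symbol :: "nat \<Rightarrow> ('p \<Rightarrow> real \<Rightarrow> real) \<Rightarrow> ('p \<Rightarrow> real \<Rightarrow> 'b::real_normed_vector) \<Rightarrow> bool" where
  "symbol 0 W q = dominated q W"
| "symbol (Suc m) W q = (dominated q W \<and>
     (\<exists>q'. (\<forall>p\<in>P. \<forall>x\<in>D p. (q p has_vector_derivative q' p x) (at x within D p)) \<and>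
           symbol m (\<lambda>p x. W p x / r p x) q'))"

lemma M_pos: "p \<in> P \<Longrightarrow> M p > 0"
  using a_less_c c_less_b length_le by (smt (verit))

lemma r_pos: "x \<in> D p \<Longrightarrow> r p x > 0"
  by (auto simp: D_def)

lemma r_le_M: "p \<in> P \<Longrightarrow> x \<in> D p \<Longrightarrow> r p x \<le> M p"
  using a_less_c[of p] c_less_b[of p] length_le[of p] by (auto simp: D_def)

text \<open>Near any other point the removal of \<open>c p\<close> is invisible, so the interval
  derivatives in \<open>deriv_on\<close> and \<open>H\<close> can be used on
  \<open>D p\<close>.\<close>

lemma at_within_D_eq: "p \<in> P \<Longrightarrow> x \<in> D p \<Longrightarrow> at x within D p = at x within {a p..b p}"
  by (rule at_within_nhd[of _ "- {c p}"]) (auto simp: D_def)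

lemma at_within_D_nontrivial: "p \<in> P \<Longrightarrow> x \<in> D p \<Longrightarrow> at x within D p \<noteq> bot"
  using a_less_c[of p] c_less_b[of p]
  by (simp add: at_within_D_eq trivial_limit_within) (auto simp: D_def islimpt_Icc)

lemma dominatedI: "(\<And>p x. p \<in> P \<Longrightarrow> x \<in> D p \<Longrightarrow> norm (q p x) \<le> K * W p x) \<Longrightarrow> K \<ge> 0 \<Longrightarrow> dominated q W"
  by (auto simp: dominated_def)

lemma dominatedE:
  assumes "dominated q W"
  obtains K where "K \<ge> 0" "\<And>p x. p \<in> P \<Longrightarrow> x \<in> D p \<Longrightarrow> norm (q p x) \<le> K * W p x"
  using assms unfolding dominated_def by blast

lemma dominated_cong:
  "(\<And>p x. p \<in> P \<Longrightarrow> x \<in> D p \<Longrightarrow> q p x = q2 p x) \<Longrightarrow>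
   (\<And>p x. p \<in> P \<Longrightarrow> x \<in> D p \<Longrightarrow> W p x = W2 p x) \<Longrightarrow> dominated q W = dominated q2 W2"
  by (simp add: dominated_def)

lemma dominated_add:
  assumes "dominated q1 W" "dominated q2 W"
  shows "dominated (\<lambda>p x. q1 p x + q2 p x) W"
proof -
  obtain K1 where "K1 \<ge> 0" "\<And>p x. p \<in> P \<Longrightarrow> x \<in> D p \<Longrightarrow> norm (q1 p x) \<le> K1 * W p x"
    using assms(1) by (rule dominatedE) blast
  moreover obtain K2 where "K2 \<ge> 0" "\<And>p x. p \<in> P \<Longrightarrow> x \<in> D p \<Longrightarrow> norm (q2 p x) \<le> K2 * W p x"
    using assms(2) by (rule dominatedE) blast
  ultimately show ?thesis
    by (intro dominatedI[of _ "K1 + K2"])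
       (auto simp: algebra_simps intro!: order.trans[OF norm_triangle_ineq] add_mono)
qed

lemma dominated_mult:
  fixes q1 q2 :: "'p \<Rightarrow> real \<Rightarrow> 'b::real_normed_algebra"
  assumes "dominated q1 W1" "dominated q2 W2"
  shows "dominated (\<lambda>p x. q1 p x * q2 p x) (\<lambda>p x. W1 p x * W2 p x)"
proof -
  obtain K1 where K1: "K1 \<ge> 0" "\<And>p x. p \<in> P \<Longrightarrow> x \<in> D p \<Longrightarrow> norm (q1 p x) \<le> K1 * W1 p x"
    using assms(1) by (rule dominatedE) blast
  obtain K2 where K2: "K2 \<ge> 0" "\<And>p x. p \<in> P \<Longrightarrow> x \<in> D p \<Longrightarrow> norm (q2 p x) \<le> K2 * W2 p x"
    using assms(2) by (rule dominatedE) blast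
  show ?thesis
  proof (rule dominatedI)
    fix p x assume "p \<in> P" "x \<in> D p"
    then have "norm (q1 p x) * norm (q2 p x) \<le> (K1 * W1 p x) * (K2 * W2 p x)"
      by (intro mult_mono K1 K2) (use K1(2) norm_ge_zero order.trans in blast)+
    then show "norm (q1 p x * q2 p x) \<le> K1 * K2 * (W1 p x * W2 p x)"
      by (intro order.trans[OF norm_mult_ineq]) (simp add: algebra_simps)
  qed (use K1 K2 in simp)
qed

lemma dominated_trans:
  assumes "dominated q W1" "dominated W1 W2"
  shows "dominated q W2"
proof -
  obtain K1 where K1: "K1 \<ge> 0" "\<And>p x. p \<in> P \<Longrightarrow> x \<in> D p \<Longrightarrow> norm (q p x) \<le> K1 * W1 p x"
    using assms(1) by (rule dominatedE) blast
  obtain K2 where K2: "K2 \<ge> 0" "\<And>p x. p \<in> P \<Longrightarrow> x \<in> D p \<Longrightarrow> norm (W1 p x) \<le> K2 * W2 p x"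
    using assms(2) by (rule dominatedE) blast
  show ?thesis
  proof (rule dominatedI)
    fix p x assume px: "p \<in> P" "x \<in> D p"
    then have "K1 * W1 p x \<le> K1 * (K2 * W2 p x)"
      using K2(2)[OF px] K1(1) by (intro mult_left_mono) auto
    then show "norm (q p x) \<le> K1 * K2 * W2 p x"
      using K1(2)[OF px] by simp
  qed (use K1 K2 in simp)
qed

lemma dominated_mono:
  assumes "dominated q W1" "\<And>p x. p \<in> P \<Longrightarrow> x \<in> D p \<Longrightarrow> W1 p x \<le> W2 p x"
  shows "dominated q W2"
proof -
  obtain K1 where K1: "K1 \<ge> 0" "\<And>p x. p \<in> P \<Longrightarrow> x \<in> D p \<Longrightarrow> norm (q p x) \<le> K1 * W1 p x"
    using assms(1) by (rule dominatedE) blast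
  show ?thesis
    by (rule dominatedI[OF order.trans[OF K1(2) mult_left_mono[OF assms(2)]]]) (auto simp: K1)
qed

lemma dominated_divide_r:
  fixes q :: "'p \<Rightarrow> real \<Rightarrow> real"
  assumes "dominated q W"
  shows "dominated (\<lambda>p x. q p x / r p x) (\<lambda>p x. W p x / r p x)"
proof -
  obtain K1 where K1: "K1 \<ge> 0" "\<And>p x. p \<in> P \<Longrightarrow> x \<in> D p \<Longrightarrow> norm (q p x) \<le> K1 * W p x"
    using assms(1) by (rule dominatedE) blast
  show ?thesis
    by (rule dominatedI[of _ K1]) (use K1 r_pos in \<open>auto simp: field_simps\<close>)
qed

lemma dominated_refl: "(\<And>p x. p \<in> P \<Longrightarrow> x \<in> D p \<Longrightarrow> W p x \<ge> 0) \<Longrightarrow> dominated W W"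
  by (rule dominatedI[of _ 1]) auto

lemma dominated_0 [simp]: "dominated (\<lambda>p x. 0) W"
  by (rule dominatedI[of _ 0]) auto

lemma dominated_scale:
  assumes "dominated q W"
  shows "dominated (\<lambda>p x. k *\<^sub>R q p x) W"
proof -
  obtain K1 where K1: "K1 \<ge> 0" "\<And>p x. p \<in> P \<Longrightarrow> x \<in> D p \<Longrightarrow> norm (q p x) \<le> K1 * W p x"
    using assms(1) by (rule dominatedE) blast
  show ?thesis
    by (rule dominatedI[of _ "\<bar>k\<bar> * K1"]) (use K1 in \<open>auto intro!: mult_left_mono simp: mult.assoc\<close>)
qed

lemma symbol_SucI:
  "dominated q W \<Longrightarrow>
   (\<And>p x. p \<in> P \<Longrightarrow> x \<in> D p \<Longrightarrow> (q p has_vector_derivative q' p x) (at x within D p)) \<Longrightarrow>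
   symbol m (\<lambda>p x. W p x / r p x) q' \<Longrightarrow> symbol (Suc m) W q"
  by auto

lemma symbol_dominated: "symbol m W q \<Longrightarrow> dominated q W"
  by (cases m) auto

lemma symbol_cong':
  assumes "symbol m W q" "\<And>p x. p \<in> P \<Longrightarrow> x \<in> D p \<Longrightarrow> q p x = q2 p x"
    "\<And>p x. p \<in> P \<Longrightarrow> x \<in> D p \<Longrightarrow> W p x = W2 p x"
  shows "symbol m W2 q2"
  using assms
proof (induction m arbitrary: W W2 q q2)
  case 0
  then show ?case using dominated_cong[of q q2 W W2] by simp
next
  case (Suc m)
  obtain q' where q': "\<forall>p\<in>P. \<forall>x\<in>D p. (q p has_vector_derivative q' p x) (at x within D p)"
      "symbol m (\<lambda>p x. W p x / r p x) q'" "dominated q W"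
    using Suc.prems(1) by auto
  have "dominated q2 W2"
    using q'(3) dominated_cong[of q q2 W W2] Suc.prems by simp
  moreover have "\<forall>p\<in>P. \<forall>x\<in>D p. (q2 p has_vector_derivative q' p x) (at x within D p)"
    using q'(1) Suc.prems(2)
    by - (intro ballI, rule has_vector_derivative_transform[where f = "q _"], auto)
  moreover have "symbol m (\<lambda>p x. W2 p x / r p x) q'"
    by (rule Suc.IH[OF q'(2)]) (auto simp: Suc.prems(3))
  ultimately show ?case by auto
qed

lemma symbol_cong: "symbol m W q \<Longrightarrow> (\<And>p x. p \<in> P \<Longrightarrow> x \<in> D p \<Longrightarrow> q p x = q2 p x) \<Longrightarrow> symbol m W q2"
  by (erule symbol_cong') auto

lemma symbol_trans: "symbol m W1 q \<Longrightarrow> dominated W1 W2 \<Longrightarrow> symbol m W2 q"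
proof (induction m arbitrary: W1 W2 q)
  case (Suc m)
  obtain q' where q': "\<forall>p\<in>P. \<forall>x\<in>D p. (q p has_vector_derivative q' p x) (at x within D p)"
      "symbol m (\<lambda>p x. W1 p x / r p x) q'" "dominated q W1"
    using Suc.prems(1) by auto
  show ?case
    using q'(1) Suc.IH[OF q'(2) dominated_divide_r[OF Suc.prems(2)]] dominated_trans[OF q'(3) Suc.prems(2)]
    by (intro symbol_SucI) auto
qed (auto intro: dominated_trans)

lemma symbol_mono:
  assumes "symbol m W1 q" "\<And>p x. p \<in> P \<Longrightarrow> x \<in> D p \<Longrightarrow> 0 \<le> W1 p x \<and> W1 p x \<le> W2 p x"
  shows "symbol m W2 q"
  by (rule symbol_trans[OF assms(1)]) (rule dominatedI[of _ 1], use assms(2) in auto)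

lemma symbol_Suc_imp: "symbol (Suc m) W q \<Longrightarrow> symbol m W q"
proof (induction m arbitrary: W q)
  case (Suc m)
  obtain q' where q': "\<forall>p\<in>P. \<forall>x\<in>D p. (q p has_vector_derivative q' p x) (at x within D p)"
      "symbol (Suc m) (\<lambda>p x. W p x / r p x) q'" "dominated q W"
    using Suc.prems(1) by auto
  then show ?case using Suc.IH[OF q'(2)] by auto
qed auto

lemma symbol_le: "m \<le> m' \<Longrightarrow> symbol m' W q \<Longrightarrow> symbol m W q"
  by (induction m' rule: dec_induct) (auto dest: symbol_Suc_imp simp del: symbol.simps)

lemma symbol_add:
  "symbol m W q1 \<Longrightarrow> symbol m W q2 \<Longrightarrow> symbol m W (\<lambda>p x. q1 p x + q2 p x)"
proof (induction m arbitrary: W q1 q2)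
  case (Suc m)
  obtain q1' where q1: "\<forall>p\<in>P. \<forall>x\<in>D p. (q1 p has_vector_derivative q1' p x) (at x within D p)"
      "symbol m (\<lambda>p x. W p x / r p x) q1'" "dominated q1 W"
    using Suc.prems(1) by auto
  obtain q2' where q2: "\<forall>p\<in>P. \<forall>x\<in>D p. (q2 p has_vector_derivative q2' p x) (at x within D p)"
      "symbol m (\<lambda>p x. W p x / r p x) q2'" "dominated q2 W"
    using Suc.prems(2) by auto
  have "\<forall>p\<in>P. \<forall>x\<in>D p. ((\<lambda>x. q1 p x + q2 p x) has_vector_derivative (q1' p x + q2' p x)) (at x within D p)"
    using q1(1) q2(1) by (auto intro!: derivative_intros)
  with dominated_add[OF q1(3) q2(3)] Suc.IH[OF q1(2) q2(2)] show ?case by (intro symbol_SucI) auto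
qed (auto intro: dominated_add)

lemma symbol_0 [simp]: "symbol m W (\<lambda>p x. 0)"
  by (induction m arbitrary: W) (auto intro!: exI[of _ "\<lambda>p x. 0"])

lemma symbol_const: "dominated (\<lambda>p x. k p) W \<Longrightarrow> symbol m W (\<lambda>p x. k p)"
  by (cases m) (auto intro!: exI[of _ "\<lambda>p x. 0"])

lemma symbol_sum:
  "(\<And>i. i \<in> A \<Longrightarrow> symbol m W (q i)) \<Longrightarrow> symbol m W (\<lambda>p x. \<Sum>i\<in>A. q i p x)"
  by (induction A rule: infinite_finite_induct) (auto intro: symbol_add)

lemma symbol_mult:
  fixes q1 q2 :: "'p \<Rightarrow> real \<Rightarrow> 'b::real_normed_algebra"
  shows "symbol m W1 q1 \<Longrightarrow> symbol m W2 q2 \<Longrightarrow>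
    symbol m (\<lambda>p x. W1 p x * W2 p x) (\<lambda>p x. q1 p x * q2 p x)"
proof (induction m arbitrary: W1 W2 q1 q2)
  case (Suc m)
  obtain q1' where q1: "\<forall>p\<in>P. \<forall>x\<in>D p. (q1 p has_vector_derivative q1' p x) (at x within D p)"
      "symbol m (\<lambda>p x. W1 p x / r p x) q1'" "dominated q1 W1"
    using Suc.prems(1) by auto
  obtain q2' where q2: "\<forall>p\<in>P. \<forall>x\<in>D p. (q2 p has_vector_derivative q2' p x) (at x within D p)"
      "symbol m (\<lambda>p x. W2 p x / r p x) q2'" "dominated q2 W2"
    using Suc.prems(2) by auto
  have "\<forall>p\<in>P. \<forall>x\<in>D p. ((\<lambda>x. q1 p x * q2 p x) has_vector_derivative (q1 p x * q2' p x + q1' p x * q2 p x)) (at x within D p)"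
    using q1(1) q2(1) by (auto intro!: derivative_eq_intros)
  moreover have "symbol m (\<lambda>p x. W1 p x * W2 p x / r p x) (\<lambda>p x. q1 p x * q2' p x + q1' p x * q2 p x)"
    using Suc.IH[OF symbol_Suc_imp[OF Suc.prems(1)] q2(2)] Suc.IH[OF q1(2) symbol_Suc_imp[OF Suc.prems(2)]]
    by (intro symbol_add) simp_all
  ultimately show ?case using dominated_mult[OF q1(3) q2(3)] by (intro symbol_SucI) auto
qed (auto intro: dominated_mult)

lemma symbol_cmult:
  fixes q :: "'p \<Rightarrow> real \<Rightarrow> 'b::real_normed_algebra_1"
  assumes "symbol m W q" shows "symbol m W (\<lambda>p x. k * q p x)"
proof -
  have "dominated (\<lambda>p x. k) (\<lambda>p x. 1)" by (rule dominatedI[of _ "norm k"]) auto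
  from symbol_mult[OF symbol_const[OF this] assms] show ?thesis by simp
qed

lemma symbol_minus:
  fixes q :: "'p \<Rightarrow> real \<Rightarrow> 'b::real_normed_algebra_1"
  assumes "symbol m W q" shows "symbol m W (\<lambda>p x. - q p x)"
  using symbol_cmult[OF assms, of "-1"] by simp

lemma symbol_diff:
  fixes q1 q2 :: "'p \<Rightarrow> real \<Rightarrow> 'b::real_normed_algebra_1"
  assumes "symbol m W q1" "symbol m W q2" shows "symbol m W (\<lambda>p x. q1 p x - q2 p x)"
  using symbol_add[OF assms(1) symbol_minus[OF assms(2)]] by simp

lemma dominated_of_real:
  "dominated q W \<Longrightarrow> dominated (\<lambda>p x. of_real (q p x) :: 'b::real_normed_algebra_1) W"
  by (simp add: dominated_def)

lemma symbol_of_real: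
  "symbol m W q \<Longrightarrow> symbol m W (\<lambda>p x. of_real (q p x) :: 'b::real_normed_algebra_1)"
proof (induction m arbitrary: W q)
  case (Suc m)
  obtain q' where q': "\<forall>p\<in>P. \<forall>x\<in>D p. (q p has_vector_derivative q' p x) (at x within D p)"
      "symbol m (\<lambda>p x. W p x / r p x) q'" "dominated q W"
    using Suc.prems(1) by auto
  have "\<forall>p\<in>P. \<forall>x\<in>D p. ((\<lambda>x. of_real (q p x) :: 'b) has_vector_derivative of_real (q' p x)) (at x within D p)"
    using q'(1) by (auto intro!: has_vector_derivative_of_real simp: has_real_derivative_iff_has_vector_derivative)
  then show ?case using Suc.IH[OF q'(2)] dominated_of_real[OF q'(3)] by (intro symbol_SucI) auto
qed (auto intro: dominated_of_real)

text \<open>No point of \<open>D p\<close> is isolated in it, so derivatives within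
  \<open>D p\<close> are unique and the existential witness in \<open>symbol\<close> agrees with any
  derivative computed otherwise.\<close>

lemma symbol_derivative:
  assumes "symbol (Suc m) W q"
    "\<And>p x. p \<in> P \<Longrightarrow> x \<in> D p \<Longrightarrow> (q p has_vector_derivative q' p x) (at x within D p)"
  shows "symbol m (\<lambda>p x. W p x / r p x) q'"
proof -
  obtain q2 where q2: "\<forall>p\<in>P. \<forall>x\<in>D p. (q p has_vector_derivative q2 p x) (at x within D p)"
      "symbol m (\<lambda>p x. W p x / r p x) q2"
    using assms(1) by auto
  show ?thesis
    by (rule symbol_cong[OF q2(2)])
       (use q2(1) assms(2) at_within_D_nontrivial in \<open>blast intro: vector_derivative_unique_within\<close>)
qed

lemma symbol_differentiable:
  assumes "symbol (Suc m) W q" "p \<in> P" "x \<in> D p"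
  shows "(q p has_vector_derivative vector_derivative (q p) (at x within {a p..b p})) (at x within {a p..b p})"
  using assms at_within_D_eq[of p x]
  by (auto simp: vector_derivative_works[symmetric] intro: differentiableI_vector)
     (metis differentiableI_vector)

lemma symbol_vector_derivative:
  assumes "symbol (Suc m) W q"
  shows "symbol m (\<lambda>p x. W p x / r p x) (\<lambda>p x. vector_derivative (q p) (at x within {a p..b p}))"
  by (rule symbol_derivative[OF assms]) (use symbol_differentiable[OF assms] at_within_D_eq in auto)

text \<open>For a hierarchy of derivatives known in advance: the induction shifts the sequence and
  moves one factor \<open>1 / r\<close> into the weight.\<close>

lemma symbol_chain:
  assumes "\<And>i p x. i < m \<Longrightarrow> p \<in> P \<Longrightarrow> x \<in> D p \<Longrightarrow> (F i p has_vector_derivative F (Suc i) p x) (at x within D p)"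
    "\<And>i. i \<le> m \<Longrightarrow> dominated (F i) (\<lambda>p x. W p x / r p x ^ i)"
  shows "symbol m W (F 0)"
  using assms
proof (induction m arbitrary: W F)
  case 0 show ?case using 0(2)[of 0] by simp
next
  case (Suc m)
  have "symbol m (\<lambda>p x. W p x / r p x) (F (Suc 0))"
    by (rule Suc.IH[of "\<lambda>i. F (Suc i)"]) (use Suc.prems(1) Suc.prems(2)[of "Suc _"] in \<open>auto simp: mult.commute\<close>)
  moreover have "dominated (F 0) W" using Suc.prems(2)[of 0] by simp
  ultimately show ?case using Suc.prems(1)[of 0] by auto
qed

text \<open>The derivative of 1/w is -w'/w^2, of weight \<open>W1 / r * W2\<^sup>2\<close>;
  boundedness of \<open>W1 * W2\<close> reduces this to \<open>W2 / r\<close>, and the product rule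
  closes the induction.\<close>

lemma symbol_inverse:
  fixes w :: "'p \<Rightarrow> real \<Rightarrow> 'b::real_normed_field"
  assumes "symbol m W1 w" "dominated (\<lambda>p x. inverse (w p x)) W2" "dominated (\<lambda>p x. W1 p x * W2 p x) (\<lambda>p x. 1)"
    "\<And>p x. p \<in> P \<Longrightarrow> x \<in> D p \<Longrightarrow> w p x \<noteq> 0"
    "\<And>p x. p \<in> P \<Longrightarrow> x \<in> D p \<Longrightarrow> 0 \<le> W2 p x"
  shows "symbol m W2 (\<lambda>p x. inverse (w p x))"
  using assms(1)
proof (induction m)
  case (Suc m)
  obtain w' where w': "\<forall>p\<in>P. \<forall>x\<in>D p. (w p has_vector_derivative w' p x) (at x within D p)"
      "symbol m (\<lambda>p x. W1 p x / r p x) w'"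
    using Suc.prems by auto
  have IH: "symbol m W2 (\<lambda>p x. inverse (w p x))"
    using Suc.IH[OF symbol_Suc_imp[OF Suc.prems]] .
  have "symbol m (\<lambda>p x. W1 p x / r p x * (W2 p x * W2 p x)) (\<lambda>p x. - (w' p x * (inverse (w p x) * inverse (w p x))))"
    by (intro symbol_mult w' IH symbol_minus)
  moreover have "dominated (\<lambda>p x. W1 p x / r p x * (W2 p x * W2 p x)) (\<lambda>p x. W2 p x / r p x)"
    using dominated_mult[OF assms(3) dominated_divide_r[OF dominated_refl[OF assms(5)]]] by (simp add: field_simps)
  ultimately have "symbol m (\<lambda>p x. W2 p x / r p x) (\<lambda>p x. - (w' p x * (inverse (w p x) * inverse (w p x))))"
    by (rule symbol_trans)
  moreover have "\<forall>p\<in>P. \<forall>x\<in>D p. ((\<lambda>x. inverse (w p x)) has_vector_derivative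
      - (w' p x * (inverse (w p x) * inverse (w p x)))) (at x within D p)"
  proof safe
    fix p x assume px: "p \<in> P" "x \<in> D p"
    have "(w p has_derivative (\<lambda>h. h *\<^sub>R w' p x)) (at x within D p)"
      using w'(1) px by (auto simp: has_vector_derivative_def)
    from Deriv.has_derivative_inverse[OF assms(4)[OF px] this]
    show "((\<lambda>x. inverse (w p x)) has_vector_derivative
      - (w' p x * (inverse (w p x) * inverse (w p x)))) (at x within D p)"
      by (simp add: has_vector_derivative_def mult_ac)
  qed
  ultimately show ?case using assms(2) by (intro symbol_SucI) auto
qed (use assms(2) in auto)

lemma symbol_id: "symbol m r (\<lambda>p x. x - c p)"
proof (cases m)
  case (Suc k)
  have "symbol k (\<lambda>p x. r p x / r p x) (\<lambda>p x. 1 :: real)"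
    by (rule symbol_const) (rule dominatedI[of _ 1], use r_pos in force, simp)
  moreover have "\<forall>p\<in>P. \<forall>x\<in>D p. ((\<lambda>x. x - c p) has_vector_derivative 1) (at x within D p)"
    by (auto intro!: derivative_eq_intros)
  moreover have "dominated (\<lambda>p x. x - c p) r" by (rule dominatedI[of _ 1]) auto
  ultimately show ?thesis using Suc symbol_SucI[of "\<lambda>p x. x - c p" r "\<lambda>p x. 1" k] by blast
qed (auto intro!: dominatedI[of _ 1])

lemma symbol_inverse_id: "symbol m (\<lambda>p x. 1 / r p x) (\<lambda>p x. inverse (x - c p))"
  by (rule symbol_inverse[OF symbol_id]) (auto intro!: dominatedI[of _ 1] simp: divide_inverse D_def)

lemma symbol_power:
  fixes q :: "'p \<Rightarrow> real \<Rightarrow> 'b::real_normed_field"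
  assumes "symbol m W q" shows "symbol m (\<lambda>p x. W p x ^ k) (\<lambda>p x. q p x ^ k)"
proof (induction k)
  case 0
  have "dominated (\<lambda>p x. 1 :: 'b) (\<lambda>p x. 1)" by (rule dominatedI[of _ 1]) auto
  then show ?case using symbol_const by force
qed (use assms symbol_mult in auto)

text \<open>The two extra facts about \<xi> matter later: it is closer to \<open>c p\<close> than x,
  which lets powers of \<open>r\<close> be compared, and it lies on the same side, which lets signs
  be transferred.\<close>

lemma mvt_D:
  assumes p: "p \<in> P" and x: "x \<in> D p"
    and F: "\<And>x. x \<in> {a p..b p} \<Longrightarrow> (F has_real_derivative F' x) (at x within {a p..b p})"
  obtains \<xi> where "\<xi> \<in> D p" "F x - F (c p) = F' \<xi> * (x - c p)" "r p \<xi> < r p x" "(\<xi> - c p) * (x - c p) > 0"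
proof -
  have ac: "a p < c p" "c p < b p" using a_less_c c_less_b p by auto
  have der: "(F has_derivative (\<lambda>h. F' y * h)) (at y within {s..t})" if "y \<in> {s..t}" "{s..t} \<subseteq> {a p..b p}" for y s t
    using F[of y] that has_derivative_subset[of F _ y "{a p..b p}" "{s..t}"]
    by (auto simp: has_field_derivative_def)
  consider "x < c p" | "x > c p" using x by (fastforce simp: D_def)
  then show ?thesis
  proof cases
    case 1
    obtain \<xi> where "\<xi> \<in> {x<..<c p}" "F (c p) - F x = F' \<xi> * (c p - x)"
      using mvt_simple[OF 1, of F "\<lambda>y h. F' y * h"] der[of _ x "c p"] 1 x ac by (auto simp: D_def)
    moreover from this have "(\<xi> - c p) * (x - c p) > 0"
      by (intro mult_neg_neg) (use 1 in auto)
    ultimately show ?thesis using that[of \<xi>] 1 x ac by (auto simp: D_def algebra_simps)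
  next
    case 2
    obtain \<xi> where "\<xi> \<in> {c p<..<x}" "F x - F (c p) = F' \<xi> * (x - c p)"
      using mvt_simple[OF 2, of F "\<lambda>y h. F' y * h"] der[of _ "c p" x] 2 x ac by (auto simp: D_def)
    moreover from this have "(\<xi> - c p) * (x - c p) > 0"
      by (intro mult_pos_pos) (use 2 in auto)
    ultimately show ?thesis using that[of \<xi>] 2 x ac by (auto simp: D_def)
  qed
qed

lemma taylor_sum_deriv:
  fixes A :: "nat \<Rightarrow> real"
  shows "((\<lambda>x. \<Sum>k<Suc m. A k / fact k * (x - s) ^ k) has_real_derivative
     (\<Sum>k<m. A (Suc k) / fact k * (x - s) ^ k)) (at x within S)"
proof -
  have "((\<lambda>x. \<Sum>k<Suc m. A k / fact k * (x - s) ^ k) has_real_derivative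
     (\<Sum>k<Suc m. A k / fact k * (of_nat k * (x - s) ^ (k - Suc 0)))) (at x within S)"
    by (rule DERIV_sum) (auto intro!: derivative_eq_intros)
  also have "(\<Sum>k<Suc m. A k / fact k * (of_nat k * (x - s) ^ (k - Suc 0))) = (\<Sum>k<m. A (Suc k) / fact k * (x - s) ^ k)"
    by (subst sum.lessThan_Suc_shift) (auto intro!: sum.cong simp: field_simps simp del: of_nat_Suc)
  finally show ?thesis .
qed

text \<open>The derivative of a Taylor remainder is the remainder of one order less for the next
  derivative. As remainders vanish at \<open>c p\<close>, the mean value theorem returns the lost
  factor \<open>r\<close>.\<close>

lemma symbol_taylor:
  fixes F :: "nat \<Rightarrow> 'p \<Rightarrow> real \<Rightarrow> real"
  assumes "\<And>i p x. i < m \<Longrightarrow> p \<in> P \<Longrightarrow> x \<in> {a p..b p} \<Longrightarrow>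
      (F i p has_real_derivative F (Suc i) p x) (at x within {a p..b p})"
    and "dominated (F m) (\<lambda>p x. W p)"
  shows "symbol m (\<lambda>p x. W p * r p x ^ m) (\<lambda>p x. F 0 p x - (\<Sum>k<m. F k p (c p) / fact k * (x - c p) ^ k))"
  using assms
proof (induction m arbitrary: F)
  case (Suc m)
  let ?R = "\<lambda>p x. F 0 p x - (\<Sum>k<Suc m. F k p (c p) / fact k * (x - c p) ^ k)"
  let ?R' = "\<lambda>p x. F (Suc 0) p x - (\<Sum>k<m. F (Suc k) p (c p) / fact k * (x - c p) ^ k)"
  have IH: "symbol m (\<lambda>p x. W p * r p x ^ m) ?R'"
    using Suc.IH[of "\<lambda>i. F (Suc i)"] Suc.prems by auto
  have deriv: "(?R p has_real_derivative ?R' p x) (at x within {a p..b p})"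
    if "p \<in> P" "x \<in> {a p..b p}" for p x
    using Suc.prems(1)[of 0] that by (intro DERIV_diff taylor_sum_deriv) auto
  obtain K where K: "K \<ge> 0" "\<And>p x. p \<in> P \<Longrightarrow> x \<in> D p \<Longrightarrow> norm (?R' p x) \<le> K * (W p * r p x ^ m)"
    using symbol_dominated[OF IH] by (rule dominatedE) blast
  obtain K2 where K2: "K2 \<ge> 0" "\<And>p x. p \<in> P \<Longrightarrow> x \<in> D p \<Longrightarrow> norm (F (Suc m) p x) \<le> K2 * W p"
    using Suc.prems(2) by (rule dominatedE) blast
  have "dominated ?R (\<lambda>p x. W p * r p x ^ Suc m)"
  proof (rule dominatedI[OF _ K(1)])
    fix p x assume px: "p \<in> P" "x \<in> D p"
    have Rc: "?R p (c p) = 0"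
      by (simp add: sum.lessThan_Suc_shift)
    obtain \<xi> where \<xi>: "\<xi> \<in> D p" "?R p x - ?R p (c p) = ?R' p \<xi> * (x - c p)" "r p \<xi> < r p x"
      by (rule mvt_D[OF px deriv[OF px(1)]]) auto
    \<comment> \<open>The sign of \<open>W p\<close> is not assumed; it is recovered from the norm
      bound at \<xi>, where \<open>r\<close> is positive.\<close>
    have W: "K * W p \<ge> 0"
    proof -
      have "0 \<le> K * (W p * r p \<xi> ^ m)" using K(2)[OF px(1) \<xi>(1)] norm_ge_zero order.trans by blast
      then show ?thesis using r_pos[OF \<xi>(1)] by (simp add: zero_le_mult_iff mult.assoc[symmetric] del: abs_ge_zero zero_less_abs_iff)
         (metis linorder_not_less not_less_iff_gr_or_eq zero_less_power zero_less_abs_iff)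
    qed
    have "norm (?R p x) = norm (?R' p \<xi>) * r p x"
      using \<xi>(2) Rc by (simp add: abs_mult)
    also have "\<dots> \<le> K * (W p * r p \<xi> ^ m) * r p x"
      using K(2)[OF px(1) \<xi>(1)] by (intro mult_right_mono) auto
    also have "\<dots> \<le> K * (W p * r p x ^ m) * r p x"
      using \<xi>(3) W by (intro mult_right_mono) (auto simp: mult.assoc[symmetric] intro!: mult_left_mono power_mono)
    finally show "norm (?R p x) \<le> K * (W p * r p x ^ Suc m)"
      by (simp add: mult_ac)
  qed
  moreover have "\<forall>p\<in>P. \<forall>x\<in>D p. (?R p has_vector_derivative ?R' p x) (at x within D p)"
    using deriv at_within_D_eq by (auto simp: has_real_derivative_iff_has_vector_derivative[symmetric] D_def)
  moreover have "symbol m (\<lambda>p x. W p * r p x ^ Suc m / r p x) ?R'"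
    by (rule symbol_cong'[OF IH]) (use r_pos in auto)
  ultimately show ?case by (auto intro!: exI[of _ ?R'])
qed auto

end

section \<open>Lagrange inversion\<close>

unbundle no vec_syntax
unbundle fps_syntax

text \<open>The formal power (1 + Z)^\<kappa>, for Z without constant term.\<close>

definition hpow :: "real fps \<Rightarrow> real \<Rightarrow> real fps" where
  "hpow Z \<kappa> = fps_binomial \<kappa> oo Z"

text \<open>If y^2 = X^2 (1 + Z), this is y y' / X, half the derivative of y^2 divided by X.\<close>

definition phi_fps :: "real fps \<Rightarrow> real fps" where
  "phi_fps Z = 1 + Z + fps_const (1 / 2) * fps_X * fps_deriv Z"

text \<open>The series Z with f(\<gamma> + X) - f(\<gamma>) = \<lambda>_2 X^2 (1 + Z),
  formally.\<close>

definition ratio_fps :: "(nat \<Rightarrow> real) \<Rightarrow> real fps" where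
  "ratio_fps lam = Abs_fps (\<lambda>i. if i = 0 then 0 else lam (i + 2) / lam 2)"

text \<open>The residue of G(X) y^(-k-1) dX, where G has coefficients \<open>eta\<close> and y = X
  (1 + Z)^(1/2).\<close>

definition lagrange_coeff :: "real fps \<Rightarrow> (nat \<Rightarrow> real) \<Rightarrow> nat \<Rightarrow> real" where
  "lagrange_coeff Z eta k = (\<Sum>l\<le>k. eta l * hpow Z (- (real k + 1) / 2) $ (k - l))"

lemma hpow_nth_0 [simp]: "hpow Z \<kappa> $ 0 = 1"
  by (simp add: hpow_def)

lemma hpow_add: "Z $ 0 = 0 \<Longrightarrow> hpow Z (\<kappa> + \<mu>) = hpow Z \<kappa> * hpow Z \<mu>"
  by (simp add: hpow_def fps_binomial_add_mult fps_compose_mult_distrib)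

lemma hpow_0 [simp]: "hpow Z 0 = 1"
  by (simp add: hpow_def)

lemma hpow_1: "Z $ 0 = 0 \<Longrightarrow> hpow Z 1 = 1 + Z"
  by (simp add: hpow_def fps_binomial_1 fps_compose_add_distrib)

lemma fps_deriv_hpow:
  assumes "Z $ 0 = 0"
  shows "fps_deriv (hpow Z \<kappa>) = fps_const \<kappa> * fps_deriv Z * hpow Z (\<kappa> - 1)"
proof -
  have "fps_deriv (fps_binomial \<kappa>) = fps_const \<kappa> * fps_binomial (\<kappa> - 1)"
    using gbinomial_absorption[of _ \<kappa>] by (intro fps_ext) (simp del: of_nat_Suc)
  then show ?thesis
    using assms by (simp add: hpow_def fps_compose_deriv fps_compose_mult_distrib mult_ac)
qed

text \<open>The product equals \<open>G - X G' / d\<close> with \<open>G = (1 + Z)\<close> to the power \<open>- d / 2\<close>.\<close>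

lemma phi_hpow_nth:
  assumes Z: "Z $ 0 = 0" and d: "d > 0"
  shows "(phi_fps Z * hpow Z (- real d / 2 - 1)) $ d = 0"
proof -
  define G where "G = hpow Z (- real d / 2)"
  have G': "fps_deriv G = fps_const (- real d / 2) * fps_deriv Z * hpow Z (- real d / 2 - 1)"
    unfolding G_def by (rule fps_deriv_hpow[OF Z])
  have "hpow Z (- real d / 2 - 1) * hpow Z 1 = G"
    unfolding G_def by (simp add: hpow_add[OF Z, symmetric])
  then have 1: "(1 + Z) * hpow Z (- real d / 2 - 1) = G"
    by (simp add: hpow_1[OF Z] mult.commute)
  have "fps_const (- 1 / real d) * fps_deriv G =
      (fps_const (- 1 / real d) * fps_const (- real d / 2)) * fps_deriv Z * hpow Z (- real d / 2 - 1)"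
    unfolding G' by (simp only: mult.assoc)
  also have "fps_const (- 1 / real d) * fps_const (- real d / 2) = fps_const (1 / 2)"
    using d by simp
  finally have 2: "fps_const (1 / 2) * fps_deriv Z * hpow Z (- real d / 2 - 1) =
      fps_const (- 1 / real d) * fps_deriv G" by simp
  have "phi_fps Z * hpow Z (- real d / 2 - 1) =
      (1 + Z) * hpow Z (- real d / 2 - 1) + fps_X * (fps_const (1 / 2) * fps_deriv Z * hpow Z (- real d / 2 - 1))"
    by (simp add: phi_fps_def algebra_simps)
  also have "\<dots> = G + fps_X * (fps_const (- 1 / real d) * fps_deriv G)"
    by (simp only: 1 2)
  \<comment> \<open>The coefficient of X^d in X G' is d times that in G, so the terms cancel. In
    terms of y: the exact form y^(-d-1) dy has no residue.\<close>
  finally show ?thesis using d by simp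
qed

text \<open>\<open>?A l k\<close> is the coefficient of X^l in y^k y', and \<open>?w\<close> pairs a
  series with y^(-j-1) under the residue. Both matrices are triangular with unit diagonal, and they
  are mutually inverse because y^k y' y^(-j-1) has residue 0 for k < j.\<close>

lemma lagrange_inversion:
  assumes Z: "Z $ 0 = 0"
  shows "eta j = (\<Sum>k\<le>j. lagrange_coeff Z eta k * (phi_fps Z * hpow Z ((real k - 1) / 2)) $ (j - k))"
proof (induction j rule: less_induct)
  case (less j)
  let ?A = "\<lambda>l k. (phi_fps Z * hpow Z ((real k - 1) / 2)) $ (l - k)"
  let ?w = "\<lambda>l. hpow Z (- (real j + 1) / 2) $ (j - l)"
  have phi0: "phi_fps Z $ 0 = 1" using Z by (simp add: phi_fps_def)
  \<comment> \<open>The exponents (k-1)/2 and -(j+1)/2 add up to -d/2 - 1 with d = j - k, the case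
    of \<open>phi_hpow_nth\<close>. The diagonal term is split off since \<open>?w j\<close> =
    1.\<close>
  have conv: "(\<Sum>l\<in>{k..<j}. ?w l * ?A l k) = - ?A j k" if k: "k < j" for k
  proof -
    define d where "d = j - k"
    have d: "d > 0" "j = k + d" using k by (auto simp: d_def)
    have "phi_fps Z * hpow Z (- real d / 2 - 1) =
        (phi_fps Z * hpow Z ((real k - 1) / 2)) * hpow Z (- (real j + 1) / 2)"
      proof -
      have "(real k - 1) / 2 + - (real j + 1) / 2 = - real d / 2 - 1"
        by (simp add: d field_simps)
      then show ?thesis by (simp only: mult.assoc hpow_add[OF Z, symmetric])
    qed
    then have "0 = ((phi_fps Z * hpow Z ((real k - 1) / 2)) * hpow Z (- (real j + 1) / 2)) $ d"
      using phi_hpow_nth[OF Z d(1)] by (simp only:)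
    also have "\<dots> = (\<Sum>i=0..d. (phi_fps Z * hpow Z ((real k - 1) / 2)) $ i * hpow Z (- (real j + 1) / 2) $ (d - i))"
      by (rule fps_mult_nth)
    also have "\<dots> = (\<Sum>l\<in>{k..j}. ?w l * ?A l k)"
      by (rule sum.reindex_bij_witness[of _ "\<lambda>l. l - k" "\<lambda>i. i + k"]) (auto simp: d(2))
    also have "\<dots> = (\<Sum>l\<in>{k..<j}. ?w l * ?A l k) + ?w j * ?A j k"
    proof -
      have "{k..j} = insert j {k..<j}" using k by auto
      then show ?thesis by simp
    qed
    finally show ?thesis by simp
  qed
  have "lagrange_coeff Z eta j = (\<Sum>l<j. eta l * ?w l) + eta j"
    by (simp add: lagrange_coeff_def lessThan_Suc_atMost[symmetric])
  \<comment> \<open>Every \<open>eta l\<close> with l < j is replaced by its expansion from the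
    induction hypothesis; exchanging the sums makes \<open>conv\<close> applicable.\<close>
  also have "(\<Sum>l<j. eta l * ?w l) = (\<Sum>l<j. \<Sum>k\<le>l. lagrange_coeff Z eta k * ?A l k * ?w l)"
    using less by (simp add: sum_distrib_right)
  also have "\<dots> = (\<Sum>k<j. \<Sum>l\<in>{k..<j}. lagrange_coeff Z eta k * ?A l k * ?w l)"
    unfolding sum.Sigma[OF finite_lessThan ballI[OF finite_atMost]] sum.Sigma[OF finite_lessThan ballI[OF finite_atLeastLessThan]]
    by (rule sum.reindex_bij_witness[of _ "\<lambda>(k, l). (l, k)" "\<lambda>(l, k). (k, l)"]) auto
  also have "\<dots> = (\<Sum>k<j. lagrange_coeff Z eta k * (\<Sum>l\<in>{k..<j}. ?w l * ?A l k))"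
    by (simp add: sum_distrib_left mult_ac)
  also have "\<dots> = - (\<Sum>k<j. lagrange_coeff Z eta k * ?A j k)"
  proof -
    have "(\<Sum>k<j. lagrange_coeff Z eta k * (\<Sum>l\<in>{k..<j}. ?w l * ?A l k)) =
        (\<Sum>k<j. - (lagrange_coeff Z eta k * ?A j k))"
      by (intro sum.cong refl) (simp only: conv lessThan_iff mult_minus_right)
    then show ?thesis by (simp only: sum_negf)
  qed
  finally show ?case
    using phi0 by (simp add: lessThan_Suc_atMost[symmetric])
qed

text \<open>The coefficient of a power is a sum over compositions of d into j parts, and the shift
  n_i = v_i + 2 turns it into the tuple sum of \<open>varpi\<close>.\<close>

lemma ratio_fps_power_nth:
  assumes j: "j \<ge> 1" and d: "d \<le> 2 * n"
  shows "(ratio_fps lam ^ j) $ d =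
    1 / lam 2 ^ j * (\<Sum>ns\<in>index_tuples (2 * n + 3) j (d + 2 * j). \<Prod>i<j. lam (ns ! i))"
proof -
  let ?Z = "ratio_fps lam"
  let ?S = "{v \<in> natpermute d j. 0 \<notin> set v}"
  have "(?Z ^ j) $ d = (\<Sum>v\<in>natpermute d j. \<Prod>i<j. ?Z $ (v ! i))"
    using j by (cases j) (simp_all add: fps_power_nth lessThan_Suc_atMost atLeast0AtMost del: power_Suc)
  \<comment> \<open>Z has no constant term, so compositions with a zero part contribute nothing;
    this becomes the condition n_i >= 3.\<close>
  also have "\<dots> = (\<Sum>v\<in>?S. \<Prod>i<j. ?Z $ (v ! i))"
  proof (rule sum.mono_neutral_right)
    show "\<forall>v\<in>natpermute d j - ?S. (\<Prod>i<j. ?Z $ (v ! i)) = 0"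
    proof
      fix v assume "v \<in> natpermute d j - ?S"
      then obtain i where "i < j" "v ! i = 0"
        by (auto simp: natpermute_def in_set_conv_nth)
      then show "(\<Prod>i<j. ?Z $ (v ! i)) = 0"
        by (intro prod_zero bexI[of _ i]) (auto simp: ratio_fps_def)
    qed
  qed (auto simp: natpermute_finite)
  also have "\<dots> = (\<Sum>ns\<in>index_tuples (2 * n + 3) j (d + 2 * j). \<Prod>i<j. lam (ns ! i) / lam 2)"
  proof (rule sum.reindex_bij_witness[of _ "map (\<lambda>i. i - 2)" "map (\<lambda>i. i + 2)"])
    fix v assume "v \<in> ?S"
    then have v: "length v = j" "sum_list v = d" "0 \<notin> set v" by (auto simp: natpermute_def)
    show "map (\<lambda>i. i - 2) (map (\<lambda>i. i + 2) v) = v" by (simp add: o_def)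
    have "i \<le> d" if "i \<in> set v" for i using member_le_sum_list[OF that] v by simp
    moreover have "i \<noteq> 0" if "i \<in> set v" for i using v that by metis
    \<comment> \<open>A part is at most d \<le> 2n, so the upper limit 2n+3 excludes no
      tuple.\<close>
    ultimately have "i + 2 \<in> {3..2 * n + 3}" if "i \<in> set v" for i using d that by fastforce
    moreover have "sum_list (map (\<lambda>i. i + 2) v) = d + 2 * j"
      using v by (simp only: sum_list_addf sum_list_triv) simp
    ultimately show "map (\<lambda>i. i + 2) v \<in> index_tuples (2 * n + 3) j (d + 2 * j)"
      using v by (auto simp: index_tuples_def)
    show "(\<Prod>i<j. lam (map (\<lambda>i. i + 2) v ! i) / lam 2) = (\<Prod>i<j. ?Z $ (v ! i))"
      using v by (intro prod.cong) (auto simp: ratio_fps_def in_set_conv_nth)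
  next
    fix ns assume "ns \<in> index_tuples (2 * n + 3) j (d + 2 * j)"
    then have ns: "length ns = j" "sum_list ns = d + 2 * j" "set ns \<subseteq> {3..2 * n + 3}"
      by (auto simp: index_tuples_def)
    show eq: "map (\<lambda>i. i + 2) (map (\<lambda>i. i - 2) ns) = ns"
      unfolding map_map by (rule map_idI) (auto dest!: subsetD[OF ns(3)])
    have "sum_list (map (\<lambda>i. i + 2) (map (\<lambda>i. i - 2) ns)) = d + 2 * j"
      unfolding eq by (rule ns)
    then have "sum_list (map (\<lambda>i. i - 2) ns) = d"
      using ns(1) by (simp only: sum_list_addf sum_list_triv map_ident length_map) simp
    then show "map (\<lambda>i. i - 2) ns \<in> ?S"
      using ns by (auto simp: natpermute_def)
  qed
  also have "\<dots> = 1 / lam 2 ^ j * (\<Sum>ns\<in>index_tuples (2 * n + 3) j (d + 2 * j). \<Prod>i<j. lam (ns ! i))"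
    by (simp add: sum_distrib_left prod_dividef)
  finally show ?thesis .
qed

text \<open>This identifies the numerical constants: C_{klj} is the binomial coefficient of -(k+1)/2
  over j, from the binomial series of (1 + Z)^(-(k+1)/2). For l < k the term j = 0 drops out, having
  no coefficient in positive degree.\<close>

lemma varpi_eq_lagrange_coeff:
  assumes k: "k \<le> 2 * n"
  shows "varpi (\<lambda>k l j. (- (real k + 1) / 2) gchoose j) n lam eta k = lagrange_coeff (ratio_fps lam) eta k"
proof -
  let ?Z = "ratio_fps lam"
  have coeff: "hpow ?Z (- (real k + 1) / 2) $ (k - l) =
      (\<Sum>j=1..k - l. ((- (real k + 1) / 2) gchoose j) / lam 2 ^ j *
       (\<Sum>ns\<in>index_tuples (2 * n + 3) j (k - l + 2 * j). \<Prod>i<j. lam (ns ! i)))" if l: "l < k" for l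
  proof -
    have "hpow ?Z (- (real k + 1) / 2) $ (k - l) =
        (\<Sum>j\<in>{0..k - l}. ((- (real k + 1) / 2) gchoose j) * (?Z ^ j) $ (k - l))"
      by (simp add: hpow_def fps_compose_nth)
    also have "\<dots> = (\<Sum>j\<in>{1..k - l}. ((- (real k + 1) / 2) gchoose j) * (?Z ^ j) $ (k - l))"
      using l by (intro sum.mono_neutral_right) (auto simp: not_less_eq_eq Suc_le_eq)
    also have "\<dots> = (\<Sum>j=1..k - l. ((- (real k + 1) / 2) gchoose j) / lam 2 ^ j *
       (\<Sum>ns\<in>index_tuples (2 * n + 3) j (k - l + 2 * j). \<Prod>i<j. lam (ns ! i)))"
      using k by (intro sum.cong refl) (simp add: ratio_fps_power_nth[of _ _ n])
    finally show ?thesis .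
  qed
  have "lagrange_coeff ?Z eta k = eta k + (\<Sum>l<k. eta l * hpow ?Z (- (real k + 1) / 2) $ (k - l))"
    by (simp add: lagrange_coeff_def lessThan_Suc_atMost[symmetric])
  also have "(\<Sum>l<k. eta l * hpow ?Z (- (real k + 1) / 2) $ (k - l)) =
      (\<Sum>l<k. eta l * (\<Sum>j=1..k - l. ((- (real k + 1) / 2) gchoose j) / lam 2 ^ j *
       (\<Sum>ns\<in>index_tuples (2 * n + 3) j (k - l + 2 * j). \<Prod>i<j. lam (ns ! i))))"
    by (intro sum.cong refl) (simp only: coeff lessThan_iff)
  finally show ?thesis by (simp only: varpi_def)
qed

section \<open>Taylor expansions of finite order\<close>

text \<open>Differentiation lowers exponent and order together, by absorption of binomial
  coefficients. For J = 0 the truncated J - 1 is again 0 and both sums are empty.\<close>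

lemma binomial_remainder_deriv:
  fixes b z :: real
  assumes "1 + z > 0"
  shows "((\<lambda>z. (1 + z) powr b - (\<Sum>j<J. (b gchoose j) * z ^ j)) has_real_derivative
    b * ((1 + z) powr (b - 1) - (\<Sum>j<J - 1. ((b - 1) gchoose j) * z ^ j))) (at z)"
proof -
  have "((\<lambda>z. (1 + z) powr b - (\<Sum>j<J. (b gchoose j) * z ^ j)) has_real_derivative
    b * (1 + z) powr (b - 1) - (\<Sum>j<J. (b gchoose j) * (of_nat j * z ^ (j - Suc 0)))) (at z)"
    using assms by (intro DERIV_diff DERIV_sum) (auto intro!: derivative_eq_intros)
  moreover have "(\<Sum>j<J. (b gchoose j) * (of_nat j * z ^ (j - Suc 0))) = b * (\<Sum>j<J - 1. ((b - 1) gchoose j) * z ^ j)"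
  proof (cases J)
    case (Suc I)
    have "(\<Sum>j<J. (b gchoose j) * (of_nat j * z ^ (j - Suc 0))) = (\<Sum>j<I. (of_nat (Suc j) * (b gchoose Suc j)) * z ^ j)"
      unfolding Suc by (subst sum.lessThan_Suc_shift) (simp add: mult_ac del: of_nat_Suc)
    also have "\<dots> = (\<Sum>j<I. b * (((b - 1) gchoose j) * z ^ j))"
      by (simp only: gbinomial_absorption mult.assoc)
    finally show ?thesis by (simp add: Suc sum_distrib_left)
  qed simp
  ultimately show ?thesis by (simp add: right_diff_distrib)
qed

text \<open>Here z may exceed 1, where the binomial series diverges; only the finite remainder is
  controlled, by induction on its order with the mean value theorem. The base case is compactness of
  the range of 1 + z.\<close>

lemma binomial_remainder_bound:
  fixes \<kappa>1 \<kappa>2 b :: real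
  assumes \<kappa>: "0 < \<kappa>1" "\<kappa>1 \<le> 1" "1 \<le> \<kappa>2"
  shows "\<exists>K\<ge>0. \<forall>z. 1 + z \<in> {\<kappa>1..\<kappa>2} \<longrightarrow> \<bar>(1 + z) powr b - (\<Sum>j<J. (b gchoose j) * z ^ j)\<bar> \<le> K * \<bar>z\<bar> ^ J"
proof (induction J arbitrary: b)
  case 0
  have "bounded ((\<lambda>t. t powr b) ` {\<kappa>1..\<kappa>2})"
    using \<kappa> by (intro compact_imp_bounded compact_continuous_image continuous_intros) auto
  then obtain K where "K > 0" "\<forall>t\<in>{\<kappa>1..\<kappa>2}. \<bar>t powr b\<bar> \<le> K"
    unfolding bounded_pos by auto
  then show ?case by (intro exI[of _ K]) auto
next
  case (Suc J)
  let ?G = "\<lambda>b J z. (1 + z) powr b - (\<Sum>j<J. (b gchoose j) * z ^ j)"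
  obtain K where K: "K \<ge> 0" "\<And>z. 1 + z \<in> {\<kappa>1..\<kappa>2} \<Longrightarrow> \<bar>?G (b - 1) J z\<bar> \<le> K * \<bar>z\<bar> ^ J"
    using Suc.IH[of "b - 1"] by blast
  show ?case
  proof (intro exI[of _ "\<bar>b\<bar> * K"] conjI allI impI)
    fix z :: real assume z: "1 + z \<in> {\<kappa>1..\<kappa>2}"
    have G0: "?G b (Suc J) 0 = 0" by (simp add: sum.lessThan_Suc_shift)
    have "\<exists>\<xi>. 1 + \<xi> \<in> {\<kappa>1..\<kappa>2} \<and> \<bar>\<xi>\<bar> \<le> \<bar>z\<bar> \<and> ?G b (Suc J) z = z * (b * ?G (b - 1) J \<xi>)"
    proof -
      have der: "(?G b (Suc J) has_real_derivative b * ?G (b - 1) J t) (at t)" if "1 + t \<ge> \<kappa>1" for t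
        using binomial_remainder_deriv[of t b "Suc J"] that \<kappa> by simp
      consider "z = 0" | "z > 0" | "z < 0" by linarith
      then show ?thesis
      proof cases
        case 1 then show ?thesis using G0 \<kappa> by (intro exI[of _ 0]) auto
      next
        case 2
        obtain \<xi> where "0 < \<xi>" "\<xi> < z" "?G b (Suc J) z - ?G b (Suc J) 0 = (z - 0) * (b * ?G (b - 1) J \<xi>)"
          using MVT2[OF 2, of "?G b (Suc J)" "\<lambda>t. b * ?G (b - 1) J t"] der \<kappa> by auto
        then show ?thesis using G0 z \<kappa> by (intro exI[of _ \<xi>]) auto
      next
        case 3
        obtain \<xi> where "z < \<xi>" "\<xi> < 0" "?G b (Suc J) 0 - ?G b (Suc J) z = (0 - z) * (b * ?G (b - 1) J \<xi>)"
          using MVT2[OF 3, of "?G b (Suc J)" "\<lambda>t. b * ?G (b - 1) J t"] der z \<kappa> by auto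
        then show ?thesis using G0 z \<kappa> by (intro exI[of _ \<xi>]) auto
      qed
    qed
    then obtain \<xi> where \<xi>: "1 + \<xi> \<in> {\<kappa>1..\<kappa>2}" "\<bar>\<xi>\<bar> \<le> \<bar>z\<bar>" "?G b (Suc J) z = z * (b * ?G (b - 1) J \<xi>)"
      by blast
    have "\<bar>?G b (Suc J) z\<bar> = \<bar>b\<bar> * \<bar>?G (b - 1) J \<xi>\<bar> * \<bar>z\<bar>" unfolding \<xi>(3) by (simp add: abs_mult)
    also have "\<dots> \<le> \<bar>b\<bar> * (K * \<bar>\<xi>\<bar> ^ J) * \<bar>z\<bar>"
      by (intro mult_right_mono mult_left_mono K \<xi>) auto
    also have "\<dots> \<le> \<bar>b\<bar> * (K * \<bar>z\<bar> ^ J) * \<bar>z\<bar>"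
      by (intro mult_right_mono mult_left_mono power_mono K \<xi>) auto
    finally show "\<bar>?G b (Suc J) z\<bar> \<le> \<bar>b\<bar> * K * \<bar>z\<bar> ^ Suc J" by (simp add: mult_ac)
  qed (use K in auto)
qed

context pointed_intervals
begin

text \<open>The function is \<open>F\<close> up to order \<open>K\<close>, with size \<open>B\<close> on the scale \<open>M\<close>.\<close>

definition expansion :: "nat \<Rightarrow> nat \<Rightarrow> ('p \<Rightarrow> real) \<Rightarrow> ('p \<Rightarrow> real \<Rightarrow> real) \<Rightarrow> ('p \<Rightarrow> real fps) \<Rightarrow> bool" where
  "expansion m K B q F \<longleftrightarrow>
     (\<forall>k<K. dominated (\<lambda>p x. F p $ k) (\<lambda>p x. B p / M p ^ k)) \<and>
     symbol m (\<lambda>p x. B p * (r p x / M p) ^ K) (\<lambda>p x. q p x - (\<Sum>k<K. F p $ k * (x - c p) ^ k))"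

lemma ratio_le_1: "p \<in> P \<Longrightarrow> x \<in> D p \<Longrightarrow> 0 \<le> r p x / M p \<and> r p x / M p \<le> 1"
  using r_le_M[of p x] M_pos[of p] by simp

lemma ratio_power_mono:
  assumes "p \<in> P" "x \<in> D p" "i \<le> j"
  shows "(r p x / M p) ^ j \<le> (r p x / M p) ^ i"
  using ratio_le_1[OF assms(1,2)] assms(3) by (intro power_decreasing) auto

lemma dominated_sum:
  "(\<And>i. i \<in> A \<Longrightarrow> dominated (q i) W) \<Longrightarrow> dominated (\<lambda>p x. \<Sum>i\<in>A. q i p x) W"
  by (induction A rule: infinite_finite_induct) (auto intro: dominated_add)

lemma dominated_cmult:
  assumes "dominated q W" shows "dominated (\<lambda>p x. k * q p x :: real) W"
  using dominated_scale[OF assms, of k] by simp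

lemma symbol_monomial:
  assumes "dominated (\<lambda>p x. A p) (\<lambda>p x. B p / M p ^ j)"
  shows "symbol m (\<lambda>p x. B p * (r p x / M p) ^ j) (\<lambda>p x. A p * (x - c p) ^ j)"
  by (rule symbol_cong'[OF symbol_mult[OF symbol_const[OF assms] symbol_power[OF symbol_id]]])
     (auto simp: power_divide)

lemma expansion_poly:
  assumes "expansion m K B q F" "\<And>p. p \<in> P \<Longrightarrow> B p \<ge> 0"
  shows "symbol m (\<lambda>p x. B p) (\<lambda>p x. \<Sum>k<K. F p $ k * (x - c p) ^ k)"
proof (rule symbol_sum)
  fix k assume "k \<in> {..<K}"
  then have "symbol m (\<lambda>p x. B p * (r p x / M p) ^ k) (\<lambda>p x. F p $ k * (x - c p) ^ k)"
    using assms by (intro symbol_monomial) (auto simp: expansion_def)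
  then show "symbol m (\<lambda>p x. B p) (\<lambda>p x. F p $ k * (x - c p) ^ k)"
    by (rule symbol_mono)
       (use assms(2) ratio_power_mono[of _ _ 0 k] ratio_le_1 in \<open>auto intro!: mult_right_le_one_le mult_nonneg_nonneg simp del: power_divide\<close>)
qed

lemma expansion_sym:
  assumes "expansion m K B q F" "\<And>p. p \<in> P \<Longrightarrow> B p \<ge> 0"
  shows "symbol m (\<lambda>p x. B p) q"
proof -
  have "symbol m (\<lambda>p x. B p * (r p x / M p) ^ K) (\<lambda>p x. q p x - (\<Sum>k<K. F p $ k * (x - c p) ^ k))"
    using assms(1) by (simp add: expansion_def)
  then have "symbol m (\<lambda>p x. B p) (\<lambda>p x. q p x - (\<Sum>k<K. F p $ k * (x - c p) ^ k))"
    by (rule symbol_mono)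
       (use assms(2) ratio_power_mono[of _ _ 0 K] ratio_le_1 in \<open>auto intro!: mult_right_le_one_le mult_nonneg_nonneg simp del: power_divide\<close>)
  from symbol_add[OF this expansion_poly[OF assms]] show ?thesis by simp
qed

lemma expansion_cong:
  assumes "expansion m K B q F" "\<And>p k. p \<in> P \<Longrightarrow> k < K \<Longrightarrow> F p $ k = G p $ k"
    "\<And>p x. p \<in> P \<Longrightarrow> x \<in> D p \<Longrightarrow> q p x = q2 p x"
  shows "expansion m K B q2 G"
  unfolding expansion_def
proof (intro conjI allI impI)
  fix k assume "k < K"
  then show "dominated (\<lambda>p x. G p $ k) (\<lambda>p x. B p / M p ^ k)"
    using assms dominated_cong[of "\<lambda>p x. F p $ k" "\<lambda>p x. G p $ k" "\<lambda>p x. B p / M p ^ k" "\<lambda>p x. B p / M p ^ k"]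
    by (simp add: expansion_def)
next
  have "symbol m (\<lambda>p x. B p * (r p x / M p) ^ K) (\<lambda>p x. q p x - (\<Sum>k<K. F p $ k * (x - c p) ^ k))"
    using assms(1) by (simp add: expansion_def)
  then show "symbol m (\<lambda>p x. B p * (r p x / M p) ^ K) (\<lambda>p x. q2 p x - (\<Sum>k<K. G p $ k * (x - c p) ^ k))"
    by (rule symbol_cong) (simp add: assms(2,3))
qed

lemma expansion_0: "expansion m K B (\<lambda>p x. 0) (\<lambda>p. 0)"
  by (simp add: expansion_def)

lemma expansion_1: "K > 0 \<Longrightarrow> expansion m K (\<lambda>p. 1) (\<lambda>p x. 1) (\<lambda>p. 1)"
proof -
  assume "K > 0"
  have "dominated (\<lambda>p x. 1 $ k :: real) (\<lambda>p x. 1 / M p ^ k)" for k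
    by (rule dominatedI[of _ 1]) (use M_pos in \<open>auto intro!: less_imp_le\<close>)
  moreover have "(\<Sum>k<K. 1 $ k * (x - c p) ^ k) = 1" for x p
    using \<open>K > 0\<close> by (subst sum.remove[of _ 0]) (auto intro!: sum.neutral)
  ultimately show ?thesis by (simp add: expansion_def)
qed

lemma expansion_remainder:
  "symbol m (\<lambda>p x. B p * (r p x / M p) ^ K) q \<Longrightarrow> expansion m K B q (\<lambda>p. 0)"
  by (simp add: expansion_def)

lemma expansion_add:
  assumes "expansion m K B q1 F1" "expansion m K B q2 F2"
  shows "expansion m K B (\<lambda>p x. q1 p x + q2 p x) (\<lambda>p. F1 p + F2 p)"
  unfolding expansion_def
proof (intro conjI allI impI)
  fix k assume "k < K"
  then show "dominated (\<lambda>p x. (F1 p + F2 p) $ k) (\<lambda>p x. B p / M p ^ k)"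
    using assms by (simp add: expansion_def dominated_add)
next
  have "symbol m (\<lambda>p x. B p * (r p x / M p) ^ K)
     (\<lambda>p x. (q1 p x - (\<Sum>k<K. F1 p $ k * (x - c p) ^ k)) + (q2 p x - (\<Sum>k<K. F2 p $ k * (x - c p) ^ k)))"
    using assms by (intro symbol_add) (simp_all add: expansion_def)
  then show "symbol m (\<lambda>p x. B p * (r p x / M p) ^ K)
     (\<lambda>p x. q1 p x + q2 p x - (\<Sum>k<K. (F1 p + F2 p) $ k * (x - c p) ^ k))"
    by (rule symbol_cong) (simp add: algebra_simps sum.distrib)
qed

lemma expansion_cmult:
  assumes "expansion m K B q F"
  shows "expansion m K B (\<lambda>p x. k * q p x) (\<lambda>p. fps_const k * F p)"
  unfolding expansion_def
proof (intro conjI allI impI)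
  fix i assume "i < K"
  then show "dominated (\<lambda>p x. (fps_const k * F p) $ i) (\<lambda>p x. B p / M p ^ i)"
    using assms by (simp add: expansion_def dominated_cmult)
next
  have "symbol m (\<lambda>p x. B p * (r p x / M p) ^ K)
     (\<lambda>p x. k * (q p x - (\<Sum>k<K. F p $ k * (x - c p) ^ k)))"
    using assms by (intro symbol_cmult) (simp add: expansion_def)
  then show "symbol m (\<lambda>p x. B p * (r p x / M p) ^ K)
     (\<lambda>p x. k * q p x - (\<Sum>i<K. (fps_const k * F p) $ i * (x - c p) ^ i))"
    by (rule symbol_cong) (simp add: algebra_simps sum_distrib_left)
qed

lemma expansion_sum:
  "(\<And>i. i \<in> A \<Longrightarrow> expansion m K B (q i) (F i)) \<Longrightarrow>
   expansion m K B (\<lambda>p x. \<Sum>i\<in>A. q i p x) (\<lambda>p. \<Sum>i\<in>A. F i p)"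
  by (induction A rule: infinite_finite_induct) (auto intro: expansion_add expansion_0)

text \<open>With polynomials p1, p2 and truncated product t, the remainder is (q1 - p1) q2 + p1 (q2
  - p2) + (p1 p2 - t), and the last bracket has only monomials of degree at least
  \<open>K\<close>.\<close>

lemma expansion_mult:
  assumes 1: "expansion m K B1 q1 F1" and 2: "expansion m K B2 q2 F2"
    and B: "\<And>p. p \<in> P \<Longrightarrow> B1 p \<ge> 0" "\<And>p. p \<in> P \<Longrightarrow> B2 p \<ge> 0"
  shows "expansion m K (\<lambda>p. B1 p * B2 p) (\<lambda>p x. q1 p x * q2 p x) (\<lambda>p. F1 p * F2 p)"
proof -
  have coeff: "dominated (\<lambda>p x. F1 p $ i * F2 p $ j) (\<lambda>p x. (B1 p * B2 p) / M p ^ (i + j))"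
    if "i < K" "j < K" for i j
  proof -
    have "dominated (\<lambda>p x. F1 p $ i * F2 p $ j) (\<lambda>p x. (B1 p / M p ^ i) * (B2 p / M p ^ j))"
      using 1 2 that by (intro dominated_mult) (auto simp: expansion_def)
    then show ?thesis by (simp add: power_add)
  qed
  let ?p1 = "\<lambda>p x. \<Sum>k<K. F1 p $ k * (x - c p) ^ k"
  let ?p2 = "\<lambda>p x. \<Sum>k<K. F2 p $ k * (x - c p) ^ k"
  let ?t = "\<lambda>p x. \<Sum>k<K. (F1 p * F2 p) $ k * (x - c p) ^ k"
  let ?I = "{(i, j) \<in> {..<K} \<times> {..<K}. \<not> i + j < K}"
  let ?h = "\<lambda>p x. \<Sum>(i, j)\<in>?I. (F1 p $ i * F2 p $ j) * (x - c p) ^ (i + j)"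
  let ?W = "\<lambda>p x. (B1 p * B2 p) * (r p x / M p) ^ K"
  have split: "?p1 p x * ?p2 p x - ?t p x = ?h p x" for p x
  proof -
    let ?g = "\<lambda>i j. (F1 p $ i * F2 p $ j) * (x - c p) ^ (i + j)"
    have "?p1 p x * ?p2 p x = (\<Sum>(i, j)\<in>{..<K} \<times> {..<K}. ?g i j)"
      by (simp add: sum_product sum.cartesian_product power_add mult_ac)
    also have "{..<K} \<times> {..<K} = {(i, j). i + j < K} \<union> ?I" by auto
    also have "(\<Sum>(i, j)\<in>{(i, j). i + j < K} \<union> ?I. ?g i j) = (\<Sum>(i, j)\<in>{(i, j). i + j < K}. ?g i j) + ?h p x"
    proof (rule sum.union_disjoint)
      show "finite {(i, j). i + j < K}"
        by (rule finite_subset[of _ "{..<K} \<times> {..<K}"]) auto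
      show "finite ?I"
        by (rule finite_subset[of _ "{..<K} \<times> {..<K}"]) auto
    qed auto
    also have "(\<Sum>(i, j)\<in>{(i, j). i + j < K}. ?g i j) = (\<Sum>k<K. \<Sum>i\<le>k. ?g i (k - i))"
      by (rule sum.triangle_reindex)
    also have "\<dots> = ?t p x"
      by (simp add: fps_mult_nth atLeast0AtMost sum_distrib_right)
    finally show ?thesis by simp
  qed
  have h: "symbol m ?W ?h"
  proof (rule symbol_cong[OF symbol_sum[where q = "\<lambda>ij p x. (F1 p $ fst ij * F2 p $ snd ij) * (x - c p) ^ (fst ij + snd ij)"]])
    fix ij assume ij: "ij \<in> ?I"
    have "symbol m (\<lambda>p x. (B1 p * B2 p) * (r p x / M p) ^ (fst ij + snd ij))
        (\<lambda>p x. (F1 p $ fst ij * F2 p $ snd ij) * (x - c p) ^ (fst ij + snd ij))"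
      using ij by (intro symbol_monomial coeff) auto
    then show "symbol m ?W (\<lambda>p x. (F1 p $ fst ij * F2 p $ snd ij) * (x - c p) ^ (fst ij + snd ij))"
      by (rule symbol_mono)
         (use ij B M_pos in \<open>auto intro!: mult_left_mono ratio_power_mono mult_nonneg_nonneg simp: less_imp_le simp del: power_divide\<close>)
  qed (auto simp: case_prod_beta)
  have r1: "symbol m (\<lambda>p x. B1 p * (r p x / M p) ^ K) (\<lambda>p x. q1 p x - ?p1 p x)"
    and r2: "symbol m (\<lambda>p x. B2 p * (r p x / M p) ^ K) (\<lambda>p x. q2 p x - ?p2 p x)"
    using 1 2 by (simp_all add: expansion_def)
  have "symbol m ?W (\<lambda>p x. (q1 p x - ?p1 p x) * q2 p x)"
    by (rule symbol_cong'[OF symbol_mult[OF r1 expansion_sym[OF 2 B(2)]]]) auto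
  moreover have "symbol m ?W (\<lambda>p x. ?p1 p x * (q2 p x - ?p2 p x))"
    by (rule symbol_cong'[OF symbol_mult[OF expansion_poly[OF 1 B(1)] r2]]) auto
  ultimately have "symbol m ?W (\<lambda>p x. (q1 p x - ?p1 p x) * q2 p x + ?p1 p x * (q2 p x - ?p2 p x) + ?h p x)"
    using h by (intro symbol_add)
  then have "symbol m ?W (\<lambda>p x. q1 p x * q2 p x - ?t p x)"
  proof (rule symbol_cong)
    fix p x
    show "(q1 p x - ?p1 p x) * q2 p x + ?p1 p x * (q2 p x - ?p2 p x) + ?h p x = q1 p x * q2 p x - ?t p x"
      unfolding split[symmetric] by (simp add: algebra_simps)
  qed
  moreover have "dominated (\<lambda>p x. (F1 p * F2 p) $ k) (\<lambda>p x. (B1 p * B2 p) / M p ^ k)" if "k < K" for k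
    unfolding fps_mult_nth
  proof (rule dominated_sum)
    fix i assume "i \<in> {0..k}"
    then show "dominated (\<lambda>p x. F1 p $ i * F2 p $ (k - i)) (\<lambda>p x. (B1 p * B2 p) / M p ^ k)"
      using coeff[of i "k - i"] that by simp
  qed
  ultimately show ?thesis by (simp add: expansion_def)
qed

lemma expansion_power:
  assumes "expansion m K (\<lambda>p. 1) q F" "K > 0"
  shows "expansion m K (\<lambda>p. 1) (\<lambda>p x. q p x ^ j) (\<lambda>p. F p ^ j)"
proof (induction j)
  case (Suc j)
  from expansion_mult[OF assms(1) Suc] show ?case by simp
qed (use expansion_1[OF assms(2)] in simp)

text \<open>A vanishing constant term gains one factor \<open>r / M\<close>, which makes powers of z
  small to the corresponding order.\<close>

lemma expansion_sym_vanishing: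
  assumes "expansion m K (\<lambda>p. 1) z Z" "\<And>p. p \<in> P \<Longrightarrow> Z p $ 0 = 0" "K > 0"
  shows "symbol m (\<lambda>p x. r p x / M p) z"
proof -
  have mono: "symbol m (\<lambda>p x. r p x / M p) q" if "symbol m (\<lambda>p x. 1 * (r p x / M p) ^ j) q" "j \<ge> 1" for j and q :: "'p \<Rightarrow> real \<Rightarrow> real"
    by (rule symbol_mono[OF that(1)])
       (use ratio_power_mono[of _ _ 1 j] that(2) M_pos in \<open>auto simp: less_imp_le simp del: power_divide\<close>)
  have "symbol m (\<lambda>p x. r p x / M p) (\<lambda>p x. \<Sum>k<K. Z p $ k * (x - c p) ^ k)"
  proof (rule symbol_sum)
    fix k assume k: "k \<in> {..<K}"
    show "symbol m (\<lambda>p x. r p x / M p) (\<lambda>p x. Z p $ k * (x - c p) ^ k)"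
    proof (cases "k = 0")
      case True
      show ?thesis by (rule symbol_cong[OF symbol_0]) (simp add: True assms(2))
    next
      case False
      have "symbol m (\<lambda>p x. 1 * (r p x / M p) ^ k) (\<lambda>p x. Z p $ k * (x - c p) ^ k)"
        using assms(1) k by (intro symbol_monomial) (auto simp: expansion_def)
      then show ?thesis by (rule mono) (use False in auto)
    qed
  qed
  moreover have "symbol m (\<lambda>p x. r p x / M p) (\<lambda>p x. z p x - (\<Sum>k<K. Z p $ k * (x - c p) ^ k))"
    by (rule mono) (use assms in \<open>auto simp: expansion_def\<close>)
  ultimately show ?thesis using symbol_add by force
qed

text \<open>By the chain rule a derivative replaces the order J by J - 1 and brings in z', whose
  weight \<open>(r / M) / r\<close> restores the lost power. The induction must vary both s and
  J.\<close>

lemma symbol_binomial_remainder: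
  fixes z :: "'p \<Rightarrow> real \<Rightarrow> real"
  assumes z: "symbol m (\<lambda>p x. r p x / M p) z"
    and \<kappa>: "0 < \<kappa>1" "\<kappa>1 \<le> 1" "1 \<le> \<kappa>2"
    and zI: "\<And>p x. p \<in> P \<Longrightarrow> x \<in> D p \<Longrightarrow> 1 + z p x \<in> {\<kappa>1..\<kappa>2}"
  shows "symbol m (\<lambda>p x. (r p x / M p) ^ J)
    (\<lambda>p x. (1 + z p x) powr s - (\<Sum>j<J. (s gchoose j) * z p x ^ j))"
proof -
  have base: "dominated (\<lambda>p x. (1 + z p x) powr s - (\<Sum>j<J. (s gchoose j) * z p x ^ j)) (\<lambda>p x. (r p x / M p) ^ J)" for s :: real and J
  proof -
    obtain K where K: "K \<ge> 0" "\<And>z::real. 1 + z \<in> {\<kappa>1..\<kappa>2} \<Longrightarrow> \<bar>(1 + z) powr s - (\<Sum>j<J. (s gchoose j) * z ^ j)\<bar> \<le> K * \<bar>z\<bar> ^ J"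
      using binomial_remainder_bound[OF \<kappa>, of s J] by blast
    have "dominated (\<lambda>p x. (1 + z p x) powr s - (\<Sum>j<J. (s gchoose j) * z p x ^ j)) (\<lambda>p x. \<bar>z p x\<bar> ^ J)"
      by (rule dominatedI[of _ K]) (use K zI in auto)
    moreover have "dominated (\<lambda>p x. \<bar>z p x\<bar> ^ J) (\<lambda>p x. (r p x / M p) ^ J)"
    proof -
      obtain K where "K \<ge> 0" "\<And>p x. p \<in> P \<Longrightarrow> x \<in> D p \<Longrightarrow> norm (z p x) \<le> K * (r p x / M p)"
        using symbol_dominated[OF z] by (rule dominatedE) blast
      then show ?thesis
        by (intro dominatedI[of _ "K ^ J"]) (auto simp: power_abs power_mult_distrib[symmetric] intro!: power_mono simp del: power_divide)
    qed
    ultimately show ?thesis by (rule dominated_trans)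
  qed
  show ?thesis using z
  proof (induction m arbitrary: s J)
    case 0
    show ?case using base by simp
  next
    case (Suc m)
    obtain z' where z': "\<forall>p\<in>P. \<forall>x\<in>D p. (z p has_vector_derivative z' p x) (at x within D p)"
        "symbol m (\<lambda>p x. r p x / M p / r p x) z'"
      using Suc.prems by auto
    let ?G = "\<lambda>s J z. (1 + z) powr s - (\<Sum>j<J. (s gchoose j) * z ^ j)"
    have IH: "symbol m (\<lambda>p x. (r p x / M p) ^ (J - 1)) (\<lambda>p x. ?G (s - 1) (J - 1) (z p x))"
      by (rule Suc.IH[OF symbol_Suc_imp[OF Suc.prems]])
    have "symbol m (\<lambda>p x. (r p x / M p) ^ (J - 1) * (r p x / M p / r p x)) (\<lambda>p x. s * ?G (s - 1) (J - 1) (z p x) * z' p x)"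
      by (rule symbol_mult[OF symbol_cmult[OF IH] z'(2)])
    then have "symbol m (\<lambda>p x. (r p x / M p) ^ J / r p x) (\<lambda>p x. s * ?G (s - 1) (J - 1) (z p x) * z' p x)"
    proof (rule symbol_mono, intro conjI)
      fix p x assume px: "p \<in> P" "x \<in> D p"
      show "0 \<le> (r p x / M p) ^ (J - 1) * (r p x / M p / r p x)"
        using M_pos[OF px(1)] by simp
      have "(r p x / M p) ^ (J - 1) * (r p x / M p) \<le> (r p x / M p) ^ J"
        \<comment> \<open>For J = 0 the left exponent is 1 because J - 1 is truncated; the
          inequality then holds since \<open>r / M\<close> is at most 1.\<close>
        unfolding power_Suc2[symmetric] by (rule ratio_power_mono[OF px]) auto
      then show "(r p x / M p) ^ (J - 1) * (r p x / M p / r p x) \<le> (r p x / M p) ^ J / r p x"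
        unfolding times_divide_eq_right by (intro divide_right_mono) auto
    qed
    moreover have "((\<lambda>x. ?G s J (z p x)) has_vector_derivative (s * ?G (s - 1) (J - 1) (z p x) * z' p x)) (at x within D p)"
      if px: "p \<in> P" "x \<in> D p" for p x
    proof -
      have "((\<lambda>x. ?G s J (z p x)) has_real_derivative (s * ?G (s - 1) (J - 1) (z p x) * z' p x)) (at x within D p)"
        by (rule DERIV_chain2[OF binomial_remainder_deriv])
           (use zI[OF px] \<kappa> z'(1) px in \<open>auto simp: has_real_derivative_iff_has_vector_derivative\<close>)
      then show ?thesis by (simp add: has_real_derivative_iff_has_vector_derivative)
    qed
    ultimately show ?case using base by (intro symbol_SucI)
  qed
qed

text \<open>The binomial polynomial of degree below \<open>K\<close> is expanded termwise and the
  rest is of order \<open>K\<close> in \<open>r / M\<close>. Since Z has no constant term, Z^j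
  starts in degree j, so cutting at j < \<open>K\<close> leaves the coefficients below
  \<open>K\<close> unchanged.\<close>

lemma expansion_powr:
  assumes z: "expansion m K (\<lambda>p. 1) z Z" "\<And>p. p \<in> P \<Longrightarrow> Z p $ 0 = 0" "K > 0"
    and \<kappa>: "0 < \<kappa>1" "\<kappa>1 \<le> 1" "1 \<le> \<kappa>2"
    and zI: "\<And>p x. p \<in> P \<Longrightarrow> x \<in> D p \<Longrightarrow> 1 + z p x \<in> {\<kappa>1..\<kappa>2}"
  shows "expansion m K (\<lambda>p. 1) (\<lambda>p x. (1 + z p x) powr s) (\<lambda>p. hpow (Z p) s)"
proof -
  have "symbol m (\<lambda>p x. 1 * (r p x / M p) ^ K)
      (\<lambda>p x. (1 + z p x) powr s - (\<Sum>j<K. (s gchoose j) * z p x ^ j))"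
    using symbol_binomial_remainder[OF expansion_sym_vanishing[OF z] \<kappa> zI] by simp
  then have "expansion m K (\<lambda>p. 1) (\<lambda>p x. ((1 + z p x) powr s - (\<Sum>j<K. (s gchoose j) * z p x ^ j)) + (\<Sum>j<K. (s gchoose j) * z p x ^ j))
     (\<lambda>p. 0 + (\<Sum>j<K. fps_const (s gchoose j) * Z p ^ j))"
    by (intro expansion_add expansion_remainder expansion_sum expansion_cmult expansion_power z)
  then show ?thesis
  proof (rule expansion_cong)
    fix p k assume pk: "p \<in> P" "k < K"
    have "hpow (Z p) s $ k = (\<Sum>j=0..k. (s gchoose j) * Z p ^ j $ k)"
      by (simp add: hpow_def fps_compose_nth)
    also have "\<dots> = (\<Sum>j<K. (s gchoose j) * Z p ^ j $ k)"
      using pk startsby_zero_power_prefix[OF z(2)[OF pk(1)]]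
      by (intro sum.mono_neutral_left) auto
    finally show "(0 + (\<Sum>j<K. fps_const (s gchoose j) * Z p ^ j)) $ k = hpow (Z p) s $ k"
      by (simp add: fps_sum_nth)
  qed auto
qed

end

section \<open>Fresnel integrals\<close>

text \<open>This is sqrt pi / 2 times the error function; being entire, it can be compared along
  different paths.\<close>

definition gauss_prim :: "complex \<Rightarrow> complex" where
  "gauss_prim = (SOME G. (\<forall>z. (G has_field_derivative exp (- z\<^sup>2)) (at z)) \<and> G 0 = 0)"

lemma gauss_prim: "(gauss_prim has_field_derivative exp (- z\<^sup>2)) (at z)" and gauss_prim_0: "gauss_prim 0 = 0"
proof -
  have "(\<lambda>z::complex. exp (- z\<^sup>2)) holomorphic_on UNIV" by (intro holomorphic_intros)
  then obtain G where "\<And>z::complex. z \<in> UNIV \<Longrightarrow> (G has_field_derivative exp (- z\<^sup>2)) (at z within UNIV)"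
    using holomorphic_convex_primitive'[of UNIV "\<lambda>z. exp (- z\<^sup>2)"] by blast
  then have G: "(G has_field_derivative exp (- z\<^sup>2)) (at z)" for z by simp
  have G': "((\<lambda>z. G z - G 0) has_field_derivative exp (- z\<^sup>2)) (at z)" for z
    using DERIV_diff[OF G DERIV_const] by simp
  have "\<exists>G::complex \<Rightarrow> complex. (\<forall>z. (G has_field_derivative exp (- z\<^sup>2)) (at z)) \<and> G 0 = 0"
    by (rule exI[of _ "\<lambda>z. G z - G 0"]) (simp add: G')
  from someI_ex[OF this] show "(gauss_prim has_field_derivative exp (- z\<^sup>2)) (at z)" "gauss_prim 0 = 0"
    unfolding gauss_prim_def by auto
qed

lemma gauss_prim_minus: "gauss_prim (- z) = - gauss_prim z"
proof -
  have "((\<lambda>z. gauss_prim z + gauss_prim (- z)) has_field_derivative 0) (at z within UNIV)" for z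
    by (auto intro!: derivative_eq_intros DERIV_chain2[OF gauss_prim] gauss_prim)
  then obtain K where "\<And>z. gauss_prim z + gauss_prim (- z) = K"
    using has_field_derivative_zero_constant[of UNIV "\<lambda>z. gauss_prim z + gauss_prim (- z)"] by auto
  from this[of z] this[of 0] show ?thesis by (simp add: gauss_prim_0 add_eq_0_iff)
qed

lemma gauss_prim_real_tendsto: "((\<lambda>R. gauss_prim (of_real R)) \<longlongrightarrow> of_real (sqrt pi / 2)) at_top"
proof -
  let ?g = "\<lambda>x::real. indicator {0..} x *\<^sub>R exp (- x\<^sup>2)"
  have "((\<lambda>y. \<integral> x. indicator {.. y} x *\<^sub>R ?g x \<partial>lborel) \<longlongrightarrow> (\<integral>x. ?g x \<partial>lborel)) at_top"
    using gaussian_moment_0 by (intro tendsto_integral_at_top) (auto simp: has_bochner_integral_iff)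
  also have "(\<integral>x. ?g x \<partial>lborel) = sqrt pi / 2"
    using gaussian_moment_0 by (simp add: has_bochner_integral_iff)
  finally have lim: "((\<lambda>R. of_real (\<integral> x. indicator {.. R} x *\<^sub>R ?g x \<partial>lborel) :: complex) \<longlongrightarrow> of_real (sqrt pi / 2)) at_top"
    by (intro tendsto_intros)
  have "eventually (\<lambda>R. of_real (\<integral> x. indicator {.. R} x *\<^sub>R ?g x \<partial>lborel) = gauss_prim (of_real R)) at_top"
    using eventually_ge_at_top[of 0]
  proof eventually_elim
    case (elim R)
    have "((\<lambda>x. exp (- (of_real x)\<^sup>2)) has_integral (gauss_prim (of_real R) - gauss_prim (of_real 0))) {0..R}"
      using elim by (intro fundamental_theorem_of_calculus has_vector_derivative_real_field gauss_prim)
    then have 1: "((\<lambda>x. of_real (exp (- x\<^sup>2)) :: complex) has_integral gauss_prim (of_real R)) {0..R}"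
      by (simp add: gauss_prim_0 flip: exp_of_real)
    have int: "set_integrable lborel {0..R} (\<lambda>x. exp (- x\<^sup>2) :: real)"
      by (intro borel_integrable_atLeastAtMost') (auto intro!: continuous_intros)
    have "(\<integral> x. indicator {.. R} x *\<^sub>R ?g x \<partial>lborel) = (LINT x:{0..R}|lborel. exp (- x\<^sup>2))"
      unfolding set_lebesgue_integral_def by (intro Bochner_Integration.integral_cong refl) (auto split: split_indicator)
    also have "\<dots> = integral {0..R} (\<lambda>x. exp (- x\<^sup>2))"
      by (rule set_borel_integral_eq_integral(2)[OF int])
    finally have "((\<lambda>x. exp (- x\<^sup>2)) has_integral (\<integral> x. indicator {.. R} x *\<^sub>R ?g x \<partial>lborel)) {0..R}"
      using set_borel_integral_eq_integral(1)[OF int] by (simp add: has_integral_integrable_integral)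
    from has_integral_of_real[OF this] 1 show ?case
      by (rule has_integral_unique)
  qed
  then show ?thesis by (rule Lim_transform_eventually[OF lim])
qed

text \<open>The diagonal is reached from the real axis along the vertical segment from \<open>R\<close> to \<open>R - \<i> R\<close>.\<close>

lemma gauss_prim_diagonal_tendsto:
  "((\<lambda>R. gauss_prim (of_real R * (1 - \<i>))) \<longlongrightarrow> of_real (sqrt pi / 2)) at_top"
proof -
  have "((\<lambda>R. gauss_prim (of_real R * (1 - \<i>)) - gauss_prim (of_real R)) \<longlongrightarrow> 0) at_top"
  proof (rule Lim_null_comparison)
    show "((\<lambda>R. 1 / R) \<longlongrightarrow> (0::real)) at_top" by real_asymp
    show "eventually (\<lambda>R. norm (gauss_prim (of_real R * (1 - \<i>)) - gauss_prim (of_real R)) \<le> 1 / R) at_top"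
      using eventually_gt_at_top[of 0]
    proof eventually_elim
      case (elim R)
      let ?G = "\<lambda>s. gauss_prim (of_real R - \<i> * of_real s)" and ?\<psi> = "\<lambda>s. exp (R * s - R\<^sup>2) / R"
      have G': "(?G has_vector_derivative - \<i> * exp (- (of_real R - \<i> * of_real s)\<^sup>2)) (at s)" for s
      proof -
        have "((\<lambda>z. gauss_prim (of_real R - \<i> * z)) has_field_derivative - \<i> * exp (- (of_real R - \<i> * of_real s)\<^sup>2)) (at (of_real s))"
        proof -
          have "((\<lambda>z. of_real R - \<i> * z) has_field_derivative - \<i>) (at (of_real s))"
            by (auto intro!: derivative_eq_intros)
          from DERIV_chain2[OF gauss_prim this] show ?thesis by (simp add: mult.commute)
        qed
        then show ?thesis by (rule has_vector_derivative_real_field)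
      qed
      have psi': "(?\<psi> has_vector_derivative exp (R * s - R\<^sup>2)) (at s)" for s
        using elim by (auto intro!: derivative_eq_intros simp: has_real_derivative_iff_has_vector_derivative[symmetric])
      \<comment> \<open>On the segment the derivative has modulus exp(s^2 - R^2), at most exp(R s -
        R^2) for s \<le> R; \<open>?\<psi>\<close> is a primitive of the latter in s.\<close>
      have "norm (?G R - ?G 0) \<le> ?\<psi> R - ?\<psi> 0"
      proof (rule differentiable_bound_general[where f' = "\<lambda>s. - \<i> * exp (- (of_real R - \<i> * of_real s)\<^sup>2)" and \<phi>' = "\<lambda>s. exp (R * s - R\<^sup>2)"])
        show "continuous_on {0..R} ?G" "continuous_on {0..R} ?\<psi>"
          using G' psi' by (meson continuous_at_imp_continuous_on has_vector_derivative_continuous)+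
        fix s assume s: "0 < s" "s < R"
        show "(?G has_vector_derivative - \<i> * exp (- (of_real R - \<i> * of_real s)\<^sup>2)) (at s)"
          "(?\<psi> has_vector_derivative exp (R * s - R\<^sup>2)) (at s)" by (fact G' psi')+
        have "s * s \<le> R * s" using s by (intro mult_right_mono) auto
        then show "norm (- \<i> * exp (- (of_real R - \<i> * of_real s)\<^sup>2)) \<le> exp (R * s - R\<^sup>2)"
          by (simp add: norm_mult power2_eq_square)
      qed (use elim in auto)
      also have "\<dots> \<le> 1 / R" using elim by (simp add: power2_eq_square field_simps)
      finally show ?case by (simp add: algebra_simps)
    qed
  qed
  from tendsto_add[OF this gauss_prim_real_tendsto] show ?thesis by simp
qed

text \<open>For \<mu> = 4 \<pi> i \<nu> this is e(\<nu> y^2) on the real axis, with logarithmic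
  derivative \<mu> z.\<close>

definition gphase :: "complex \<Rightarrow> complex \<Rightarrow> complex" where
  "gphase \<mu> z = exp (\<mu> * z\<^sup>2 / 2)"

text \<open>The functions \<open>H\<^sub>t\<close> for the phase \<open>\<lambda> y\<^sup>2\<close> and the weight \<open>y\<^sup>k\<close>, with \<open>\<mu> = 4 \<pi> \<i> \<lambda>\<close>.\<close>

definition hmon :: "complex \<Rightarrow> nat \<Rightarrow> nat \<Rightarrow> complex \<Rightarrow> complex" where
  "hmon \<mu> k t z = (\<Prod>s\<in>{1..<t}. 2 * of_nat s - of_nat k - 1) * z ^ (k + 1) / (\<mu> * z\<^sup>2) ^ t"

text \<open>Primitives of z^k \<open>gphase\<close>, given a primitive G of \<open>gphase\<close>
  itself; the last clause is one integration by parts of z^(k+1) against z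
  \<open>gphase\<close>.\<close>

fun gprim :: "(complex \<Rightarrow> complex) \<Rightarrow> complex \<Rightarrow> nat \<Rightarrow> complex \<Rightarrow> complex" where
  "gprim G \<mu> 0 z = G z"
| "gprim G \<mu> (Suc 0) z = gphase \<mu> z / \<mu>"
| "gprim G \<mu> (Suc (Suc k)) z = z ^ (k + 1) / \<mu> * gphase \<mu> z - of_nat (k + 1) / \<mu> * gprim G \<mu> k z"

text \<open>The primitive with the boundary terms of m integrations by parts taken off.\<close>

definition gdefect :: "(complex \<Rightarrow> complex) \<Rightarrow> complex \<Rightarrow> nat \<Rightarrow> nat \<Rightarrow> complex \<Rightarrow> complex" where
  "gdefect G \<mu> k m z = gprim G \<mu> k z - gphase \<mu> z * (\<Sum>t=1..m. hmon \<mu> k t z)"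

lemma gphase_deriv: "(gphase \<mu> has_field_derivative \<mu> * z * gphase \<mu> z) (at z)"
  unfolding gphase_def[abs_def] by (auto intro!: derivative_eq_intros)

lemma gprim_deriv:
  assumes "\<mu> \<noteq> 0" "\<And>z. (G has_field_derivative gphase \<mu> z) (at z)"
  shows "(gprim G \<mu> k has_field_derivative z ^ k * gphase \<mu> z) (at z)"
proof (induction k rule: induct_nat_012)
  case 0
  have "gprim G \<mu> 0 = G" by auto
  then show ?case using assms(2) by simp
next
  case 1
  have "gprim G \<mu> (Suc 0) = (\<lambda>z. gphase \<mu> z / \<mu>)" by auto
  then show ?case using assms(1) by (auto intro!: derivative_eq_intros gphase_deriv)
next
  case (ge2 k)
  have eq: "gprim G \<mu> (Suc (Suc k)) = (\<lambda>z. z ^ (k + 1) / \<mu> * gphase \<mu> z - of_nat (k + 1) / \<mu> * gprim G \<mu> k z)"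
    by auto
  show ?case unfolding eq
    by (rule DERIV_cong[OF DERIV_diff[OF DERIV_mult[OF DERIV_cdivide[OF DERIV_power[OF DERIV_ident]] gphase_deriv] DERIV_cmult[OF ge2(1)]]])
      (use assms(1) in \<open>simp add: field_simps\<close>)
qed

lemma hmon_power_int:
  assumes "z \<noteq> 0"
  shows "hmon \<mu> k t z = (\<Prod>s\<in>{1..<t}. 2 * of_nat s - of_nat k - 1) / \<mu> ^ t * z powi (int k + 1 - 2 * int t)"
proof -
  have "z powi (int k + 1 - 2 * int t) = z powi int (k + 1) / z powi int (2 * t)"
    using assms by (subst power_int_diff[symmetric]) (auto simp: add.commute)
  also have "\<dots> = z ^ (k + 1) / (z\<^sup>2) ^ t"
    by (simp only: power_int_of_nat power_mult)
  finally show ?thesis by (simp only: hmon_def power_mult_distrib times_divide_times_eq)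
qed

text \<open>This is the recursion of the H_t for the phase \<lambda> y^2, where 2 \<pi> i times the
  derivative of the phase is \<mu> y.\<close>

lemma hmon_deriv:
  assumes "\<mu> \<noteq> 0" "z \<noteq> 0" "t \<ge> 1"
  shows "(hmon \<mu> k t has_field_derivative - (\<mu> * z * hmon \<mu> k (Suc t) z)) (at z)"
proof -
  define A :: complex where "A = (\<Prod>s\<in>{1..<t}. 2 * of_nat s - of_nat k - 1)"
  have A: "(\<Prod>s\<in>{1..<Suc t}. 2 * of_nat s - of_nat k - 1 :: complex) = A * (2 * of_nat t - of_nat k - 1)"
    using assms(3) by (simp add: A_def)
  have z: "z powi (int k - 2 * int t) = z * z powi (int k + 1 - 2 * int (Suc t))"
    using assms(2) power_int_add[of z 1 "int k + 1 - 2 * int (Suc t)"] by simp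
  have "((\<lambda>z. A / \<mu> ^ t * z powi (int k + 1 - 2 * int t)) has_field_derivative
      A / \<mu> ^ t * (of_int (int k + 1 - 2 * int t) * z powi (int k + 1 - 2 * int t - 1))) (at z)"
    using assms(1,2) by (auto intro!: derivative_eq_intros)
  also have "A / \<mu> ^ t * (of_int (int k + 1 - 2 * int t) * z powi (int k + 1 - 2 * int t - 1)) =
      - (\<mu> * z * hmon \<mu> k (Suc t) z)"
  proof -
    have "int k + 1 - 2 * int t - 1 = int k - 2 * int t" by simp
    then show ?thesis
      unfolding hmon_power_int[OF assms(2)] A using assms(1) by (simp only: z) (simp add: field_simps)
  qed
  finally show ?thesis
    by (rule has_field_derivative_transform_within_open[where S = "- {0}"])
       (use assms in \<open>auto simp: hmon_power_int A_def\<close>)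
qed

lemma hmon_1: "z \<noteq> 0 \<Longrightarrow> hmon \<mu> k (Suc 0) z = z ^ k / (\<mu> * z)"
  by (simp add: hmon_def power2_eq_square)

text \<open>Raising k by 2 and t by 1 keeps the exponent k + 1 - 2t. In the product the new factor s
  = 1 equals -(k+1), and the others are the old ones shifted.\<close>

lemma hmon_shift:
  assumes "\<mu> \<noteq> 0" "z \<noteq> 0" "t \<ge> 1"
  shows "hmon \<mu> (Suc (Suc k)) (Suc t) z = - of_nat (k + 1) / \<mu> * hmon \<mu> k t z"
proof -
  have "(\<Prod>s\<in>{1..<Suc t}. 2 * of_nat s - of_nat (Suc (Suc k)) - 1 :: complex) =
      - of_nat (k + 1) * (\<Prod>s\<in>{Suc 1..<Suc t}. 2 * of_nat s - of_nat (Suc (Suc k)) - 1)"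
    using assms(3) by (subst prod.atLeast_Suc_lessThan) auto
  also have "(\<Prod>s\<in>{Suc 1..<Suc t}. 2 * of_nat s - of_nat (Suc (Suc k)) - 1 :: complex) =
      (\<Prod>s\<in>{1..<t}. 2 * of_nat s - of_nat k - 1)"
    by (subst prod.shift_bounds_Suc_ivl) (auto intro!: prod.cong)
  finally have eq: "(\<Prod>s\<in>{1..<Suc t}. 2 * of_nat s - of_nat (Suc (Suc k)) - 1 :: complex) =
      - of_nat (k + 1) * (\<Prod>s\<in>{1..<t}. 2 * of_nat s - of_nat k - 1)" .
  have "int (Suc (Suc k)) + 1 - 2 * int (Suc t) = int k + 1 - 2 * int t" by simp
  then show ?thesis
    by (simp only: hmon_power_int[OF assms(2)] eq) (simp add: field_simps)
qed

text \<open>The boundary term in the recursion of \<open>gprim\<close> is exactly the term t = 1 of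
  the sum, so one integration by parts lowers k by 2 without residue.\<close>

lemma gdefect_shift:
  assumes "\<mu> \<noteq> 0" "z \<noteq> 0"
  shows "gdefect G \<mu> (Suc (Suc k)) (Suc m) z = - of_nat (k + 1) / \<mu> * gdefect G \<mu> k m z"
proof -
  have "(\<Sum>t=1..Suc m. hmon \<mu> (Suc (Suc k)) t z) =
      hmon \<mu> (Suc (Suc k)) (Suc 0) z + (\<Sum>t=1..m. hmon \<mu> (Suc (Suc k)) (Suc t) z)"
    by (subst sum.atLeast_Suc_atMost) (auto simp: sum.shift_bounds_cl_Suc_ivl simp del: sum.cl_ivl_Suc)
  also have "(\<Sum>t=1..m. hmon \<mu> (Suc (Suc k)) (Suc t) z) = - of_nat (k + 1) / \<mu> * (\<Sum>t=1..m. hmon \<mu> k t z)"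
    unfolding sum_distrib_left by (intro sum.cong refl hmon_shift assms) auto
  also have "hmon \<mu> (Suc (Suc k)) (Suc 0) z = z ^ (k + 1) / \<mu>"
    using assms(2) by (simp add: hmon_1 field_simps)
  finally show ?thesis
    unfolding gdefect_def gprim.simps by (simp only:) (simp add: algebra_simps diff_divide_distrib add_divide_distrib)
qed

text \<open>Reduction by 2 ends at k = 1, where the primitive is the first boundary term and all
  later ones contain the factor 2 - 1 - 1 = 0.\<close>

lemma gdefect_odd:
  assumes "\<mu> \<noteq> 0" "z \<noteq> 0" "m \<ge> j + 1"
  shows "gdefect G \<mu> (2 * j + 1) m z = 0"
  using assms(3)
proof (induction j arbitrary: m)
  case 0
  have "hmon \<mu> (Suc 0) t z = 0" if "t > 1" for t
    using that by (auto simp: hmon_def intro!: bexI[of _ 1])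
  then have "(\<Sum>t=1..m. hmon \<mu> 1 t z) = (\<Sum>t\<in>{1}. hmon \<mu> 1 t z)"
    using 0 by (intro sum.mono_neutral_right) auto
  then show ?case using assms by (simp add: gdefect_def hmon_1)
next
  case (Suc j)
  obtain m' where m: "m = Suc m'" using Suc.prems by (cases m) auto
  have "gdefect G \<mu> (2 * Suc j + 1) m z = gdefect G \<mu> (Suc (Suc (2 * j + 1))) (Suc m') z"
    by (simp add: m)
  also have "\<dots> = 0"
    unfolding gdefect_shift[OF assms(1,2)] using Suc.IH[of m'] Suc.prems m by simp
  finally show ?case .
qed

text \<open>Each of the j reductions contributes an odd factor -(k+1)/\<mu>, whence the double
  factorial; m integrations by parts remain for k = 0.\<close>

lemma gdefect_even:
  assumes "\<mu> \<noteq> 0" "z \<noteq> 0"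
  shows "gdefect G \<mu> (2 * j) (j + m) z = (-1) ^ j * of_nat (odd_double_fact j) / \<mu> ^ j * gdefect G \<mu> 0 m z"
proof (induction j)
  case (Suc j)
  have "gdefect G \<mu> (2 * Suc j) (Suc j + m) z = gdefect G \<mu> (Suc (Suc (2 * j))) (Suc (j + m)) z"
    by simp
  also have "\<dots> = - of_nat (2 * j + 1) / \<mu> * ((-1) ^ j * of_nat (odd_double_fact j) / \<mu> ^ j * gdefect G \<mu> 0 m z)"
    unfolding gdefect_shift[OF assms] Suc.IH ..
  also have "of_nat (odd_double_fact (Suc j)) = (of_nat (odd_double_fact j) * of_nat (2 * j + 1) :: complex)"
    by (simp add: odd_double_fact_def algebra_simps)
  then have "- of_nat (2 * j + 1) / \<mu> * ((-1) ^ j * of_nat (odd_double_fact j) / \<mu> ^ j * gdefect G \<mu> 0 m z) =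
      (-1) ^ Suc j * of_nat (odd_double_fact (Suc j)) / \<mu> ^ Suc j * gdefect G \<mu> 0 m z"
    by (simp add: field_simps del: of_nat_Suc)
  finally show ?case .
qed (simp add: odd_double_fact_def)

text \<open>The sum telescopes: each new boundary term cancels the remaining integrand and leaves
  the next one.\<close>

lemma gdefect_0_deriv:
  assumes "\<mu> \<noteq> 0" "z \<noteq> 0" "\<And>z. (G has_field_derivative gphase \<mu> z) (at z)"
  shows "(gdefect G \<mu> 0 m has_field_derivative gphase \<mu> z * (\<mu> * z * hmon \<mu> 0 (Suc m) z)) (at z)"
proof (induction m)
  case 0
  have "gdefect G \<mu> 0 0 = G" by (auto simp: gdefect_def)
  then show ?case using assms by (simp add: hmon_1)
next
  case (Suc m)
  have "gdefect G \<mu> 0 (Suc m) = (\<lambda>z. gdefect G \<mu> 0 m z - gphase \<mu> z * hmon \<mu> 0 (Suc m) z)"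
    by (auto simp: gdefect_def algebra_simps)
  moreover have "((\<lambda>z. gdefect G \<mu> 0 m z - gphase \<mu> z * hmon \<mu> 0 (Suc m) z) has_field_derivative
      gphase \<mu> z * (\<mu> * z * hmon \<mu> 0 (Suc (Suc m)) z)) (at z)"
    by (rule DERIV_cong[OF DERIV_diff[OF Suc DERIV_mult[OF gphase_deriv hmon_deriv[OF assms(1,2)]]]])
       (auto simp: algebra_simps)
  ultimately show ?case by simp
qed

section \<open>Fresnel integrals on a half-line and their endpoint errors\<close>

definition quad_mu :: "real \<Rightarrow> complex" where
  "quad_mu \<nu> = 4 * of_real pi * \<i> * of_real \<nu>"

text \<open>The factor w = sqrt(\<pi> \<nu>) (1 - i) satisfies -(w z)^2 = 2 \<pi> i \<nu> z^2, so
  real z is sent to the diagonal on which the limit of \<open>gauss_prim\<close> is known.\<close>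

definition fresnel_prim :: "real \<Rightarrow> complex \<Rightarrow> complex" where
  "fresnel_prim \<nu> z =
     gauss_prim (of_real (sqrt (pi * \<nu>)) * (1 - \<i>) * z) / (of_real (sqrt (pi * \<nu>)) * (1 - \<i>))"

lemma one_minus_ii_neq_0: "1 - \<i> \<noteq> 0"
  by (simp add: complex_eq_iff)

lemma fresnel_prim_deriv:
  assumes "\<nu> > 0"
  shows "(fresnel_prim \<nu> has_field_derivative gphase (quad_mu \<nu>) z) (at z)"
proof -
  define w where "w = of_real (sqrt (pi * \<nu>)) * (1 - \<i>)"
  have w: "w \<noteq> 0" using assms one_minus_ii_neq_0 by (simp add: w_def)
  have "(of_real (sqrt (pi * \<nu>)) :: complex)\<^sup>2 = of_real (pi * \<nu>)"
    using assms by (simp flip: of_real_power)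
  then have w2: "- (w * z)\<^sup>2 = quad_mu \<nu> * z\<^sup>2 / 2"
    by (simp add: w_def power_mult_distrib quad_mu_def) (simp add: power2_eq_square algebra_simps)
  have "((\<lambda>z. gauss_prim (w * z) / w) has_field_derivative exp (- (w * z)\<^sup>2) * w / w) (at z)"
    by (intro DERIV_cdivide DERIV_chain2[OF gauss_prim]) (auto intro!: derivative_eq_intros)
  moreover have "fresnel_prim \<nu> = (\<lambda>z. gauss_prim (w * z) / w)"
    by (auto simp: fresnel_prim_def w_def)
  ultimately show ?thesis using w by (simp add: gphase_def w2)
qed

lemma fresnel_prim_minus: "fresnel_prim \<nu> (- z) = - fresnel_prim \<nu> z"
  by (simp add: fresnel_prim_def gauss_prim_minus)

lemma e_eighth: "e (1 / 8) = (1 + \<i>) / of_real (sqrt 2)"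
proof -
  have "e (1 / 8) = cis (pi / 4)" by (simp add: e_def cis_conv_exp mult_ac)
  also have "\<dots> = (1 + \<i>) * of_real (sqrt 2 / 2)"
    by (simp add: complex_eq_iff cos_45 sin_45)
  also have "sqrt 2 / 2 = 1 / sqrt 2" by (simp add: real_div_sqrt field_simps)
  finally show ?thesis by simp
qed

text \<open>Half of the integral of e(\<nu> y^2) over the line. With 2 \<nu> = f''(\<gamma>) this is
  the origin of the prefactor of the main term.\<close>

lemma fresnel_prim_tendsto:
  assumes "\<nu> > 0"
  shows "((\<lambda>y. fresnel_prim \<nu> (of_real y)) \<longlongrightarrow> e (1 / 8) / of_real (2 * sqrt (2 * \<nu>))) at_top"
proof -
  define s where "s = sqrt (pi * \<nu>)"
  have s: "s > 0" using assms by (simp add: s_def)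
  have "filterlim (\<lambda>y. s * y) at_top at_top"
    by (rule filterlim_tendsto_pos_mult_at_top[OF tendsto_const s filterlim_ident])
  from filterlim_compose[OF gauss_prim_diagonal_tendsto this]
  have "((\<lambda>y. gauss_prim (of_real s * (1 - \<i>) * of_real y) / (of_real s * (1 - \<i>)))
      \<longlongrightarrow> of_real (sqrt pi / 2) / (of_real s * (1 - \<i>))) at_top"
    using s one_minus_ii_neq_0 by (intro tendsto_divide tendsto_const) (auto simp: mult_ac)
  also have "of_real (sqrt pi / 2) / (of_real s * (1 - \<i>)) = e (1 / 8) / of_real (2 * sqrt (2 * \<nu>))"
  proof -
    have sq: "of_real (sqrt 2) * of_real (sqrt 2) = (2 :: complex)"
      by (simp flip: of_real_mult)
    have 1: "(1 + \<i>) * (1 - \<i>) = 2" by (simp add: algebra_simps)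
    have "of_real (sqrt pi / 2) / (of_real s * (1 - \<i>)) = 1 / (2 * of_real (sqrt \<nu>) * (1 - \<i>))"
      by (simp add: s_def real_sqrt_mult)
    also have "\<dots> = (1 + \<i>) / (4 * of_real (sqrt \<nu>))"
    proof (rule frac_eq_eq[THEN iffD2])
      have "(1 + \<i>) * (2 * complex_of_real (sqrt \<nu>) * (1 - \<i>)) = 2 * of_real (sqrt \<nu>) * ((1 + \<i>) * (1 - \<i>))"
        by (simp only: mult_ac)
      then show "1 * (4 * complex_of_real (sqrt \<nu>)) = (1 + \<i>) * (2 * complex_of_real (sqrt \<nu>) * (1 - \<i>))"
        unfolding 1 by simp
    qed (use assms one_minus_ii_neq_0 in auto)
    also have "\<dots> = e (1 / 8) / of_real (2 * sqrt (2 * \<nu>))"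
    proof -
      have "of_real (sqrt 2) * of_real (2 * sqrt (2 * \<nu>)) = (4 * of_real (sqrt \<nu>) :: complex)"
        using sq by (simp add: real_sqrt_mult mult_ac)
      then show ?thesis by (simp add: e_eighth)
    qed
    finally show ?thesis .
  qed
  finally show ?thesis by (simp add: fresnel_prim_def s_def)
qed

lemma quad_mu_neq_0: "\<nu> > 0 \<Longrightarrow> quad_mu \<nu> \<noteq> 0"
  by (simp add: quad_mu_def)

lemma norm_quad_mu: "\<nu> > 0 \<Longrightarrow> norm (quad_mu \<nu>) = 4 * pi * \<nu>"
  by (simp add: quad_mu_def norm_mult)

lemma gphase_eq_e: "gphase (quad_mu \<nu>) (of_real y) = e (\<nu> * y\<^sup>2)"
  by (simp add: gphase_def quad_mu_def e_def mult_ac)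

lemma norm_e [simp]: "norm (e x) = 1"
  by (simp add: e_def)

lemma e_add: "e (x + y) = e x * e y"
  by (simp add: e_def exp_add[symmetric] algebra_simps)

definition hmon_const :: "nat \<Rightarrow> nat \<Rightarrow> real" where
  "hmon_const k t = norm (\<Prod>s\<in>{1..<t}. 2 * of_nat s - of_nat k - 1 :: complex)"

lemma norm_hmon:
  assumes "\<nu> > 0" "y > 0"
  shows "norm (hmon (quad_mu \<nu>) k t (of_real y)) = hmon_const k t * y ^ (k + 1) / (4 * pi * \<nu> * y\<^sup>2) ^ t"
  using assms by (simp add: hmon_def hmon_const_def norm_mult norm_divide norm_power norm_quad_mu)

lemma hmon_0_tendsto:
  assumes "\<nu> > 0" "t \<ge> 1"
  shows "((\<lambda>y. hmon (quad_mu \<nu>) 0 t (of_real y)) \<longlongrightarrow> 0) at_top"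
proof (rule Lim_null_comparison)
  let ?K = "hmon_const 0 t / (4 * pi * \<nu>) ^ t"
  show "((\<lambda>y. ?K / y) \<longlongrightarrow> 0) at_top"
    by (rule tendsto_divide_0[OF tendsto_const filterlim_at_top_imp_at_infinity[OF filterlim_ident]])
  show "eventually (\<lambda>y. norm (hmon (quad_mu \<nu>) 0 t (of_real y)) \<le> ?K / y) at_top"
    using eventually_ge_at_top[of 1]
  proof eventually_elim
    case (elim y)
    have K: "?K \<ge> 0" using assms by (simp add: hmon_const_def)
    have "y\<^sup>2 \<le> (y\<^sup>2) ^ t" using elim assms(2) self_le_power[of "y\<^sup>2" t] by simp
    then have "y * y \<le> (y\<^sup>2) ^ t" by (simp add: power2_eq_square)
    then have "y / (y\<^sup>2) ^ t \<le> 1 / y" using elim by (simp add: divide_simps)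
    from mult_left_mono[OF this K] show ?case
      using norm_hmon[OF assms(1), of y 0 t] elim by (simp add: power_mult_distrib)
  qed
qed

lemma norm_gdefect_0_deriv:
  assumes "\<nu> > 0" "y > 0"
  shows "norm (gphase (quad_mu \<nu>) (of_real y) * (quad_mu \<nu> * of_real y * hmon (quad_mu \<nu>) 0 (Suc m) (of_real y)))
    = hmon_const 0 (Suc m) / (4 * pi * \<nu>) ^ m / y ^ (2 * m)"
proof -
  have "norm (gphase (quad_mu \<nu>) (of_real y) * (quad_mu \<nu> * of_real y * hmon (quad_mu \<nu>) 0 (Suc m) (of_real y))) =
      4 * pi * \<nu> * y * (hmon_const 0 (Suc m) * y / (4 * pi * \<nu> * y\<^sup>2) ^ Suc m)"
    using assms by (simp add: norm_mult norm_hmon gphase_eq_e norm_quad_mu del: power_Suc)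
  also have "\<dots> = hmon_const 0 (Suc m) / (4 * pi * \<nu>) ^ m / y ^ (2 * m)"
    using assms by (simp add: power_mult_distrib power_mult) (simp add: power2_eq_square divide_simps)
  finally show ?thesis .
qed

text \<open>The derivative of the m-th defect is only of order y^(-2m), not integrable for m = 0.
  The defect m + 1 is integrated from B to infinity instead, and the extra boundary term at B has
  the same size as the resulting bound.\<close>

lemma gdefect_0_bound:
  "\<exists>K\<ge>0. \<forall>\<nu>>0. \<forall>B>0. norm (gdefect (fresnel_prim \<nu>) (quad_mu \<nu>) 0 m (of_real B)
      - e (1 / 8) / of_real (2 * sqrt (2 * \<nu>))) \<le> K / (\<nu> ^ (m + 1) * B ^ (2 * m + 1))"
proof (intro exI conjI allI impI)
  let ?C1 = "hmon_const 0 (Suc m)" and ?C2 = "hmon_const 0 (Suc (Suc m))"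
  have C: "?C1 \<ge> 0" "?C2 \<ge> 0" by (simp_all add: hmon_const_def)
  then show "?C1 + ?C2 \<ge> 0" by simp
  fix \<nu> B :: real assume \<nu>: "\<nu> > 0" and B: "B > 0"
  let ?D = "\<lambda>m y. gdefect (fresnel_prim \<nu>) (quad_mu \<nu>) 0 m (of_real y)"
  let ?F = "e (1 / 8) / of_real (2 * sqrt (2 * \<nu>))"
  let ?D' = "\<lambda>y. gphase (quad_mu \<nu>) (of_real y) * (quad_mu \<nu> * of_real y * hmon (quad_mu \<nu>) 0 (Suc (Suc m)) (of_real y))"
  define L where "L = ?C2 / (4 * pi * \<nu>) ^ Suc m"
  have L: "L \<ge> 0" using C \<nu> by (simp add: L_def)
  have der: "(?D (Suc m) has_vector_derivative ?D' y) (at y within S)" if "y > 0" for y S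
    using that \<nu> by (intro has_vector_derivative_real_field gdefect_0_deriv quad_mu_neq_0 fresnel_prim_deriv) auto
  have diff: "norm (?D (Suc m) B' - ?D (Suc m) B) \<le> L / B ^ (2 * m + 1)" if B': "B' > B" for B'
  proof -
    \<comment> \<open>A primitive of L / y^(2m+2), which majorizes the derivative of the defect m +
      1.\<close>
    let ?\<psi> = "\<lambda>y. - (L / real (2 * m + 1)) * inverse (y ^ (2 * m + 1))"
    have psi': "(?\<psi> has_vector_derivative L / y ^ (2 * Suc m)) (at y within S)" if "y > 0" for y S
    proof -
      have "(?\<psi> has_real_derivative - (L / real (2 * m + 1)) *
          - (inverse (y ^ (2 * m + 1)) * (real (2 * m + 1) * y ^ (2 * m)) * inverse (y ^ (2 * m + 1)))) (at y within S)"
        using that DERIV_pow[of "2 * m + 1" y S] by (intro DERIV_cmult DERIV_inverse') auto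
      also have "- (L / real (2 * m + 1)) *
          - (inverse (y ^ (2 * m + 1)) * (real (2 * m + 1) * y ^ (2 * m)) * inverse (y ^ (2 * m + 1))) = L / y ^ (2 * Suc m)"
        using that by (simp add: divide_simps del: of_nat_Suc of_nat_add)
      finally show ?thesis by (simp only: has_real_derivative_iff_has_vector_derivative)
    qed
    have "norm (?D (Suc m) B' - ?D (Suc m) B) \<le> ?\<psi> B' - ?\<psi> B"
    proof (rule differentiable_bound_general[OF B', where f' = ?D' and \<phi>' = "\<lambda>y. L / y ^ (2 * Suc m)"])
      show "continuous_on {B..B'} (?D (Suc m))" "continuous_on {B..B'} ?\<psi>"
        using der psi' B by (meson atLeastAtMost_iff continuous_on_eq_continuous_within has_vector_derivative_continuous less_le_trans)+
      fix y assume "B < y" "y < B'"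
      then have y: "y > 0" using B by simp
      show "(?D (Suc m) has_vector_derivative ?D' y) (at y)" by (rule der[OF y])
      show "(?\<psi> has_vector_derivative L / y ^ (2 * Suc m)) (at y)" by (rule psi'[OF y])
      show "norm (?D' y) \<le> L / y ^ (2 * Suc m)"
        using norm_gdefect_0_deriv[OF \<nu> y, of "Suc m"] by (simp add: L_def)
    qed
    also have "\<dots> \<le> - ?\<psi> B" using L B B' by simp
    also have "\<dots> = L / B ^ (2 * m + 1) / real (2 * m + 1)" using B by (simp add: divide_simps)
    also have "\<dots> \<le> L / B ^ (2 * m + 1)" using L B by (simp add: divide_le_eq mult_le_cancel_left1)
    finally show ?thesis .
  qed
  have "((\<lambda>y. fresnel_prim \<nu> (of_real y) - gphase (quad_mu \<nu>) (of_real y) * (\<Sum>t=1..Suc m. hmon (quad_mu \<nu>) 0 t (of_real y)))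
      \<longlongrightarrow> ?F - 0) at_top"
  proof (intro tendsto_diff fresnel_prim_tendsto \<nu>)
    have "((\<lambda>y. \<Sum>t=1..Suc m. hmon (quad_mu \<nu>) 0 t (of_real y)) \<longlongrightarrow> (\<Sum>t=1..Suc m. 0)) at_top"
      by (intro tendsto_sum hmon_0_tendsto \<nu>) auto
    then have "((\<lambda>y. norm (\<Sum>t=1..Suc m. hmon (quad_mu \<nu>) 0 t (of_real y))) \<longlongrightarrow> 0) at_top"
      using tendsto_norm_zero by fastforce
    then show "((\<lambda>y. gphase (quad_mu \<nu>) (of_real y) * (\<Sum>t=1..Suc m. hmon (quad_mu \<nu>) 0 t (of_real y))) \<longlongrightarrow> 0) at_top"
      by (rule Lim_null_comparison[rotated]) (simp add: norm_mult gphase_eq_e del: sum.cl_ivl_Suc)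
  qed
  then have "(?D (Suc m) \<longlongrightarrow> ?F) at_top" by (simp add: gdefect_def)
  then have "((\<lambda>y. ?D (Suc m) y - ?D (Suc m) B) \<longlongrightarrow> ?F - ?D (Suc m) B) at_top"
    by (intro tendsto_intros)
  then have "norm (?F - ?D (Suc m) B) \<le> L / B ^ (2 * m + 1)"
    by (rule Lim_norm_ubound[rotated]) (use eventually_mono[OF eventually_gt_at_top[of B] diff] in auto)
  \<comment> \<open>Return from m + 1 to m integrations by parts.\<close>
  moreover have "?D m B = ?D (Suc m) B + gphase (quad_mu \<nu>) (of_real B) * hmon (quad_mu \<nu>) 0 (Suc m) (of_real B)"
    by (simp add: gdefect_def algebra_simps)
  moreover have "norm (gphase (quad_mu \<nu>) (of_real B) * hmon (quad_mu \<nu>) 0 (Suc m) (of_real B)) = ?C1 / (4 * pi * \<nu>) ^ Suc m / B ^ (2 * m + 1)"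
    using B \<nu> by (simp add: norm_mult gphase_eq_e norm_hmon del: power_Suc)
      (simp add: power_mult_distrib power_mult power2_eq_square divide_simps)
  ultimately have "norm (?D m B - ?F) \<le> L / B ^ (2 * m + 1) + ?C1 / (4 * pi * \<nu>) ^ Suc m / B ^ (2 * m + 1)"
    by (smt (verit) norm_minus_commute norm_triangle_ineq add_diff_eq diff_add_eq)
  also have "\<dots> = (?C1 + ?C2) / ((4 * pi * \<nu>) ^ Suc m * B ^ (2 * m + 1))"
    by (simp add: L_def add_divide_distrib)
  also have "\<dots> \<le> (?C1 + ?C2) / (\<nu> ^ Suc m * B ^ (2 * m + 1))"
  proof -
    have "1 * \<nu> \<le> 4 * pi * \<nu>" using \<nu> pi_gt3 by (intro mult_right_mono) auto
    then have "\<nu> ^ Suc m \<le> (4 * pi * \<nu>) ^ Suc m" using \<nu> by (intro power_mono) auto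
    then show ?thesis using C B \<nu> by (intro divide_left_mono mult_right_mono) auto
  qed
  finally show "norm (?D m B - ?F) \<le> (?C1 + ?C2) / (\<nu> ^ (m + 1) * B ^ (2 * m + 1))" by simp
qed

lemma gdefect_0_minus:
  "gdefect (fresnel_prim \<nu>) \<mu> 0 m (- z) = - gdefect (fresnel_prim \<nu>) \<mu> 0 m z"
  by (simp add: gdefect_def fresnel_prim_minus gphase_def hmon_def sum_negf)

text \<open>Here \<open>n\<close> counts all integrations by parts: j of them reduce the weight to 1
  and n - j act on the Fresnel integral. The defect for k = 0 is odd, so the two endpoints supply
  the two equal halves of the full integral.\<close>

lemma gdefect_even_bound:
  assumes "j \<le> n"
  shows "\<exists>K\<ge>0. \<forall>\<nu>>0. \<forall>A>0. \<forall>B>0.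
    norm (gdefect (fresnel_prim \<nu>) (quad_mu \<nu>) (2 * j) n (of_real B)
        - gdefect (fresnel_prim \<nu>) (quad_mu \<nu>) (2 * j) n (- of_real A)
        - e (1 / 8) / of_real (sqrt (2 * \<nu>)) * ((- 1) ^ j * of_nat (odd_double_fact j) / quad_mu \<nu> ^ j))
      \<le> K / \<nu> ^ (n + 1) * (1 / A ^ (2 * (n - j) + 1) + 1 / B ^ (2 * (n - j) + 1))"
proof -
  define m where "m = n - j"
  have n: "n = j + m" using assms by (simp add: m_def)
  obtain K where K: "K \<ge> 0" "\<And>\<nu> B. \<nu> > 0 \<Longrightarrow> B > 0 \<Longrightarrow> norm (gdefect (fresnel_prim \<nu>) (quad_mu \<nu>) 0 m (of_real B)
      - e (1 / 8) / of_real (2 * sqrt (2 * \<nu>))) \<le> K / (\<nu> ^ (m + 1) * B ^ (2 * m + 1))"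
    using gdefect_0_bound[of m] by blast
  let ?O = "real (odd_double_fact j)"
  show ?thesis
  proof (intro exI[of _ "?O * K"] conjI allI impI)
    fix \<nu> A B :: real assume \<nu>: "\<nu> > 0" and A: "A > 0" and B: "B > 0"
    let ?D = "gdefect (fresnel_prim \<nu>) (quad_mu \<nu>)" and ?F = "e (1 / 8) / of_real (2 * sqrt (2 * \<nu>))"
    let ?k = "(- 1) ^ j * of_nat (odd_double_fact j) / quad_mu \<nu> ^ j"
    have F: "e (1 / 8) / of_real (sqrt (2 * \<nu>)) = ?F + ?F" by (simp add: field_simps)
    have ev: "?D (2 * j) n z = ?k * ?D 0 m z" if "z \<noteq> 0" for z
      unfolding n by (rule gdefect_even[OF quad_mu_neq_0[OF \<nu>] that])
    have "?D (2 * j) n (of_real B) - ?D (2 * j) n (- of_real A) - e (1 / 8) / of_real (sqrt (2 * \<nu>)) * ?k =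
        ?k * ((?D 0 m (of_real B) - ?F) + (?D 0 m (of_real A) - ?F))"
      using A B by (simp only: ev F gdefect_0_minus neg_equal_0_iff_equal of_real_eq_0_iff) (simp add: ev algebra_simps gdefect_0_minus)
    also have "norm \<dots> \<le> norm ?k * (K / (\<nu> ^ (m + 1) * B ^ (2 * m + 1)) + K / (\<nu> ^ (m + 1) * A ^ (2 * m + 1)))"
      unfolding norm_mult by (intro mult_left_mono order.trans[OF norm_triangle_ineq] add_mono K \<nu> A B) auto
    also have "\<dots> \<le> ?O / \<nu> ^ j * (K / (\<nu> ^ (m + 1) * B ^ (2 * m + 1)) + K / (\<nu> ^ (m + 1) * A ^ (2 * m + 1)))"
    proof (intro mult_right_mono)
      have "1 * \<nu> \<le> 4 * pi * \<nu>" using \<nu> pi_gt3 by (intro mult_right_mono) auto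
      then have "\<nu> ^ j \<le> (4 * pi * \<nu>) ^ j" using \<nu> by (intro power_mono) auto
      then have "?O / (4 * pi * \<nu>) ^ j \<le> ?O / \<nu> ^ j" using \<nu> by (intro divide_left_mono) auto
      then show "norm ?k \<le> ?O / \<nu> ^ j"
        using \<nu> by (simp add: norm_mult norm_divide norm_power norm_quad_mu)
    qed (use K \<nu> A B in auto)
    also have "\<dots> = ?O * K / \<nu> ^ (n + 1) * (1 / A ^ (2 * m + 1) + 1 / B ^ (2 * m + 1))"
      using \<nu> A B by (simp add: n field_simps power_add)
    finally show "norm (?D (2 * j) n (of_real B) - ?D (2 * j) n (- of_real A) - e (1 / 8) / of_real (sqrt (2 * \<nu>)) * ?k)
        \<le> ?O * K / \<nu> ^ (n + 1) * (1 / A ^ (2 * (n - j) + 1) + 1 / B ^ (2 * (n - j) + 1))"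
      by (simp add: m_def)
  qed (use K in auto)
qed

section \<open>The phase and its expansions\<close>

declare deriv_on.simps(2) [simp del]

lemma Ck_on_has_real_derivative:
  fixes f :: "real \<Rightarrow> real"
  assumes "Ck_on k f S" "j < k" "x \<in> S"
  shows "(deriv_on S j f has_real_derivative deriv_on S (Suc j) f x) (at x within S)"
  using assms by (auto simp: Ck_on_def deriv_on.simps(2) has_real_derivative_iff_has_vector_derivative vector_derivative_works[symmetric])

text \<open>Only \<open>n\<close> and \<open>C\<close> are shared by all members; the scales, the
  interval and the functions vary with p.\<close>

locale stationary_phase_family = pointed_intervals P a b c M
  for P :: "'p set" and a b c M :: "'p \<Rightarrow> real" +
  fixes n :: nat and C :: "nat \<Rightarrow> real" and N T U :: "'p \<Rightarrow> real" and f g :: "'p \<Rightarrow> real \<Rightarrow> real"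
  assumes n_pos: "n \<ge> 1"
    and C_pos: "i \<le> 2 * n + 3 \<Longrightarrow> C i > 0"
    and N_pos: "p \<in> P \<Longrightarrow> N p > 0" and T_pos: "p \<in> P \<Longrightarrow> T p > 0" and U_pos: "p \<in> P \<Longrightarrow> U p > 0"
    and Ck_f: "p \<in> P \<Longrightarrow> Ck_on (2 * n + 3) (f p) {a p..b p}"
    and Ck_g: "p \<in> P \<Longrightarrow> Ck_on (2 * n + 1) (g p) {a p..b p}"
    and f_bound: "p \<in> P \<Longrightarrow> x \<in> {a p..b p} \<Longrightarrow> i \<in> {2..2 * n + 3} \<Longrightarrow>
       \<bar>deriv_on {a p..b p} i (f p) x\<bar> \<le> C i * (T p / M p ^ i)"
    and f2_lower: "p \<in> P \<Longrightarrow> x \<in> {a p..b p} \<Longrightarrow> deriv_on {a p..b p} 2 (f p) x \<ge> T p / (C 2 * (M p)\<^sup>2)"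
    and g_bound: "p \<in> P \<Longrightarrow> x \<in> {a p..b p} \<Longrightarrow> i \<le> 2 * n + 1 \<Longrightarrow>
       \<bar>deriv_on {a p..b p} i (g p) x\<bar> \<le> C i * (U p / N p ^ i)"
    and f1_neg: "p \<in> P \<Longrightarrow> x \<in> {a p..<c p} \<Longrightarrow> deriv_on {a p..b p} 1 (f p) x < 0"
    and f1_pos: "p \<in> P \<Longrightarrow> x \<in> {c p<..b p} \<Longrightarrow> deriv_on {a p..b p} 1 (f p) x > 0"
begin

abbreviation fd :: "nat \<Rightarrow> 'p \<Rightarrow> real \<Rightarrow> real" where "fd i p \<equiv> deriv_on {a p..b p} i (f p)"
abbreviation gd :: "nat \<Rightarrow> 'p \<Rightarrow> real \<Rightarrow> real" where "gd i p \<equiv> deriv_on {a p..b p} i (g p)"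
abbreviation lam :: "'p \<Rightarrow> nat \<Rightarrow> real" where "lam p \<equiv> taylor_coeff {a p..b p} (f p) (c p)"
abbreviation eta :: "'p \<Rightarrow> nat \<Rightarrow> real" where "eta p \<equiv> taylor_coeff {a p..b p} (g p) (c p)"

lemma fd_deriv: "i < 2 * n + 3 \<Longrightarrow> p \<in> P \<Longrightarrow> x \<in> {a p..b p} \<Longrightarrow>
    (fd i p has_real_derivative fd (Suc i) p x) (at x within {a p..b p})"
  using Ck_f Ck_on_has_real_derivative by blast

lemma gd_deriv: "i < 2 * n + 1 \<Longrightarrow> p \<in> P \<Longrightarrow> x \<in> {a p..b p} \<Longrightarrow>
    (gd i p has_real_derivative gd (Suc i) p x) (at x within {a p..b p})"
  using Ck_g Ck_on_has_real_derivative by blast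

lemma c_in: "p \<in> P \<Longrightarrow> c p \<in> {a p..b p}"
  using a_less_c[of p] c_less_b[of p] by simp

lemma D_in: "x \<in> D p \<Longrightarrow> x \<in> {a p..b p}"
  by (simp add: D_def)

lemma f1_c: "p \<in> P \<Longrightarrow> fd 1 p (c p) = 0"
proof -
  assume p: "p \<in> P"
  have cont: "continuous_on {a p..b p} (fd 1 p)"
    using fd_deriv[of 1 p] p by (intro DERIV_continuous_on) auto
  have ac: "a p < c p" "c p < b p" using p a_less_c c_less_b by auto
  have "\<not> fd 1 p (c p) > 0"
  proof
    assume *: "fd 1 p (c p) > 0"
    have "fd 1 p (a p) < 0" using f1_neg[OF p, of "a p"] ac by simp
    then obtain x where "a p \<le> x" "x \<le> c p" "fd 1 p x = 0"
      using IVT'[of "fd 1 p" "a p" 0 "c p"] * ac continuous_on_subset[OF cont, of "{a p..c p}"] by auto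
    then show False using f1_neg[OF p, of x] * by (cases "x = c p") auto
  qed
  moreover have "\<not> fd 1 p (c p) < 0"
  proof
    assume *: "fd 1 p (c p) < 0"
    have "fd 1 p (b p) > 0" using f1_pos[OF p, of "b p"] ac by simp
    then obtain x where "c p \<le> x" "x \<le> b p" "fd 1 p x = 0"
      using IVT'[of "fd 1 p" "c p" 0 "b p"] * ac continuous_on_subset[OF cont, of "{c p..b p}"] by auto
    then show False using f1_pos[OF p, of x] * by (cases "x = c p") auto
  qed
  ultimately show ?thesis by simp
qed

section \<open>Comparison of the phase with parabolas of curvature of order T / M^2\<close>

definition tau :: "'p \<Rightarrow> real" where "tau p = T p / (M p)\<^sup>2"

lemma tau_pos: "p \<in> P \<Longrightarrow> tau p > 0"
  unfolding tau_def by (intro divide_pos_pos zero_less_power T_pos M_pos)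

lemma C2_pos: "C 2 > 0" by (rule C_pos) simp

lemma f2_bounds:
  assumes "p \<in> P" "x \<in> {a p..b p}"
  shows "tau p / C 2 \<le> fd 2 p x" "fd 2 p x \<le> C 2 * tau p"
  using f_bound[OF assms, of 2] f2_lower[OF assms] by (auto simp: tau_def mult.commute)

lemma f1_bounds:
  assumes "p \<in> P" "x \<in> D p"
  shows "\<bar>fd 1 p x\<bar> \<le> C 2 * (tau p * r p x)" "fd 1 p x * (x - c p) \<ge> tau p / C 2 * (x - c p)\<^sup>2"
    "fd 1 p x * (x - c p) \<le> C 2 * tau p * (x - c p)\<^sup>2"
proof -
  obtain \<xi> where \<xi>: "\<xi> \<in> D p" "fd 1 p x - fd 1 p (c p) = fd (Suc 1) p \<xi> * (x - c p)"
    by (rule mvt_D[OF assms fd_deriv[of 1 p]]) (use assms in auto)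
  have eq: "fd 1 p x = fd 2 p \<xi> * (x - c p)"
    using \<xi>(2) f1_c[OF assms(1)] by (simp add: numeral_2_eq_2)
  note b = f2_bounds[OF assms(1) D_in[OF \<xi>(1)]]
  have pos: "tau p / C 2 > 0" using tau_pos[OF assms(1)] C2_pos by simp
  have "\<bar>fd 2 p \<xi>\<bar> \<le> C 2 * tau p" using b pos by simp
  then have "\<bar>fd 2 p \<xi>\<bar> * r p x \<le> C 2 * tau p * r p x" by (intro mult_right_mono) auto
  then show "\<bar>fd 1 p x\<bar> \<le> C 2 * (tau p * r p x)" unfolding eq by (simp add: abs_mult mult.assoc)
  have "fd 1 p x * (x - c p) = fd 2 p \<xi> * (x - c p)\<^sup>2" unfolding eq by (simp add: power2_eq_square)
  then show "fd 1 p x * (x - c p) \<ge> tau p / C 2 * (x - c p)\<^sup>2" "fd 1 p x * (x - c p) \<le> C 2 * tau p * (x - c p)\<^sup>2"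
    using mult_right_mono[OF b(1), of "(x - c p)\<^sup>2"] mult_right_mono[OF b(2), of "(x - c p)\<^sup>2"] by simp_all
qed

text \<open>The mean value theorem is applied to f - K (x - c)^2 / 2 with K the lower and the upper
  bound of f''. The derivative has a known sign relative to \<xi> - c, and \<xi> lies on the same
  side of c as x.\<close>

lemma f_bounds:
  assumes "p \<in> P" "x \<in> D p"
  shows "f p x - f p (c p) \<ge> tau p / C 2 * (x - c p)\<^sup>2 / 2" "f p x - f p (c p) \<le> C 2 * tau p * (x - c p)\<^sup>2 / 2"
proof -
  have *: "\<exists>\<xi>\<in>D p. (\<xi> - c p) * (x - c p) > 0 \<and> f p x - f p (c p) - K * (x - c p)\<^sup>2 / 2 = (fd 1 p \<xi> - K * (\<xi> - c p)) * (x - c p)" for K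
  proof -
    have "((\<lambda>x. f p x - K * (x - c p)\<^sup>2 / 2) has_real_derivative fd 1 p x - K * (x - c p)) (at x within {a p..b p})"
      if "x \<in> {a p..b p}" for x
      using fd_deriv[of 0 p x] that assms(1) by (auto intro!: derivative_eq_intros)
    note deriv = this
    show ?thesis
    proof (rule mvt_D[OF assms deriv])
      fix \<xi>
      assume "\<xi> \<in> D p" "(\<xi> - c p) * (x - c p) > 0"
        "f p x - K * (x - c p)\<^sup>2 / 2 - (f p (c p) - K * (c p - c p)\<^sup>2 / 2) = (fd 1 p \<xi> - K * (\<xi> - c p)) * (x - c p)"
      then show ?thesis by (intro bexI[of _ \<xi>]) auto
    qed
  qed
  obtain \<xi> where \<xi>: "\<xi> \<in> D p" "(\<xi> - c p) * (x - c p) > 0"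
      "f p x - f p (c p) - tau p / C 2 * (x - c p)\<^sup>2 / 2 = (fd 1 p \<xi> - tau p / C 2 * (\<xi> - c p)) * (x - c p)"
    using *[of "tau p / C 2"] by auto
  have "(fd 1 p \<xi> - tau p / C 2 * (\<xi> - c p)) * (\<xi> - c p) \<ge> 0"
    using f1_bounds(2)[OF assms(1) \<xi>(1)] by (simp add: left_diff_distrib power2_eq_square mult.assoc)
  then have "(fd 1 p \<xi> - tau p / C 2 * (\<xi> - c p)) * (x - c p) \<ge> 0"
    using \<xi>(2) by (auto simp: zero_le_mult_iff zero_less_mult_iff)
  then show "f p x - f p (c p) \<ge> tau p / C 2 * (x - c p)\<^sup>2 / 2" using \<xi>(3) by simp
  obtain \<xi> where \<xi>: "\<xi> \<in> D p" "(\<xi> - c p) * (x - c p) > 0"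
      "f p x - f p (c p) - C 2 * tau p * (x - c p)\<^sup>2 / 2 = (fd 1 p \<xi> - C 2 * tau p * (\<xi> - c p)) * (x - c p)"
    using *[of "C 2 * tau p"] by auto
  have "(fd 1 p \<xi> - C 2 * tau p * (\<xi> - c p)) * (\<xi> - c p) \<le> 0"
    using f1_bounds(3)[OF assms(1) \<xi>(1)] by (simp add: left_diff_distrib power2_eq_square mult.assoc)
  then have "(fd 1 p \<xi> - C 2 * tau p * (\<xi> - c p)) * (x - c p) \<le> 0"
    using \<xi>(2) by (auto simp: mult_le_0_iff zero_less_mult_iff)
  then show "f p x - f p (c p) \<le> C 2 * tau p * (x - c p)\<^sup>2 / 2" using \<xi>(3) by simp
qed

lemma lam_2: "lam p 2 = fd 2 p (c p) / 2"
  by (simp add: taylor_coeff_def fact_2)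

lemma lam_2_bounds:
  assumes "p \<in> P"
  shows "tau p / (2 * C 2) \<le> lam p 2" "lam p 2 \<le> C 2 * tau p / 2" "lam p 2 > 0"
  using f2_bounds[OF assms c_in[OF assms]] tau_pos[OF assms] C2_pos
  unfolding lam_2 by (auto intro: less_le_trans[rotated] divide_pos_pos)

lemma dominated_inverse_lam_2: "dominated (\<lambda>p x. inverse (lam p 2)) (\<lambda>p x. 1 / tau p)"
proof (rule dominatedI)
  fix p x assume p: "p \<in> P"
  show "norm (inverse (lam p 2)) \<le> 2 * C 2 * (1 / tau p)"
    using lam_2_bounds[OF p] tau_pos[OF p] C2_pos by (simp add: divide_simps mult_ac)
qed (use C2_pos in simp)

text \<open>The relative deviation of f - f(c) from its quadratic part, so that y^2 = (x - c)^2 (1 +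
  z).\<close>

definition z :: "'p \<Rightarrow> real \<Rightarrow> real" where
  "z p x = (f p x - f p (c p)) / (lam p 2 * (x - c p)\<^sup>2) - 1"

text \<open>This is y y' / (x - c), because f' = 2 \<lambda>_2 y y'.\<close>

definition phi :: "'p \<Rightarrow> real \<Rightarrow> real" where
  "phi p x = fd 1 p x / (2 * lam p 2 * (x - c p))"

text \<open>Numerator and denominator lie between the same multiples of
  \<open>tau p * (x - c p)\<^sup>2\<close>, so their quotient varies by at most the square of
  \<open>C 2\<close>. This keeps all real powers of 1 + z uniformly controlled.\<close>

lemma z_bounds:
  assumes "p \<in> P" "x \<in> D p"
  shows "1 + z p x \<in> {1 / (C 2)\<^sup>2..(C 2)\<^sup>2}"
proof -
  have u: "(x - c p)\<^sup>2 > 0" using assms(2) by (simp add: D_def)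
  note l = lam_2_bounds[OF assms(1)] and t = tau_pos[OF assms(1)]
  have "1 / (C 2)\<^sup>2 * (lam p 2 * (x - c p)\<^sup>2) \<le> 1 / (C 2)\<^sup>2 * (C 2 * tau p / 2 * (x - c p)\<^sup>2)"
    using l u by (intro mult_left_mono mult_right_mono) auto
  also have "\<dots> = tau p / C 2 * (x - c p)\<^sup>2 / 2" using C2_pos by (simp add: power2_eq_square)
  also have "\<dots> \<le> f p x - f p (c p)" by (rule f_bounds[OF assms])
  finally have 1: "1 / (C 2)\<^sup>2 * (lam p 2 * (x - c p)\<^sup>2) \<le> f p x - f p (c p)" .
  have "f p x - f p (c p) \<le> C 2 * tau p * (x - c p)\<^sup>2 / 2" by (rule f_bounds[OF assms])
  also have "\<dots> = (C 2)\<^sup>2 * (tau p / (2 * C 2) * (x - c p)\<^sup>2)" using C2_pos by (simp add: power2_eq_square)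
  also have "\<dots> \<le> (C 2)\<^sup>2 * (lam p 2 * (x - c p)\<^sup>2)"
    using l u by (intro mult_left_mono mult_right_mono) auto
  finally have 2: "f p x - f p (c p) \<le> (C 2)\<^sup>2 * (lam p 2 * (x - c p)\<^sup>2)" .
  have pos: "lam p 2 * (x - c p)\<^sup>2 > 0" using l u by simp
  show ?thesis
    using 1 2 pos by (simp add: z_def pos_le_divide_eq pos_divide_le_eq del: mult_eq_0_iff)
qed

lemma C2_ge_1: "p \<in> P \<Longrightarrow> C 2 \<ge> 1"
proof -
  assume p: "p \<in> P"
  have "tau p / C 2 \<le> C 2 * tau p" using f2_bounds[OF p c_in[OF p]] by simp
  then have "1 \<le> C 2 * C 2" using tau_pos[OF p] C2_pos by (simp add: divide_le_eq mult_ac)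
  then show ?thesis using C2_pos by (metis less_eq_real_def linorder_not_le mult_less_cancel_right2 order_less_le_trans)
qed

lemma dominated_fd: "i \<in> {2..2 * n + 3} \<Longrightarrow> dominated (fd i) (\<lambda>p x. T p / M p ^ i)"
  by (rule dominatedI[of _ "C i"]) (use f_bound D_in C_pos[of i] in auto)

lemma dominated_lam: "i \<in> {2..2 * n + 3} \<Longrightarrow> dominated (\<lambda>p x. lam p i) (\<lambda>p x. T p / M p ^ i)"
proof -
  assume i: "i \<in> {2..2 * n + 3}"
  show ?thesis
  proof (rule dominatedI)
    fix p x assume p: "p \<in> P"
    have "norm (lam p i) \<le> \<bar>fd i p (c p)\<bar> / 1"
      unfolding taylor_coeff_def by (simp add: divide_le_eq mult_le_cancel_left1 fact_ge_1)
    also have "\<dots> \<le> C i * (T p / M p ^ i)" using f_bound[OF p c_in[OF p] i] by simp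
    finally show "norm (lam p i) \<le> C i * (T p / M p ^ i)" .
  qed (use C_pos[of i] i in auto)
qed

text \<open>Since f'(c) = 0, order 0 gains the factor \<open>r\<close>; the higher derivatives fit
  because negative powers of M are at most those of \<open>r\<close>.\<close>

lemma symbol_f1: "symbol (2 * n + 2) (\<lambda>p x. tau p * r p x) (fd 1)"
proof (rule symbol_chain[where F = "\<lambda>i. fd (Suc i)" and m = "2 * n + 2", simplified One_nat_def[symmetric]])
  fix i p x assume "i < 2 * n + 2" "p \<in> P" "x \<in> D p"
  then show "(fd (Suc i) p has_vector_derivative fd (Suc (Suc i)) p x) (at x within D p)"
    using fd_deriv[of "Suc i" p x] at_within_D_eq[of p x] D_in by (simp add: has_real_derivative_iff_has_vector_derivative)
next
  fix i assume i: "i \<le> 2 * n + 2"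
  show "dominated (fd (Suc i)) (\<lambda>p x. tau p * r p x / r p x ^ i)"
  proof (cases i)
    case 0
    show ?thesis unfolding 0
      by (rule dominatedI[of _ "C 2"]) (use f1_bounds(1) C2_pos in auto)
  next
    case (Suc j)
    show ?thesis
    proof (rule dominated_mono[OF dominated_fd])
      fix p x assume px: "p \<in> P" "x \<in> D p"
      have "tau p * (1 / M p ^ j) \<le> tau p * (1 / r p x ^ j)"
        using r_le_M[OF px] M_pos[OF px(1)] r_pos[OF px(2)] tau_pos[OF px(1)]
        by (intro mult_left_mono divide_left_mono power_mono mult_pos_pos zero_less_power) auto
      moreover have "T p / M p ^ Suc i = tau p * (1 / M p ^ j)"
        by (simp add: tau_def Suc power2_eq_square)
      moreover have "tau p * r p x / r p x ^ i = tau p * (1 / r p x ^ j)"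
        using r_pos[OF px(2)] by (simp add: Suc)
      ultimately show "T p / M p ^ Suc i \<le> tau p * r p x / r p x ^ i" by simp
    qed (use Suc i in auto)
  qed
qed

lemma f1_neq_0: "p \<in> P \<Longrightarrow> x \<in> D p \<Longrightarrow> fd 1 p x \<noteq> 0"
  using f1_neg[of p x] f1_pos[of p x] by (force simp: D_def)

lemma dominated_inverse_f1: "dominated (\<lambda>p x. inverse (fd 1 p x)) (\<lambda>p x. 1 / (tau p * r p x))"
proof (rule dominatedI)
  fix p x assume px: "p \<in> P" "x \<in> D p"
  have "tau p / C 2 * (x - c p)\<^sup>2 \<le> \<bar>fd 1 p x\<bar> * r p x"
    using f1_bounds(2)[OF px] by (simp flip: abs_mult)
  then have "tau p / C 2 * r p x * r p x \<le> \<bar>fd 1 p x\<bar> * r p x"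
    by (simp add: power2_eq_square mult.assoc flip: abs_mult)
  then have *: "tau p / C 2 * r p x \<le> \<bar>fd 1 p x\<bar>" using r_pos[OF px(2)] by (simp only: mult_le_cancel_right)
  have "inverse \<bar>fd 1 p x\<bar> \<le> inverse (tau p / C 2 * r p x)"
    by (rule le_imp_inverse_le[OF *]) (use tau_pos[OF px(1)] C2_pos r_pos[OF px(2)] in simp)
  then show "norm (inverse (fd 1 p x)) \<le> C 2 * (1 / (tau p * r p x))"
    by (simp add: field_simps)
qed (use C2_pos in simp)

lemma symbol_inverse_f1: "symbol (2 * n + 2) (\<lambda>p x. 1 / (tau p * r p x)) (\<lambda>p x. inverse (fd 1 p x))"
proof (rule symbol_inverse[OF symbol_f1 dominated_inverse_f1 _ f1_neq_0])
  show "dominated (\<lambda>p x. tau p * r p x * (1 / (tau p * r p x))) (\<lambda>p x. 1)"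
    by (rule dominatedI[of _ 1]) auto
  show "0 \<le> 1 / (tau p * r p x)" if "p \<in> P" for p x
    using tau_pos[OF that] by simp
qed

abbreviation Z :: "'p \<Rightarrow> real fps" where "Z p \<equiv> ratio_fps (lam p)"

lemma Z_0: "Z p $ 0 = 0"
  by (simp add: ratio_fps_def)

lemma dominated_lam_ratio:
  assumes "k < 2 * n + 1"
  shows "dominated (\<lambda>p x. lam p (k + 2) * inverse (lam p 2)) (\<lambda>p x. 1 / M p ^ k)"
proof -
  have "dominated (\<lambda>p x. lam p (k + 2) * inverse (lam p 2)) (\<lambda>p x. T p / M p ^ (k + 2) * (1 / tau p))"
    using assms by (intro dominated_mult dominated_lam dominated_inverse_lam_2) auto
  then show ?thesis
  proof (rule dominated_mono)
    fix p x assume p: "p \<in> P"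
    show "T p / M p ^ (k + 2) * (1 / tau p) \<le> 1 / M p ^ k"
      using T_pos[OF p] M_pos[OF p] by (simp add: tau_def power_add power2_eq_square)
  qed
qed

text \<open>The Taylor remainder of f of order 2n+3 is divided by \<lambda>_2 (x - c)^2, which
  brings the order to 2n+1. The linear Taylor term vanishes with f'(c), so the quotient of the
  polynomial is 1 + Z, truncated.\<close>

lemma expansion_z: "expansion (2 * n + 1) (2 * n + 1) (\<lambda>p. 1) z Z"
  unfolding expansion_def
proof (intro conjI allI impI)
  fix k assume k: "k < 2 * n + 1"
  show "dominated (\<lambda>p x. Z p $ k) (\<lambda>p x. 1 / M p ^ k)"
  proof (cases "k = 0")
    case False
    then show ?thesis using dominated_lam_ratio[OF k] by (simp add: ratio_fps_def divide_inverse)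
  qed (simp add: ratio_fps_def)
next
  let ?R = "\<lambda>p x. fd 0 p x - (\<Sum>k<2 * n + 3. fd k p (c p) / fact k * (x - c p) ^ k)"
  have "symbol (2 * n + 3) (\<lambda>p x. T p / M p ^ (2 * n + 3) * r p x ^ (2 * n + 3)) ?R"
    by (rule symbol_taylor[where F = fd and m = "2 * n + 3", OF fd_deriv dominated_fd]) auto
  then have "symbol (2 * n + 1) (\<lambda>p x. T p / M p ^ (2 * n + 3) * r p x ^ (2 * n + 3)) ?R"
    by (rule symbol_le[rotated]) simp
  then have "symbol (2 * n + 1) (\<lambda>p x. T p / M p ^ (2 * n + 3) * r p x ^ (2 * n + 3) * (1 / tau p) * (1 / r p x) ^ 2)
      (\<lambda>p x. ?R p x * inverse (lam p 2) * inverse (x - c p) ^ 2)"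
    by (intro symbol_mult symbol_const dominated_inverse_lam_2 symbol_power symbol_inverse_id)
  then show "symbol (2 * n + 1) (\<lambda>p x. 1 * (r p x / M p) ^ (2 * n + 1))
      (\<lambda>p x. z p x - (\<Sum>k<2 * n + 1. Z p $ k * (x - c p) ^ k))"
  proof (rule symbol_cong')
    fix p x assume px: "p \<in> P" "x \<in> D p"
    show "T p / M p ^ (2 * n + 3) * r p x ^ (2 * n + 3) * (1 / tau p) * (1 / r p x) ^ 2 = 1 * (r p x / M p) ^ (2 * n + 1)"
    proof -
      have "q ^ (2 * n + 3) = q ^ (2 * n + 1) * q\<^sup>2" for q :: real
        by (simp add: power_add power2_eq_square power3_eq_cube)
      from this[of "r p x"] this[of "M p"] show ?thesis
        using T_pos[OF px(1)] M_pos[OF px(1)] r_pos[OF px(2)]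
        by (simp only: tau_def power_divide) (simp del: power_Suc)
    qed
    have u: "x - c p \<noteq> 0" using px(2) by (simp add: D_def)
    note l = lam_2_bounds(3)[OF px(1)]
    have sum: "(\<Sum>k<2 * n + 3. fd k p (c p) / fact k * (x - c p) ^ k) =
        f p (c p) + (x - c p)\<^sup>2 * lam p 2 * (1 + (\<Sum>k<2 * n + 1. Z p $ k * (x - c p) ^ k))"
    proof -
      have "(\<Sum>k<2 * n + 3. fd k p (c p) / fact k * (x - c p) ^ k) = (\<Sum>k<Suc (Suc (Suc (2 * n))). lam p k * (x - c p) ^ k)"
        by (simp add: taylor_coeff_def numeral_3_eq_3 del: sum.lessThan_Suc)
      also have "\<dots> = lam p 0 + (lam p 1 * (x - c p) + (lam p 2 * (x - c p)\<^sup>2 + (\<Sum>k<2 * n. lam p (k + 3) * (x - c p) ^ (k + 3))))"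
        by (simp only: sum.lessThan_Suc_shift) (simp add: numeral_2_eq_2 numeral_3_eq_3)
      also have "lam p 0 = f p (c p)" by (simp add: taylor_coeff_def)
      also have "lam p 1 = 0" using f1_c[OF px(1)] by (simp add: taylor_coeff_def)
      also have "(\<Sum>k<2 * n. lam p (k + 3) * (x - c p) ^ (k + 3)) = (x - c p)\<^sup>2 * lam p 2 * (\<Sum>k<2 * n. Z p $ Suc k * (x - c p) ^ Suc k)"
        unfolding sum_distrib_left
        by (intro sum.cong refl) (use l in \<open>simp add: ratio_fps_def power_add numeral_3_eq_3 numeral_2_eq_2\<close>)
      also have "(\<Sum>k<2 * n. Z p $ Suc k * (x - c p) ^ Suc k) = (\<Sum>k<2 * n + 1. Z p $ k * (x - c p) ^ k)"
        by (simp only: sum.lessThan_Suc_shift Suc_eq_plus1[symmetric]) (simp add: Z_0)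
      finally show ?thesis by (simp add: algebra_simps)
    qed
    show "?R p x * inverse (lam p 2) * inverse (x - c p) ^ 2 = z p x - (\<Sum>k<2 * n + 1. Z p $ k * (x - c p) ^ k)"
      unfolding sum z_def using l u by (simp add: field_simps)
  qed
qed

lemma phi_fps_nth: "p \<in> P \<Longrightarrow> phi_fps (Z p) $ k = real (k + 2) / 2 * (lam p (k + 2) * inverse (lam p 2))"
  using lam_2_bounds(3)[of p]
  by (cases k) (auto simp: phi_fps_def ratio_fps_def field_simps numeral_2_eq_2 mult.assoc)

text \<open>As for \<open>z\<close>, now with the remainder of f' of order 2n+2 and one division by
  x - c.\<close>

lemma expansion_phi: "expansion (2 * n + 1) (2 * n + 1) (\<lambda>p. 1) phi (\<lambda>p. phi_fps (Z p))"
  unfolding expansion_def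
proof (intro conjI allI impI)
  fix k assume k: "k < 2 * n + 1"
  show "dominated (\<lambda>p x. phi_fps (Z p) $ k) (\<lambda>p x. 1 / M p ^ k)"
    using dominated_cmult[OF dominated_lam_ratio[OF k], of "real (k + 2) / 2"]
    by (rule dominated_cong[THEN iffD1, rotated 2]) (auto simp: phi_fps_nth)
next
  let ?R = "\<lambda>p x. fd (Suc 0) p x - (\<Sum>k<2 * n + 2. fd (Suc k) p (c p) / fact k * (x - c p) ^ k)"
  have "symbol (2 * n + 2) (\<lambda>p x. T p / M p ^ (2 * n + 3) * r p x ^ (2 * n + 2)) ?R"
  proof (rule symbol_taylor[where F = "\<lambda>i. fd (Suc i)" and m = "2 * n + 2"])
    show "dominated (fd (Suc (2 * n + 2))) (\<lambda>p x. T p / M p ^ (2 * n + 3))"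
      using dominated_fd[of "2 * n + 3"] by (simp add: numeral_3_eq_3)
  qed (use fd_deriv in auto)
  then have "symbol (2 * n + 1) (\<lambda>p x. T p / M p ^ (2 * n + 3) * r p x ^ (2 * n + 2)) ?R"
    by (rule symbol_le[rotated]) simp
  then have "symbol (2 * n + 1) (\<lambda>p x. T p / M p ^ (2 * n + 3) * r p x ^ (2 * n + 2) * (1 / tau p) * (1 / r p x))
      (\<lambda>p x. 1 / 2 * (?R p x * inverse (lam p 2) * inverse (x - c p)))"
    by (intro symbol_mult symbol_cmult symbol_const dominated_inverse_lam_2 symbol_inverse_id)
  then show "symbol (2 * n + 1) (\<lambda>p x. 1 * (r p x / M p) ^ (2 * n + 1))
      (\<lambda>p x. phi p x - (\<Sum>k<2 * n + 1. phi_fps (Z p) $ k * (x - c p) ^ k))"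
  proof (rule symbol_cong')
    fix p x assume px: "p \<in> P" "x \<in> D p"
    show "T p / M p ^ (2 * n + 3) * r p x ^ (2 * n + 2) * (1 / tau p) * (1 / r p x) = 1 * (r p x / M p) ^ (2 * n + 1)"
    proof -
      have "q ^ (2 * n + 3) = q ^ (2 * n + 1) * q\<^sup>2" "q ^ (2 * n + 2) = q ^ (2 * n + 1) * q" for q :: real
        by (simp_all add: power_add power2_eq_square power3_eq_cube)
      from this(2)[of "r p x"] this(1)[of "M p"] show ?thesis
        using T_pos[OF px(1)] M_pos[OF px(1)] r_pos[OF px(2)]
        by (simp only: tau_def power_divide) (simp del: power_Suc)
    qed
    have u: "x - c p \<noteq> 0" using px(2) by (simp add: D_def)
    note l = lam_2_bounds(3)[OF px(1)]
    have sum: "(\<Sum>k<2 * n + 2. fd (Suc k) p (c p) / fact k * (x - c p) ^ k) =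
        2 * (x - c p) * lam p 2 * (\<Sum>k<2 * n + 1. phi_fps (Z p) $ k * (x - c p) ^ k)"
    proof -
      have "(\<Sum>k<2 * n + 2. fd (Suc k) p (c p) / fact k * (x - c p) ^ k) =
          fd 1 p (c p) + (\<Sum>k<2 * n + 1. fd (k + 2) p (c p) / fact (Suc k) * (x - c p) ^ Suc k)"
        by (simp only: add_2_eq_Suc' sum.lessThan_Suc_shift Suc_eq_plus1[symmetric]) simp
      also have "fd 1 p (c p) = 0" by (rule f1_c[OF px(1)])
      also have "(\<Sum>k<2 * n + 1. fd (k + 2) p (c p) / fact (Suc k) * (x - c p) ^ Suc k) =
          2 * (x - c p) * lam p 2 * (\<Sum>k<2 * n + 1. phi_fps (Z p) $ k * (x - c p) ^ k)"
        unfolding sum_distrib_left phi_fps_nth[OF px(1)]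
      proof (intro sum.cong refl)
        fix k
        have "lam p (k + 2) * real (k + 2) = fd (k + 2) p (c p) / fact (Suc k)"
          by (simp add: taylor_coeff_def field_simps del: of_nat_Suc)
        then have "fd (k + 2) p (c p) / fact (Suc k) * (x - c p) ^ Suc k =
            (lam p (k + 2) * real (k + 2)) * (x - c p) ^ Suc k * (lam p 2 * inverse (lam p 2))"
          using l by simp
        then show "fd (k + 2) p (c p) / fact (Suc k) * (x - c p) ^ Suc k =
            2 * (x - c p) * lam p 2 * (real (k + 2) / 2 * (lam p (k + 2) * inverse (lam p 2)) * (x - c p) ^ k)"
          by (simp only: power_Suc) (simp add: mult_ac)
      qed
      finally show ?thesis by simp
    qed
    show "1 / 2 * (?R p x * inverse (lam p 2) * inverse (x - c p)) = phi p x - (\<Sum>k<2 * n + 1. phi_fps (Z p) $ k * (x - c p) ^ k)"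
      unfolding sum phi_def using l u by (simp add: field_simps)
  qed
qed

end

lemma (in pointed_intervals) expansion_X_power:
  assumes "k < K"
  shows "expansion m K (\<lambda>p. M p ^ k) (\<lambda>p x. (x - c p) ^ k) (\<lambda>p. fps_X ^ k)"
proof -
  have "dominated (\<lambda>p x. (fps_X ^ k) $ i :: real) (\<lambda>p x. M p ^ k / M p ^ i)" for i
  proof (rule dominatedI)
    fix p x assume p: "p \<in> P"
    show "norm ((fps_X ^ k) $ i :: real) \<le> 1 * (M p ^ k / M p ^ i)"
      using M_pos[OF p] by (auto simp: fps_X_power_nth intro!: divide_nonneg_nonneg zero_le_power)
  qed simp
  moreover have "(\<Sum>i<K. (fps_X ^ k) $ i * (x - c p) ^ i) = (x - c p) ^ k" for p x
    using assms by (subst sum.remove[of _ k]) (auto intro!: sum.neutral simp: fps_X_power_nth)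
  ultimately show ?thesis by (simp add: expansion_def)
qed

context stationary_phase_family
begin

section \<open>Uniform size of the remainder R\<close>

definition rho :: "'p \<Rightarrow> real" where "rho p = 1 + M p / N p"

text \<open>In units of M, the derivative of g of order 2n+1 has size U (M/N)^(2n+1). The 1 in
  \<open>rho\<close> accounts for variation on the scale M itself and makes the powers of
  \<open>rho\<close> increase.\<close>

definition V :: "'p \<Rightarrow> real" where "V p = U p * rho p ^ (2 * n + 1)"

lemma rho_ge_1: "p \<in> P \<Longrightarrow> rho p \<ge> 1"
  using M_pos[of p] N_pos[of p] by (simp add: rho_def)

lemma V_pos: "p \<in> P \<Longrightarrow> V p > 0"
  using rho_ge_1[of p] U_pos[of p] by (simp add: V_def)

lemma U_rho_le_V: "p \<in> P \<Longrightarrow> k \<le> 2 * n + 1 \<Longrightarrow> U p * rho p ^ k \<le> V p"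
  unfolding V_def using rho_ge_1[of p] U_pos[of p] by (intro mult_left_mono power_increasing) auto

definition w :: "'p \<Rightarrow> nat \<Rightarrow> real" where "w p k = lagrange_coeff (Z p) (eta p) k"

definition basis_weight :: "nat \<Rightarrow> 'p \<Rightarrow> real \<Rightarrow> real" where
  "basis_weight k p x = phi p x * (x - c p) ^ k * (1 + z p x) powr ((real k - 1) / 2)"

text \<open>\<open>w p k\<close> is \<open>\<varpi>\<^sub>k\<close>, and \<open>basis_weight k\<close> is \<open>y\<^sup>k y'\<close> written without \<open>y\<close>.\<close>

definition R :: "'p \<Rightarrow> real \<Rightarrow> real" where
  "R p x = g p x - (\<Sum>k<2 * n + 1. w p k * basis_weight k p x)"

lemma expansion_z_powr: "expansion (2 * n + 1) (2 * n + 1) (\<lambda>p. 1) (\<lambda>p x. (1 + z p x) powr s) (\<lambda>p. hpow (Z p) s)"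
\<comment> \<open>That \<open>C 2\<close> is at least 1 is read off from the two bounds on f'' for
  some member of \<open>P\<close>; over the empty family the claim is vacuous.\<close>
proof (cases "P = {}")
  case True
  then have noP: "p \<notin> P" for p by simp
  have "symbol m W q" for m W and q :: "'p \<Rightarrow> real \<Rightarrow> real"
    by (induction m arbitrary: W q) (auto simp: dominated_def noP)
  then show ?thesis by (auto simp: expansion_def dominated_def noP)
next
  case False
  then have C2: "C 2 \<ge> 1" using C2_ge_1 by auto
  show ?thesis
  proof (rule expansion_powr[OF expansion_z Z_0 _ _ _ _ z_bounds])
    show "1 / (C 2)\<^sup>2 \<le> 1" "1 \<le> (C 2)\<^sup>2" "0 < 1 / (C 2)\<^sup>2"
      using C2 one_le_power[OF C2, of 2] by (auto simp: divide_le_eq)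
  qed auto
qed

lemma expansion_basis_weight:
  assumes "k < 2 * n + 1"
  shows "expansion (2 * n + 1) (2 * n + 1) (\<lambda>p. M p ^ k) (basis_weight k)
    (\<lambda>p. phi_fps (Z p) * fps_X ^ k * hpow (Z p) ((real k - 1) / 2))"
proof -
  have "expansion (2 * n + 1) (2 * n + 1) (\<lambda>p. 1 * M p ^ k * 1)
      (\<lambda>p x. phi p x * (x - c p) ^ k * (1 + z p x) powr ((real k - 1) / 2))
      (\<lambda>p. phi_fps (Z p) * fps_X ^ k * hpow (Z p) ((real k - 1) / 2))"
    using M_pos by (intro expansion_mult expansion_phi expansion_X_power assms expansion_z_powr) (auto simp: less_imp_le)
  then show ?thesis by (simp add: basis_weight_def[abs_def])
qed

lemma dominated_eta: "i \<le> 2 * n + 1 \<Longrightarrow> dominated (\<lambda>p x. eta p i) (\<lambda>p x. U p / N p ^ i)"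
proof -
  assume i: "i \<le> 2 * n + 1"
  show ?thesis
  proof (rule dominatedI)
    fix p x assume p: "p \<in> P"
    have "norm (eta p i) \<le> \<bar>gd i p (c p)\<bar> / 1"
      unfolding taylor_coeff_def by (simp add: divide_le_eq mult_le_cancel_left1 fact_ge_1)
    also have "\<dots> \<le> C i * (U p / N p ^ i)" using g_bound[OF p c_in[OF p] i] by simp
    finally show "norm (eta p i) \<le> C i * (U p / N p ^ i)" .
  qed (use C_pos[of i] i in auto)
qed

text \<open>The l-th summand is of order U (M/N)^l / M^k, and (M/N)^l is at most a k-th power of
  \<open>rho\<close>.\<close>

lemma dominated_w:
  assumes k: "k < 2 * n + 1"
  shows "dominated (\<lambda>p x. w p k) (\<lambda>p x. U p * rho p ^ k / M p ^ k)"
  unfolding w_def lagrange_coeff_def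
proof (rule dominated_sum)
  fix l assume l: "l \<in> {..k}"
  have "dominated (\<lambda>p x. eta p l * hpow (Z p) (- (real k + 1) / 2) $ (k - l)) (\<lambda>p x. U p / N p ^ l * (1 / M p ^ (k - l)))"
    using expansion_z_powr[of "- (real k + 1) / 2"] l k by (intro dominated_mult dominated_eta) (auto simp: expansion_def)
  then show "dominated (\<lambda>p x. eta p l * hpow (Z p) (- (real k + 1) / 2) $ (k - l)) (\<lambda>p x. U p * rho p ^ k / M p ^ k)"
  proof (rule dominated_mono)
    fix p x assume p: "p \<in> P"
    have "(M p / N p) ^ l \<le> rho p ^ l"
      using M_pos[OF p] N_pos[OF p] by (intro power_mono) (auto simp: rho_def)
    also have "\<dots> \<le> rho p ^ k" using rho_ge_1[OF p] l by (intro power_increasing) auto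
    finally have "U p * (M p / N p) ^ l / M p ^ k \<le> U p * rho p ^ k / M p ^ k"
      using U_pos[OF p] M_pos[OF p] by (intro divide_right_mono mult_left_mono) auto
    moreover have "M p ^ k = M p ^ l * M p ^ (k - l)" using l by (simp flip: power_add)
    ultimately show "U p / N p ^ l * (1 / M p ^ (k - l)) \<le> U p * rho p ^ k / M p ^ k"
      using M_pos[OF p] by (simp add: power_divide)
  qed
qed

text \<open>R is the Taylor remainder of g minus the remainders of the weighted y^k y'; Lagrange
  inversion makes the Taylor polynomials cancel.\<close>

lemma symbol_R: "symbol (2 * n + 1) (\<lambda>p x. V p * (r p x / M p) ^ (2 * n + 1)) R"
proof -
  let ?K = "2 * n + 1"
  let ?B = "\<lambda>k p. phi_fps (Z p) * fps_X ^ k * hpow (Z p) ((real k - 1) / 2)"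
  let ?W = "\<lambda>p x. V p * (r p x / M p) ^ ?K"
  let ?g = "\<lambda>p x. gd 0 p x - (\<Sum>k<?K. gd k p (c p) / fact k * (x - c p) ^ k)"
  have "symbol ?K (\<lambda>p x. U p / N p ^ ?K * r p x ^ ?K) ?g"
  proof (rule symbol_taylor[where F = gd, OF gd_deriv])
    show "dominated (gd ?K) (\<lambda>p x. U p / N p ^ ?K)"
      by (rule dominatedI[of _ "C ?K"]) (use g_bound D_in C_pos[of ?K] in \<open>auto simp del: power_Suc\<close>)
  qed auto
  then have 1: "symbol ?K ?W ?g"
  proof (rule symbol_mono, intro conjI)
    fix p x assume px: "p \<in> P" "x \<in> D p"
    show "0 \<le> U p / N p ^ ?K * r p x ^ ?K"
      using U_pos[OF px(1)] N_pos[OF px(1)] by (intro mult_nonneg_nonneg divide_nonneg_nonneg) auto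
    have "(M p / N p) ^ ?K \<le> rho p ^ ?K"
      using M_pos[OF px(1)] N_pos[OF px(1)] by (intro power_mono) (auto simp: rho_def)
    then have "U p * (M p / N p) ^ ?K * (r p x / M p) ^ ?K \<le> V p * (r p x / M p) ^ ?K"
      unfolding V_def using U_pos[OF px(1)] ratio_le_1[OF px]
      by (intro mult_right_mono mult_left_mono zero_le_power) auto
    moreover have "U p * (M p / N p) ^ ?K * (r p x / M p) ^ ?K = U p / N p ^ ?K * r p x ^ ?K"
      using M_pos[OF px(1)] by (simp only: power_divide) simp
    ultimately show "U p / N p ^ ?K * r p x ^ ?K \<le> V p * (r p x / M p) ^ ?K" by simp
  qed
  have 2: "symbol ?K ?W (\<lambda>p x. \<Sum>k<?K. w p k * (basis_weight k p x - (\<Sum>j<?K. ?B k p $ j * (x - c p) ^ j)))"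
  proof (rule symbol_sum)
    fix k assume k: "k \<in> {..<?K}"
    then have "symbol ?K (\<lambda>p x. U p * rho p ^ k / M p ^ k * (M p ^ k * (r p x / M p) ^ ?K))
       (\<lambda>p x. w p k * (basis_weight k p x - (\<Sum>j<?K. ?B k p $ j * (x - c p) ^ j)))"
      using expansion_basis_weight[of k] by (intro symbol_mult symbol_const dominated_w) (auto simp: expansion_def)
    then show "symbol ?K ?W (\<lambda>p x. w p k * (basis_weight k p x - (\<Sum>j<?K. ?B k p $ j * (x - c p) ^ j)))"
    proof (rule symbol_mono, intro conjI)
      fix p x assume px: "p \<in> P" "x \<in> D p"
      have eq: "U p * rho p ^ k / M p ^ k * (M p ^ k * (r p x / M p) ^ ?K) = U p * rho p ^ k * (r p x / M p) ^ ?K"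
        using M_pos[OF px(1)] by simp
      show "0 \<le> U p * rho p ^ k / M p ^ k * (M p ^ k * (r p x / M p) ^ ?K)"
        unfolding eq using U_pos[OF px(1)] rho_ge_1[OF px(1)] ratio_le_1[OF px] by (intro mult_nonneg_nonneg zero_le_power) auto
      show "U p * rho p ^ k / M p ^ k * (M p ^ k * (r p x / M p) ^ ?K) \<le> V p * (r p x / M p) ^ ?K"
        unfolding eq using U_rho_le_V[OF px(1), of k] k ratio_le_1[OF px]
        by (intro mult_right_mono zero_le_power) auto
    qed
  qed
  show ?thesis
  proof (rule symbol_cong[OF symbol_diff[OF 1 2]])
    fix p x
    have B: "?B k p $ j = (if j < k then 0 else (phi_fps (Z p) * hpow (Z p) ((real k - 1) / 2)) $ (j - k))" for k j
    proof -
      have "?B k p = fps_X ^ k * (phi_fps (Z p) * hpow (Z p) ((real k - 1) / 2))" by (simp only: mult_ac)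
      then show ?thesis by (simp only: fps_X_power_mult_nth)
    qed
    \<comment> \<open>Equality of the j-th Taylor coefficients. Only k \<le> j contribute, as y^k y'
      starts in degree k.\<close>
    have "eta p j = (\<Sum>k<?K. w p k * ?B k p $ j)" if j: "j < ?K" for j
    proof -
      have "(\<Sum>k<?K. w p k * ?B k p $ j) = (\<Sum>k\<le>j. w p k * ?B k p $ j)"
        using j by (intro sum.mono_neutral_right) (auto simp: B)
      also have "\<dots> = (\<Sum>k\<le>j. w p k * (phi_fps (Z p) * hpow (Z p) ((real k - 1) / 2)) $ (j - k))"
        by (intro sum.cong refl) (simp add: B)
      also have "\<dots> = eta p j"
        unfolding w_def by (rule lagrange_inversion[OF Z_0, symmetric])
      finally show ?thesis by simp
    qed
    then have "(\<Sum>j<?K. eta p j * (x - c p) ^ j) = (\<Sum>j<?K. (\<Sum>k<?K. w p k * ?B k p $ j) * (x - c p) ^ j)"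
      by (intro sum.cong refl) (simp del: sum.lessThan_Suc)
    also have "\<dots> = (\<Sum>k<?K. w p k * (\<Sum>j<?K. ?B k p $ j * (x - c p) ^ j))"
      unfolding sum_distrib_left sum_distrib_right by (subst sum.swap) (simp only: mult.assoc)
    finally have "(\<Sum>j<?K. gd j p (c p) / fact j * (x - c p) ^ j) = (\<Sum>k<?K. w p k * (\<Sum>j<?K. ?B k p $ j * (x - c p) ^ j))"
      by (simp only: taylor_coeff_def)
    then show "?g p x - (\<Sum>k<?K. w p k * (basis_weight k p x - (\<Sum>j<?K. ?B k p $ j * (x - c p) ^ j))) = R p x"
      by (simp only: R_def deriv_on.simps(1) right_diff_distrib sum_subtractf)
  qed
qed

section \<open>The functions H_t of the remainder\<close>

definition HR :: "nat \<Rightarrow> 'p \<Rightarrow> real \<Rightarrow> complex" where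
  "HR t p = H {a p..b p} (f p) (R p) t"

text \<open>With v = \<open>r / M\<close>, each step divides by f' and differentiates, at the cost 1
  / (tau r * r) = 1 / (T v^2); the starting size is that of R / f'.\<close>

abbreviation HR_weight :: "nat \<Rightarrow> 'p \<Rightarrow> real \<Rightarrow> real" where
  "HR_weight t p x \<equiv> V p * M p * (r p x / M p) ^ (2 * n + 2) / (T p * (r p x / M p)\<^sup>2) ^ Suc t"

lemma HR_1: "HR (Suc 0) p x = of_real (R p x) * (inverse (2 * of_real pi * \<i>) * of_real (inverse (fd 1 p x)))"
  by (simp only: HR_def H.simps divide_inverse inverse_mult_distrib of_real_inverse mult.assoc)

lemma HR_Suc: "HR (Suc (Suc t)) p x = - vector_derivative (HR (Suc t) p) (at x within {a p..b p}) *
    (inverse (2 * of_real pi * \<i>) * of_real (inverse (fd 1 p x)))"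
  by (simp only: HR_def H.simps divide_inverse inverse_mult_distrib of_real_inverse mult.assoc)

text \<open>Each step uses up one of the 2n+1 derivatives controlled for R, so H_(n+2) still has n
  of them.\<close>

lemma symbol_HR:
  assumes "t \<le> n + 1"
  shows "symbol (2 * n + 1 - t) (HR_weight t) (HR (Suc t))"
  using assms
proof (induction t)
  case 0
  have i: "symbol (2 * n + 1) (\<lambda>p x. 1 / (tau p * r p x)) (\<lambda>p x. inverse (2 * of_real pi * \<i>) * (of_real (inverse (fd 1 p x)) :: complex))"
    by (intro symbol_cmult symbol_of_real symbol_le[OF _ symbol_inverse_f1]) auto
  show ?case unfolding minus_nat.diff_0
  proof (rule symbol_cong'[OF symbol_mult[OF symbol_of_real[OF symbol_R] i]])
    fix p x assume px: "p \<in> P" "x \<in> D p"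
    show "of_real (R p x) * (inverse (2 * of_real pi * \<i>) * of_real (inverse (fd 1 p x))) = HR (Suc 0) p x"
      by (rule HR_1[symmetric])
    have alg: "V' * (s / m) ^ (2 * n + 1) * (1 / (T' / m\<^sup>2 * s)) = V' * m * (s / m) ^ (2 * n + 2) / (T' * (s / m)\<^sup>2) ^ Suc 0"
      if "s > 0" "m > 0" "T' > 0" for V' s m T' :: real
    proof -
      have "(s / m) ^ (2 * n + 2) = (s / m) ^ (2 * n + 1) * (s / m)" by simp
      then show ?thesis using that by (simp only:) (simp add: field_simps power2_eq_square)
    qed
    show "V p * (r p x / M p) ^ (2 * n + 1) * (1 / (tau p * r p x)) =
        HR_weight 0 p x"
      unfolding tau_def by (rule alg[OF r_pos[OF px(2)] M_pos[OF px(1)] T_pos[OF px(1)]])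
  qed
next
  case (Suc t)
  define W where "W = HR_weight t"
  have eq: "2 * n + 1 - t = Suc (2 * n + 1 - Suc t)" using Suc.prems by simp
  have "symbol (Suc (2 * n + 1 - Suc t)) W (HR (Suc t))"
    using Suc unfolding eq[symmetric] W_def by simp
  from symbol_vector_derivative[OF this]
  have "symbol (2 * n + 1 - Suc t) (\<lambda>p x. W p x / r p x) (\<lambda>p x. vector_derivative (HR (Suc t) p) (at x within {a p..b p}))" .
  moreover have "symbol (2 * n + 1 - Suc t) (\<lambda>p x. 1 / (tau p * r p x)) (\<lambda>p x. inverse (2 * of_real pi * \<i>) * (of_real (inverse (fd 1 p x)) :: complex))"
    by (intro symbol_cmult symbol_of_real symbol_le[OF _ symbol_inverse_f1]) auto
  ultimately have "symbol (2 * n + 1 - Suc t) (\<lambda>p x. W p x / r p x * (1 / (tau p * r p x)))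
    (\<lambda>p x. - vector_derivative (HR (Suc t) p) (at x within {a p..b p}) *
      (inverse (2 * of_real pi * \<i>) * of_real (inverse (fd 1 p x))))"
    by (intro symbol_mult symbol_minus)
  then show ?case
  proof (rule symbol_cong')
    fix p x assume px: "p \<in> P" "x \<in> D p"
    have "W p x / r p x * (1 / (tau p * r p x)) = W p x / (T p * (r p x / M p)\<^sup>2)"
      using M_pos[OF px(1)] by (simp add: tau_def power_divide) (simp add: power2_eq_square)
    then show "W p x / r p x * (1 / (tau p * r p x)) =
        HR_weight (Suc t) p x"
      by (simp add: W_def)
  qed (simp only: HR_Suc)
qed

section \<open>The quadratic coordinate and the decomposition of H_t\<close>

definition y :: "'p \<Rightarrow> real \<Rightarrow> real" where
  "y p x = sgn (x - c p) * sqrt ((f p x - f p (c p)) / lam p 2)"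

lemma y_eq: 
  assumes "p \<in> P" "x \<in> D p"
  shows "y p x = (x - c p) * sqrt (1 + z p x)" "y p x \<noteq> 0" "lam p 2 * (y p x)\<^sup>2 = f p x - f p (c p)"
    "basis_weight k p x = fd 1 p x / (2 * lam p 2 * y p x) * y p x ^ k"
proof -
  have u: "x - c p \<noteq> 0" using assms(2) by (simp add: D_def)
  note l = lam_2_bounds(3)[OF assms(1)]
  have z: "1 + z p x > 0" using z_bounds[OF assms] C2_pos by (auto intro: less_le_trans[rotated])
  have q: "(f p x - f p (c p)) / lam p 2 = (x - c p)\<^sup>2 * (1 + z p x)"
    using l u by (simp add: z_def)
  show y: "y p x = (x - c p) * sqrt (1 + z p x)"
    unfolding y_def q by (simp add: real_sqrt_mult mult.assoc[symmetric] sgn_mult_abs)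
  show y0: "y p x \<noteq> 0" using y u z by simp
  show "lam p 2 * (y p x)\<^sup>2 = f p x - f p (c p)"
    using l u z by (simp add: y power_mult_distrib q[symmetric])
  have "(1 + z p x) powr ((real k - 1) / 2) = (1 + z p x) powr (real k / 2 - 1 / 2)"
    by (simp add: diff_divide_distrib)
  also have "\<dots> = sqrt (1 + z p x) ^ k / sqrt (1 + z p x)"
  proof -
    have "(1 + z p x) powr (real k / 2) = sqrt (1 + z p x) powr real k"
      using z powr_powr[of "1 + z p x" "1 / 2" "real k"] by (simp add: powr_half_sqrt)
    also have "\<dots> = sqrt (1 + z p x) ^ k"
      using z by (intro powr_realpow) simp
    finally show ?thesis using z by (simp only: powr_diff powr_half_sqrt less_imp_le)
  qed
  finally show "basis_weight k p x = fd 1 p x / (2 * lam p 2 * y p x) * y p x ^ k"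
    by (simp add: basis_weight_def phi_def y power_mult_distrib)
qed

lemma y_deriv:
  assumes "p \<in> P" "x \<in> D p"
  shows "(y p has_vector_derivative fd 1 p x / (2 * lam p 2 * y p x)) (at x within {a p..b p})"
proof -
  have u: "x - c p \<noteq> 0" using assms(2) by (simp add: D_def)
  note l = lam_2_bounds(3)[OF assms(1)]
  have pos: "(f p x - f p (c p)) / lam p 2 > 0"
    using y_eq(2,3)[OF assms] l by (metis nonzero_mult_div_cancel_left less_irrefl zero_less_power2)
  have y: "y p x = sgn (x - c p) * sqrt ((f p x - f p (c p)) / lam p 2)" by (simp add: y_def)
  \<comment> \<open>The sign is frozen at x: points closer to x than \<open>c p\<close> lie on the
    same side of \<open>c p\<close>.\<close>
  have "((\<lambda>t. sgn (x - c p) * sqrt ((f p t - f p (c p)) / lam p 2)) has_real_derivative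
      sgn (x - c p) * (inverse (sqrt ((f p x - f p (c p)) / lam p 2)) / 2 * (fd 1 p x / lam p 2))) (at x within D p)"
  proof (intro DERIV_cmult DERIV_chain2[where f = sqrt and g = "\<lambda>t. (f p t - f p (c p)) / lam p 2", OF DERIV_real_sqrt[OF pos]] DERIV_cdivide)
    have "(f p has_real_derivative fd 1 p x) (at x within D p)"
      using fd_deriv[of 0 p x] assms at_within_D_eq[OF assms] D_in[OF assms(2)] by simp
    from DERIV_diff[OF this DERIV_const] show "((\<lambda>t. f p t - f p (c p)) has_real_derivative fd 1 p x) (at x within D p)"
      by simp
  qed
  also have "sgn (x - c p) * (inverse (sqrt ((f p x - f p (c p)) / lam p 2)) / 2 * (fd 1 p x / lam p 2)) =
      fd 1 p x / (2 * lam p 2 * y p x)"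
  proof -
    have alg: "\<sigma> * (inverse S / 2 * (F / l)) = F / (2 * l * (\<sigma> * S))" if "\<sigma> = 1 \<or> \<sigma> = -1" for \<sigma> S F l :: real
      using that by (auto simp: inverse_eq_divide)
    have "sgn (x - c p) = 1 \<or> sgn (x - c p) = -1" using u by (simp add: sgn_if)
    from alg[OF this] show ?thesis by (simp only: y)
  qed
  finally have "((\<lambda>t. sgn (x - c p) * sqrt ((f p t - f p (c p)) / lam p 2)) has_vector_derivative
      fd 1 p x / (2 * lam p 2 * y p x)) (at x within {a p..b p})"
    unfolding at_within_D_eq[OF assms] by (simp only: has_real_derivative_iff_has_vector_derivative)
  then show ?thesis
  proof (rule has_vector_derivative_transform_within[where d = "r p x"])
    fix t assume "t \<in> {a p..b p}" "dist t x < r p x"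
    then have "sgn (t - c p) = sgn (x - c p)" by (auto simp: dist_real_def sgn_if)
    then show "sgn (x - c p) * sqrt ((f p t - f p (c p)) / lam p 2) = y p t" by (simp add: y_def)
  qed (use r_pos[OF assms(2)] D_in[OF assms(2)] in auto)
qed

abbreviation mu :: "'p \<Rightarrow> complex" where "mu p \<equiv> quad_mu (lam p 2)"

text \<open>The chain rule turns \<mu> y y' into 2 \<pi> i f', so the recursion in y becomes the
  recursion in x.\<close>

lemma hmon_y_deriv:
  assumes "p \<in> P" "x \<in> D p" "t \<ge> 1"
  shows "((\<lambda>x. hmon (mu p) k t (of_real (y p x))) has_vector_derivative
    - (2 * of_real pi * \<i> * of_real (fd 1 p x)) * hmon (mu p) k (Suc t) (of_real (y p x))) (at x within {a p..b p})"
proof -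
  note l = lam_2_bounds(3)[OF assms(1)] and y0 = y_eq(2)[OF assms(1,2)]
  have "((\<lambda>s. hmon (mu p) k t (of_real s)) has_vector_derivative
      - (mu p * of_real (y p x) * hmon (mu p) k (Suc t) (of_real (y p x)))) (at (y p x) within y p ` {a p..b p})"
    using y0 l assms(3) by (intro has_vector_derivative_real_field hmon_deriv quad_mu_neq_0) auto
  from vector_diff_chain_within[OF y_deriv[OF assms(1,2)] this]
  show ?thesis using y0 l
    by (simp add: o_def scaleR_conv_of_real quad_mu_def field_simps)
qed

lemma H_decomposition:
  assumes "p \<in> P" "t \<le> n + 1" "x \<in> D p"
  shows "H {a p..b p} (f p) (g p) (Suc t) x =
    (\<Sum>k<2 * n + 1. of_real (w p k) * hmon (mu p) k (Suc t) (of_real (y p x))) + HR (Suc t) p x"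
  using assms(2,3)
proof (induction t arbitrary: x)
  case 0
  note px = assms(1) 0(2)
  have f1: "fd 1 p x \<noteq> 0" by (rule f1_neq_0[OF px])
  note l = lam_2_bounds(3)[OF assms(1)] and y0 = y_eq(2)[OF px]
  have mono: "of_real (basis_weight k p x) / (2 * of_real pi * \<i> * of_real (fd 1 p x)) = hmon (mu p) k (Suc 0) (of_real (y p x))" for k
    using y0 l f1 by (simp add: y_eq(4)[OF px] hmon_1 quad_mu_def field_simps del: One_nat_def)
  have "g p x = (\<Sum>k<2 * n + 1. w p k * basis_weight k p x) + R p x" by (simp add: R_def)
  then have "H {a p..b p} (f p) (g p) (Suc 0) x = ((\<Sum>k<2 * n + 1. of_real (w p k) * of_real (basis_weight k p x)) + of_real (R p x)) / (2 * of_real pi * \<i> * of_real (fd 1 p x))"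
    by (simp del: One_nat_def)
  also have "\<dots> = (\<Sum>k<2 * n + 1. of_real (w p k) * (of_real (basis_weight k p x) / (2 * of_real pi * \<i> * of_real (fd 1 p x)))) + HR (Suc 0) p x"
    by (simp add: HR_def add_divide_distrib sum_divide_distrib del: One_nat_def)
  finally show ?case by (simp only: mono)
next
  case (Suc t)
  note px = assms(1) Suc.prems(2)
  have f1: "fd 1 p x \<noteq> 0" by (rule f1_neq_0[OF px])
  let ?S = "\<lambda>t x. \<Sum>k<2 * n + 1. of_real (w p k) * hmon (mu p) k (Suc t) (of_real (y p x))"
  let ?D = "vector_derivative (HR (Suc t) p) (at x within {a p..b p})"
  have "symbol (Suc (2 * n - t)) (HR_weight t) (HR (Suc t))"
    using symbol_HR[of t] Suc.prems(1) by (simp add: Suc_diff_le)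
  from symbol_differentiable[OF this px]
  have "(HR (Suc t) p has_vector_derivative ?D) (at x within {a p..b p})" .
  moreover have "(?S t has_vector_derivative (\<Sum>k<2 * n + 1. of_real (w p k) *
      (- (2 * of_real pi * \<i> * of_real (fd 1 p x)) * hmon (mu p) k (Suc (Suc t)) (of_real (y p x))))) (at x within {a p..b p})"
    by (intro has_vector_derivative_sum has_vector_derivative_mult_right hmon_y_deriv px) auto
  moreover have "(\<Sum>k<2 * n + 1. of_real (w p k) *
      (- (2 * of_real pi * \<i> * of_real (fd 1 p x)) * hmon (mu p) k (Suc (Suc t)) (of_real (y p x)))) =
      - (2 * of_real pi * \<i> * of_real (fd 1 p x)) * ?S (Suc t) x"
    unfolding sum_distrib_left by (intro sum.cong refl) (simp only: mult_ac)
  ultimately have "((\<lambda>x. ?S t x + HR (Suc t) p x) has_vector_derivative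
      (- (2 * of_real pi * \<i> * of_real (fd 1 p x)) * ?S (Suc t) x + ?D)) (at x within D p)"
    unfolding at_within_D_eq[OF px] by (intro has_vector_derivative_add) simp_all
  \<comment> \<open>The induction hypothesis is an identity on all of \<open>D p\<close>, hence can
    be differentiated within \<open>D p\<close>.\<close>
  then have "(H {a p..b p} (f p) (g p) (Suc t) has_vector_derivative
      (- (2 * of_real pi * \<i> * of_real (fd 1 p x)) * ?S (Suc t) x + ?D)) (at x within D p)"
    by (rule has_vector_derivative_transform[OF px(2), rotated]) (use Suc.IH Suc.prems(1) in auto)
  then have "vector_derivative (H {a p..b p} (f p) (g p) (Suc t)) (at x within {a p..b p}) =
      - (2 * of_real pi * \<i> * of_real (fd 1 p x)) * ?S (Suc t) x + ?D"
    using at_within_D_nontrivial[OF px] unfolding at_within_D_eq[OF px] by (intro vector_derivative_within)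
  then have "H {a p..b p} (f p) (g p) (Suc (Suc t)) x =
      - (- (2 * of_real pi * \<i> * of_real (fd 1 p x)) * ?S (Suc t) x + ?D) / (2 * of_real pi * \<i> * of_real (fd 1 p x))"
    by (simp only: H.simps(3))
  also have "\<dots> = ?S (Suc t) x - ?D / (2 * of_real pi * \<i> * of_real (fd 1 p x))"
    using f1 by (simp add: field_simps del: One_nat_def sum.lessThan_Suc)
  also have "- (?D / (2 * of_real pi * \<i> * of_real (fd 1 p x))) = HR (Suc (Suc t)) p x"
    by (simp add: HR_def del: One_nat_def)
  then have "?S (Suc t) x - ?D / (2 * of_real pi * \<i> * of_real (fd 1 p x)) = ?S (Suc t) x + HR (Suc (Suc t)) p x"
    by simp
  finally show ?case .
qed

end

section \<open>Integration by parts and the error terms\<close>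

lemma one_plus_power_le:
  fixes s :: real
  assumes "s \<ge> 0"
  shows "(1 + s) ^ m \<le> 2 ^ m * (1 + s ^ m)"
proof -
  have "(1 + s) ^ m \<le> (2 * max 1 s) ^ m" using assms by (intro power_mono) auto
  also have "\<dots> = 2 ^ m * (max 1 s) ^ m" by (rule power_mult_distrib)
  also have "(max 1 s) ^ m \<le> 1 + s ^ m" using assms by (cases "1 \<le> s") (auto simp: max_def)
  finally show ?thesis by simp
qed

lemma sum_even_odd: "(\<Sum>k<2 * n + 1. F k) = (\<Sum>j\<le>n. F (2 * j)) + (\<Sum>j<n. F (2 * j + 1 :: nat) :: 'a::comm_monoid_add)"
  by (induction n) (simp_all add: ac_simps)

lemma (in pointed_intervals) dominated_uniform:
  assumes "finite A" "\<And>i. i \<in> A \<Longrightarrow> dominated (q i) (W i)"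
    "\<And>i p x. i \<in> A \<Longrightarrow> p \<in> P \<Longrightarrow> x \<in> D p \<Longrightarrow> W i p x \<ge> 0"
  shows "\<exists>K\<ge>0. \<forall>i\<in>A. \<forall>p\<in>P. \<forall>x\<in>D p. norm (q i p x) \<le> K * W i p x"
proof -
  have "\<forall>i\<in>A. \<exists>K\<ge>0. \<forall>p\<in>P. \<forall>x\<in>D p. norm (q i p x) \<le> K * W i p x"
    using assms(2) by (auto simp: dominated_def)
  then obtain K where K: "\<And>i. i \<in> A \<Longrightarrow> K i \<ge> 0"
      "\<And>i p x. i \<in> A \<Longrightarrow> p \<in> P \<Longrightarrow> x \<in> D p \<Longrightarrow> norm (q i p x) \<le> K i * W i p x"
    by metis
  show ?thesis
  proof (intro exI[of _ "\<Sum>i\<in>A. K i"] conjI ballI)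
    fix i p x assume i: "i \<in> A" and px: "p \<in> P" "x \<in> D p"
    have "K i \<le> (\<Sum>i\<in>A. K i)" using K(1) i assms(1) by (intro member_le_sum) auto
    then have "K i * W i p x \<le> (\<Sum>i\<in>A. K i) * W i p x"
      using assms(3)[OF i px] by (intro mult_right_mono)
    then show "norm (q i p x) \<le> (\<Sum>i\<in>A. K i) * W i p x" using K(2)[OF i px] by simp
  qed (use K in \<open>auto intro: sum_nonneg\<close>)
qed

context stationary_phase_family
begin

abbreviation ef :: "'p \<Rightarrow> real \<Rightarrow> complex" where "ef p x \<equiv> e (f p x)"

lemma ef_deriv:
  assumes "p \<in> P" "x \<in> {a p..b p}"
  shows "(ef p has_vector_derivative 2 * of_real pi * \<i> * of_real (fd 1 p x) * ef p x) (at x within {a p..b p})"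
proof -
  have 1: "(f p has_vector_derivative fd 1 p x) (at x within {a p..b p})"
    using fd_deriv[of 0 p x] assms by (simp add: has_real_derivative_iff_has_vector_derivative)
  have "((\<lambda>z. exp (2 * of_real pi * \<i> * z)) has_field_derivative 2 * of_real pi * \<i> * exp (2 * of_real pi * \<i> * of_real (f p x))) (at (of_real (f p x)))"
    by (auto intro!: derivative_eq_intros)
  then have "((\<lambda>s. exp (2 * of_real pi * \<i> * of_real s)) has_vector_derivative 2 * of_real pi * \<i> * exp (2 * of_real pi * \<i> * of_real (f p x))) (at (f p x) within f p ` {a p..b p})"
    by (rule has_vector_derivative_real_field)
  from vector_diff_chain_within[OF 1 this] show ?thesis
    by (simp add: o_def e_def[abs_def] scaleR_conv_of_real mult_ac)
qed

lemma ef_continuous: "p \<in> P \<Longrightarrow> continuous_on {a p..b p} (ef p)"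
  using ef_deriv by (meson continuous_on_eq_continuous_within has_vector_derivative_continuous)

lemma g_continuous: "p \<in> P \<Longrightarrow> continuous_on {a p..b p} (g p)"
  using gd_deriv[of 0 p] by (intro DERIV_continuous_on) auto

definition QR :: "nat \<Rightarrow> 'p \<Rightarrow> real \<Rightarrow> complex" where
  "QR m p x = ef p x * (\<Sum>t=1..m. HR t p x)"

abbreviation HR' :: "nat \<Rightarrow> 'p \<Rightarrow> real \<Rightarrow> complex" where
  "HR' t p x \<equiv> vector_derivative (HR t p) (at x within {a p..b p})"

lemma HR_deriv:
  assumes "p \<in> P" "x \<in> D p" "t \<le> n + 1"
  shows "(HR (Suc t) p has_vector_derivative HR' (Suc t) p x) (at x within {a p..b p})"
proof (rule symbol_differentiable[OF _ assms(1,2)])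
  have "2 * n + 1 - t = Suc (2 * n - t)" using assms(3) n_pos by simp
  then show "symbol (Suc (2 * n - t)) (HR_weight t) (HR (Suc t))"
    using symbol_HR[OF assms(3)] by simp
qed

text \<open>Telescoping: 2 \<pi> i f' H_1 = R, and 2 \<pi> i f' H_(m+1) cancels the derivative of
  H_m left by the previous step.\<close>

lemma QR_deriv:
  assumes "p \<in> P" "x \<in> D p" "m \<le> n + 1"
  shows "(QR (Suc m) p has_vector_derivative of_real (R p x) * ef p x + HR' (Suc m) p x * ef p x) (at x within {a p..b p})"
  using assms(3)
proof (induction m)
  case 0
  define F where "F = 2 * of_real pi * \<i> * complex_of_real (fd 1 p x)"
  have F: "F \<noteq> 0" using f1_neq_0[OF assms(1,2)] by (simp add: F_def)
  have H1: "F * HR (Suc 0) p x = of_real (R p x)"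
    using F by (simp add: HR_def F_def del: One_nat_def)
  have "QR (Suc 0) p = (\<lambda>x. ef p x * HR (Suc 0) p x)" by (simp add: QR_def fun_eq_iff)
  then have "(QR (Suc 0) p has_vector_derivative ef p x * HR' (Suc 0) p x + F * ef p x * HR (Suc 0) p x) (at x within {a p..b p})"
    using has_vector_derivative_mult[OF ef_deriv[OF assms(1) D_in[OF assms(2)]] HR_deriv[OF assms(1,2), of 0]]
    by (simp only: F_def)
  also have "ef p x * HR' (Suc 0) p x + F * ef p x * HR (Suc 0) p x = of_real (R p x) * ef p x + HR' (Suc 0) p x * ef p x"
    unfolding H1[symmetric] by (simp only: mult_ac add.commute)
  finally show ?case .
next
  case (Suc m)
  define F where "F = 2 * of_real pi * \<i> * complex_of_real (fd 1 p x)"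
  have F: "F \<noteq> 0" using f1_neq_0[OF assms(1,2)] by (simp add: F_def)
  have H: "F * HR (Suc (Suc m)) p x = - HR' (Suc m) p x"
    using F by (simp add: HR_def F_def del: One_nat_def)
  have "QR (Suc (Suc m)) p = (\<lambda>x. QR (Suc m) p x + ef p x * HR (Suc (Suc m)) p x)"
    by (simp add: QR_def fun_eq_iff algebra_simps)
  moreover have "(QR (Suc m) p has_vector_derivative of_real (R p x) * ef p x + HR' (Suc m) p x * ef p x) (at x within {a p..b p})"
    using Suc by simp
  moreover note has_vector_derivative_mult[OF ef_deriv[OF assms(1) D_in[OF assms(2)]] HR_deriv[OF assms(1,2) Suc.prems]]
  ultimately have "(QR (Suc (Suc m)) p has_vector_derivative of_real (R p x) * ef p x + HR' (Suc m) p x * ef p x +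
      (ef p x * HR' (Suc (Suc m)) p x + F * ef p x * HR (Suc (Suc m)) p x)) (at x within {a p..b p})"
    unfolding F_def by (simp only:) (intro has_vector_derivative_add)
  also have "F * ef p x * HR (Suc (Suc m)) p x = - (HR' (Suc m) p x * ef p x)"
    using arg_cong[OF H, of "\<lambda>z. z * ef p x"] by (simp only: mult_ac mult_minus_left mult_minus_right)
  finally show ?case by (simp add: mult.commute)
qed

lemma y_continuous: "p \<in> P \<Longrightarrow> continuous_on {a p..b p} (y p)"
proof -
  assume p: "p \<in> P"
  have "continuous_on {a p..b p} (f p)"
    using fd_deriv[of 0 p] p by (intro DERIV_continuous_on) auto
  then have h: "continuous_on S (\<lambda>x. sqrt ((f p x - f p (c p)) / lam p 2))" if "S \<subseteq> {a p..b p}" for S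
    using lam_2_bounds(3)[OF p] that by (intro continuous_intros) (auto intro: continuous_on_subset)
  have "continuous_on {a p..b p} (\<lambda>x. if x \<le> c p then - sqrt ((f p x - f p (c p)) / lam p 2) else sqrt ((f p x - f p (c p)) / lam p 2))"
    by (intro continuous_on_cases_le continuous_on_minus h continuous_on_id) auto
  moreover have "y p = (\<lambda>x. if x \<le> c p then - sqrt ((f p x - f p (c p)) / lam p 2) else sqrt ((f p x - f p (c p)) / lam p 2))"
    by (auto simp: y_def fun_eq_iff sgn_if)
  ultimately show ?thesis by simp
qed

lemma ef_eq_gphase:
  assumes "p \<in> P" "x \<in> D p"
  shows "ef p x = ef p (c p) * gphase (mu p) (of_real (y p x))"
proof -
  have "f p x = f p (c p) + lam p 2 * (y p x)\<^sup>2" using y_eq(3)[OF assms] by simp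
  then show ?thesis by (simp only: gphase_eq_e e_add)
qed

abbreviation prim :: "nat \<Rightarrow> 'p \<Rightarrow> complex \<Rightarrow> complex" where
  "prim k p \<equiv> gprim (fresnel_prim (lam p 2)) (mu p) k"

abbreviation prim_diff :: "nat \<Rightarrow> 'p \<Rightarrow> complex" where
  "prim_diff k p \<equiv> prim k p (of_real (y p (b p))) - prim k p (of_real (y p (a p)))"

text \<open>The primitive composed with y is continuous on the whole interval and differentiable off
  c, so the fundamental theorem with one exceptional point applies across c.\<close>

lemma basis_weight_integral:
  assumes p: "p \<in> P"
  shows "((\<lambda>x. of_real (basis_weight k p x) * ef p x) has_integral
    ef p (c p) * prim_diff k p) {a p..b p}"
proof -
  note l = lam_2_bounds(3)[OF p]
  have prim': "(prim k p has_field_derivative z ^ k * gphase (mu p) z) (at z)" for z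
    by (intro gprim_deriv quad_mu_neq_0 fresnel_prim_deriv l)
  have "((\<lambda>x. of_real (basis_weight k p x) * ef p x) has_integral
      ef p (c p) * prim k p (of_real (y p (b p))) - ef p (c p) * prim k p (of_real (y p (a p)))) {a p..b p}"
  proof (rule fundamental_theorem_of_calculus_interior_strong[where S = "{c p}"])
    show "a p \<le> b p" using a_less_c[OF p] c_less_b[OF p] by simp
    show "continuous_on {a p..b p} (\<lambda>x. ef p (c p) * prim k p (of_real (y p x)))"
    proof (intro continuous_intros)
      have "continuous_on UNIV (prim k p)"
        using prim' by (intro DERIV_continuous_on) auto
      then show "continuous_on {a p..b p} (\<lambda>x. prim k p (of_real (y p x)))"
        by (rule continuous_on_compose2) (auto intro!: continuous_intros y_continuous p)
    qed
    fix x assume x: "x \<in> {a p<..<b p} - {c p}"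
    then have xD: "x \<in> D p" by (auto simp: D_def)
    have at: "at x within {a p..b p} = at x" using x by (intro at_within_Icc_at) auto
    have "((\<lambda>s. prim k p (of_real s)) has_vector_derivative of_real (y p x) ^ k * gphase (mu p) (of_real (y p x))) (at (y p x) within y p ` {a p..b p})"
      by (rule has_vector_derivative_real_field[OF prim'])
    from has_vector_derivative_mult_right[OF vector_diff_chain_within[OF y_deriv[OF p xD] this], of "ef p (c p)"]
    show "((\<lambda>x. ef p (c p) * prim k p (of_real (y p x))) has_vector_derivative of_real (basis_weight k p x) * ef p x) (at x)"
      unfolding at by (simp add: o_def y_eq(4)[OF p xD] ef_eq_gphase[OF p xD] scaleR_conv_of_real mult_ac)
  qed simp
  then show ?thesis by (simp add: right_diff_distrib)
qed

abbreviation g_integral :: "'p \<Rightarrow> complex" where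
  "g_integral p \<equiv> integral {a p..b p} (\<lambda>x. of_real (g p x) * ef p x)"

abbreviation R_integral :: "'p \<Rightarrow> complex" where
  "R_integral p \<equiv> integral {a p..b p} (\<lambda>x. of_real (R p x) * ef p x)"

lemma g_ef_integrable: "p \<in> P \<Longrightarrow> (\<lambda>x. of_real (g p x) * ef p x) integrable_on {a p..b p}"
  by (intro integrable_continuous_real continuous_intros g_continuous ef_continuous)

text \<open>Integrability of R e(f) is inferred from that of the other terms, since R is controlled
  only off c.\<close>

lemma R_has_integral:
  assumes p: "p \<in> P"
  shows "((\<lambda>x. of_real (R p x) * ef p x) has_integral
    g_integral p -
    (\<Sum>k<2 * n + 1. of_real (w p k) * (ef p (c p) * prim_diff k p))) {a p..b p}"
proof -
  have "((\<lambda>x. of_real (g p x) * ef p x - (\<Sum>k<2 * n + 1. of_real (w p k) * (of_real (basis_weight k p x) * ef p x))) has_integral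
    g_integral p -
    (\<Sum>k<2 * n + 1. of_real (w p k) * (ef p (c p) * prim_diff k p))) {a p..b p}"
    by (intro has_integral_diff has_integral_sum has_integral_mult_right basis_weight_integral p integrable_integral g_ef_integrable) simp
  moreover have "of_real (g p x) * ef p x - (\<Sum>k<2 * n + 1. of_real (w p k) * (of_real (basis_weight k p x) * ef p x)) = of_real (R p x) * ef p x" for x
    by (simp add: R_def left_diff_distrib sum_distrib_right mult.assoc del: sum.lessThan_Suc)
  ultimately show ?thesis by simp
qed

text \<open>This is V (\<delta>/M)^(2n+1) \<delta> at the cutting radius \<delta> = M / sqrt
  T.\<close>

definition central_error :: "'p \<Rightarrow> real" where "central_error p = V p * M p / T p ^ (n + 1)"

text \<open>For t \<le> n the weight is V M (v^2)^(n-t) / T^(t+1) with v = \<open>r / M\<close>, so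
  it does not decrease with v and is controlled by its value at v^2 = 1/T.\<close>

lemma HR_weight_small:
  assumes "p \<in> P" "x \<in> D p" "r p x \<le> M p / sqrt (T p)" "t \<le> n"
  shows "HR_weight t p x \<le> central_error p"
proof -
  note pos = M_pos[OF assms(1)] T_pos[OF assms(1)] V_pos[OF assms(1)] r_pos[OF assms(2)]
  define v where "v = r p x / M p"
  have v: "v > 0" "v\<^sup>2 \<le> 1 / T p"
  proof -
    show v: "v > 0" using pos by (simp add: v_def)
    have "v \<le> 1 / sqrt (T p)" using assms(3) pos by (simp add: v_def field_simps)
    then have "v\<^sup>2 \<le> (1 / sqrt (T p))\<^sup>2" using v by (intro power_mono) auto
    then show "v\<^sup>2 \<le> 1 / T p" using pos by (simp add: power_divide)
  qed
  have split: "v ^ (2 * n + 2) = (v\<^sup>2) ^ (n - t) * (v\<^sup>2) ^ Suc t"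
    using assms(4) by (simp add: power_mult[symmetric] power_add[symmetric] algebra_simps del: power_Suc)
  have "v ^ (2 * n + 2) / (T p * v\<^sup>2) ^ Suc t = (v\<^sup>2) ^ (n - t) / T p ^ Suc t"
    unfolding split power_mult_distrib using v pos by simp
  also have "\<dots> \<le> (1 / T p) ^ (n - t) / T p ^ Suc t"
    using v pos by (intro divide_right_mono power_mono) auto
  also have "\<dots> = 1 / T p ^ (n + 1)"
  proof -
    have "T p ^ (n - t) * T p ^ Suc t = T p ^ (n + 1)"
      using assms(4) by (simp add: power_add[symmetric] del: power_Suc)
    then show ?thesis using pos by (simp add: power_divide del: power_Suc)
  qed
  finally have "V p * M p * (v ^ (2 * n + 2) / (T p * v\<^sup>2) ^ Suc t) \<le> V p * M p * (1 / T p ^ (n + 1))"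
    using pos by (intro mult_left_mono) auto
  then show ?thesis by (simp only: v_def central_error_def times_divide_eq_right mult_1_right)
qed

text \<open>For H_(n+2) the power of v is negative: the weight decays like (\<delta> / r)^2 with
  \<delta> = M / sqrt T.\<close>

lemma HR_weight_last:
  assumes "p \<in> P" "x \<in> D p"
  shows "HR_weight (n + 1) p x = central_error p * ((M p)\<^sup>2 / T p) / (r p x)\<^sup>2"
proof -
  note pos = M_pos[OF assms(1)] T_pos[OF assms(1)] V_pos[OF assms(1)] r_pos[OF assms(2)]
  define v where "v = r p x / M p"
  have v: "v > 0" using pos by (simp add: v_def)
  have "v ^ (2 * n + 2) = (v\<^sup>2) ^ (n + 1)" by (simp only: power_mult[symmetric] distrib_left mult_1_right)
  then have "v ^ (2 * n + 2) / (T p * v\<^sup>2) ^ Suc (n + 1) = 1 / (T p ^ (n + 1) * (T p * v\<^sup>2))"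
    using v by (simp only: power_mult_distrib power_Suc2[of _ "n + 1"]) simp
  then have "V p * M p * v ^ (2 * n + 2) / (T p * v\<^sup>2) ^ Suc (n + 1) = central_error p * (1 / T p) / v\<^sup>2"
    by (simp add: central_error_def times_divide_eq_right[symmetric] del: times_divide_eq_right power_Suc)
  also have "\<dots> = central_error p * ((M p)\<^sup>2 / T p) / (r p x)\<^sup>2"
    by (simp add: v_def power_divide)
  finally show ?thesis by (simp only: v_def)
qed

lemma HR_weight_large:
  assumes "p \<in> P" "x \<in> D p" "r p x \<ge> M p / sqrt (T p)"
  shows "HR_weight (n + 1) p x \<le> central_error p"
proof -
  note pos = M_pos[OF assms(1)] T_pos[OF assms(1)] V_pos[OF assms(1)] r_pos[OF assms(2)]
  have "(M p / sqrt (T p))\<^sup>2 \<le> (r p x)\<^sup>2" using assms(3) pos by (intro power_mono) auto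
  also have "(M p / sqrt (T p))\<^sup>2 = (M p)\<^sup>2 / T p" using pos by (simp add: power_divide)
  finally have "(M p)\<^sup>2 / T p / (r p x)\<^sup>2 \<le> 1"
    using pos by (intro divide_le_eq_1_pos[THEN iffD2]) (auto intro!: zero_less_power)
  moreover have "central_error p \<ge> 0" using pos by (simp add: central_error_def)
  ultimately have "central_error p * ((M p)\<^sup>2 / T p / (r p x)\<^sup>2) \<le> central_error p * 1" by (intro mult_left_mono)
  then show ?thesis unfolding HR_weight_last[OF assms(1,2)] by simp
qed

lemma inverse_cube_integral:
  fixes s t d k :: real
  assumes "s \<le> t" "d \<notin> {s..t}" "\<delta> > 0" "\<And>x. x \<in> {s..t} \<Longrightarrow> \<bar>x - d\<bar> \<ge> \<delta>" "k \<ge> 0"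
  shows "\<exists>J\<le>k / (2 * \<delta>\<^sup>2). ((\<lambda>x. k / \<bar>x - d\<bar> ^ 3) has_integral J) {s..t}"
proof -
  define \<sigma> :: real where "\<sigma> = (if s > d then 1 else -1)"
  have \<sigma>: "\<bar>x - d\<bar> = \<sigma> * (x - d)" "x - d \<noteq> 0" if "x \<in> {s..t}" for x
    using that assms(1,2) by (auto simp: \<sigma>_def)
  let ?\<Psi> = "\<lambda>x. - \<sigma> * k / 2 * inverse ((x - d)\<^sup>2)"
  have "((\<lambda>x. k / \<bar>x - d\<bar> ^ 3) has_integral (?\<Psi> t - ?\<Psi> s)) {s..t}"
  proof (rule fundamental_theorem_of_calculus[OF assms(1)])
    fix x assume x: "x \<in> {s..t}"
    have "((\<lambda>x. (x - d)\<^sup>2) has_real_derivative 2 * (x - d)) (at x within {s..t})"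
      by (auto intro!: derivative_eq_intros)
    then have "(?\<Psi> has_real_derivative (- \<sigma> * k / 2) * (- (inverse ((x - d)\<^sup>2) * (2 * (x - d)) * inverse ((x - d)\<^sup>2)))) (at x within {s..t})"
      using \<sigma>(2)[OF x] by (intro DERIV_cmult DERIV_inverse') auto
    also have "(- \<sigma> * k / 2) * (- (inverse ((x - d)\<^sup>2) * (2 * (x - d)) * inverse ((x - d)\<^sup>2))) = \<sigma> * k / (x - d) ^ 3"
    proof -
      have "(- \<sigma> * k / 2) * (- (inverse (q\<^sup>2) * (2 * q) * inverse (q\<^sup>2))) = \<sigma> * k / q ^ 3" if "q \<noteq> 0" for q
        using that by (simp add: field_simps power2_eq_square power3_eq_cube)
      from this[OF \<sigma>(2)[OF x]] show ?thesis .
    qed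
    also have "\<dots> = k / \<bar>x - d\<bar> ^ 3"
      unfolding \<sigma>(1)[OF x] by (simp add: \<sigma>_def power_mult_distrib)
    finally show "(?\<Psi> has_vector_derivative k / \<bar>x - d\<bar> ^ 3) (at x within {s..t})"
      by (simp only: has_real_derivative_iff_has_vector_derivative)
  qed
  moreover have "?\<Psi> t - ?\<Psi> s \<le> k / (2 * \<delta>\<^sup>2)"
  proof -
    have B: "k / 2 * inverse ((x - d)\<^sup>2) \<le> k / (2 * \<delta>\<^sup>2)" "0 \<le> k / 2 * inverse ((x - d)\<^sup>2)" if "x \<in> {s..t}" for x
    proof -
      have "\<delta>\<^sup>2 \<le> \<bar>x - d\<bar>\<^sup>2" using assms(3) assms(4)[OF that] by (intro power_mono) auto
      then have "inverse ((x - d)\<^sup>2) \<le> inverse (\<delta>\<^sup>2)" using assms(3) by (intro le_imp_inverse_le) auto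
      then have "k / 2 * inverse ((x - d)\<^sup>2) \<le> k / 2 * inverse (\<delta>\<^sup>2)" using assms(5) by (intro mult_left_mono) auto
      then show "k / 2 * inverse ((x - d)\<^sup>2) \<le> k / (2 * \<delta>\<^sup>2)" by (simp add: field_simps)
      show "0 \<le> k / 2 * inverse ((x - d)\<^sup>2)" using assms(5) by simp
    qed
    show ?thesis using B[of s] B[of t] assms(1) by (cases "s > d") (auto simp: \<sigma>_def)
  qed
  ultimately show ?thesis by blast
qed

lemma central_error_nonneg: "p \<in> P \<Longrightarrow> central_error p \<ge> 0"
  using M_pos[of p] T_pos[of p] V_pos[of p] by (simp add: central_error_def)

text \<open>What remains after n + 2 integrations by parts is the integral of H_(n+2)' e(f), whose
  integrand is at most a multiple of \<delta>^2 / r^3. The cube makes the bound independent of the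
  length of the interval.\<close>

lemma R_integral_tail:
  "\<exists>K\<ge>0. \<forall>p\<in>P. \<forall>s t. s \<le> t \<longrightarrow> {s..t} \<subseteq> {a p..b p} \<longrightarrow> (\<forall>x\<in>{s..t}. r p x \<ge> M p / sqrt (T p)) \<longrightarrow>
     norm (integral {s..t} (\<lambda>x. of_real (R p x) * ef p x) - (QR (n + 2) p t - QR (n + 2) p s)) \<le> K * central_error p"
proof -
  have "2 * n + 1 - (n + 1) = Suc (n - 1)" using n_pos by simp
  then have "symbol (Suc (n - 1)) (HR_weight (n + 1)) (HR (Suc (n + 1)))"
    using symbol_HR[of "n + 1"] by (simp only:)
  from symbol_dominated[OF symbol_vector_derivative[OF this]] obtain K where K: "K \<ge> 0"
      "\<And>p x. p \<in> P \<Longrightarrow> x \<in> D p \<Longrightarrow> norm (HR' (Suc (n + 1)) p x) \<le> K * (HR_weight (n + 1) p x / r p x)"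
    by (rule dominatedE) blast
  show ?thesis
  proof (intro exI[of _ K] conjI ballI allI impI K(1))
    fix p s t assume p: "p \<in> P" and st: "s \<le> t" "{s..t} \<subseteq> {a p..b p}" and far: "\<forall>x\<in>{s..t}. r p x \<ge> M p / sqrt (T p)"
    define \<delta> where "\<delta> = M p / sqrt (T p)"
    note pos = M_pos[OF p] T_pos[OF p]
    have \<delta>: "\<delta> > 0" "\<delta>\<^sup>2 = (M p)\<^sup>2 / T p" using pos by (simp_all add: \<delta>_def power_divide)
    have c: "c p \<notin> {s..t}" using far \<delta>(1) by (force simp: \<delta>_def[symmetric])
    have D: "x \<in> D p" if "x \<in> {s..t}" for x using that st c by (auto simp: D_def)
    define k where "k = K * central_error p * ((M p)\<^sup>2 / T p)"
    have k: "k \<ge> 0" using K(1) central_error_nonneg[OF p] pos by (simp add: k_def)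
    obtain J where J: "J \<le> k / (2 * \<delta>\<^sup>2)" "((\<lambda>x. k / \<bar>x - c p\<bar> ^ 3) has_integral J) {s..t}"
      using inverse_cube_integral[OF st(1) c \<delta>(1) _ k] far by (auto simp: \<delta>_def)
    have F1: "((\<lambda>x. of_real (R p x) * ef p x + HR' (Suc (n + 1)) p x * ef p x) has_integral
        QR (Suc (n + 1)) p t - QR (Suc (n + 1)) p s) {s..t}"
    proof (rule fundamental_theorem_of_calculus[OF st(1)])
      fix x assume "x \<in> {s..t}"
      from has_vector_derivative_within_subset[OF QR_deriv[OF p D[OF this], of "n + 1"] st(2)]
      show "(QR (Suc (n + 1)) p has_vector_derivative of_real (R p x) * ef p x + HR' (Suc (n + 1)) p x * ef p x) (at x within {s..t})"
        by simp
    qed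
    have "(\<lambda>x. of_real (R p x) * ef p x) integrable_on {s..t}"
      by (rule integrable_subinterval_real[OF has_integral_integrable[OF R_has_integral[OF p]] st(2)])
    then have F2: "((\<lambda>x. of_real (R p x) * ef p x) has_integral integral {s..t} (\<lambda>x. of_real (R p x) * ef p x)) {s..t}"
      by (rule integrable_integral)
    have I: "((\<lambda>x. HR' (Suc (n + 1)) p x * ef p x) has_integral
        QR (Suc (n + 1)) p t - QR (Suc (n + 1)) p s - integral {s..t} (\<lambda>x. of_real (R p x) * ef p x)) {s..t}"
      using has_integral_diff[OF F1 F2] by (simp only: add_diff_cancel_left')
    have "norm (integral {s..t} (\<lambda>x. HR' (Suc (n + 1)) p x * ef p x)) \<le> integral {s..t} (\<lambda>x. k / \<bar>x - c p\<bar> ^ 3)"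
    proof (rule integral_norm_bound_integral)
      fix x assume x: "x \<in> {s..t}"
      have "norm (HR' (Suc (n + 1)) p x * ef p x) \<le> K * (HR_weight (n + 1) p x / r p x)"
        using K(2)[OF p D[OF x]] by (simp add: norm_mult del: power_Suc)
      also have "\<dots> = k / \<bar>x - c p\<bar> ^ 3"
        unfolding HR_weight_last[OF p D[OF x]] k_def by (simp add: power2_eq_square power3_eq_cube)
      finally show "norm (HR' (Suc (n + 1)) p x * ef p x) \<le> k / \<bar>x - c p\<bar> ^ 3" .
    qed (fact has_integral_integrable[OF I] has_integral_integrable[OF J(2)])+
    also have "\<dots> \<le> k / (2 * \<delta>\<^sup>2)" using J by (simp add: integral_unique)
    also have "\<dots> = K * central_error p / 2" using pos by (simp add: \<delta>(2) k_def)
    also have "\<dots> \<le> K * central_error p" using K(1) central_error_nonneg[OF p] by simp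
    finally have "norm (QR (Suc (n + 1)) p t - QR (Suc (n + 1)) p s - integral {s..t} (\<lambda>x. of_real (R p x) * ef p x)) \<le> K * central_error p"
      unfolding integral_unique[OF I] .
    then show "norm (integral {s..t} (\<lambda>x. of_real (R p x) * ef p x) - (QR (n + 2) p t - QR (n + 2) p s)) \<le> K * central_error p"
      by (subst norm_minus_commute) simp
  qed
qed

text \<open>
  After \<open>n + 1\<close> integrations by parts the integrand is of order \<open>1 / \<bar>x - c\<bar>\<close>, which would cost a
  logarithm; one more makes it integrable away from \<open>c\<close>.
\<close>

lemma R_integral_bound:
  "\<exists>K\<ge>0. \<forall>p\<in>P. norm (R_integral p - (QR (n + 1) p (b p) - QR (n + 1) p (a p))) \<le> K * central_error p"
proof -
  have HR_dominated: "dominated (HR (Suc t)) (HR_weight t)" if "t \<in> {..n + 1}" for t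
    using that by (intro symbol_dominated[OF symbol_HR]) simp
  have W_nonneg: "0 \<le> HR_weight t p x" if "t \<in> {..n + 1}" "p \<in> P" "x \<in> D p" for t p x
    using M_pos[OF that(2)] T_pos[OF that(2)] V_pos[OF that(2)] by (intro divide_nonneg_nonneg mult_nonneg_nonneg zero_le_power) auto
  have HR_uniform: "\<exists>K\<ge>0. \<forall>t\<in>{..n + 1}. \<forall>p\<in>P. \<forall>x\<in>D p. norm (HR (Suc t) p x) \<le> K * HR_weight t p x"
    by (rule dominated_uniform) (fact finite_atMost HR_dominated W_nonneg)+
  obtain K1 where K1: "K1 \<ge> 0" "\<And>t p x. t \<in> {..n + 1} \<Longrightarrow> p \<in> P \<Longrightarrow> x \<in> D p \<Longrightarrow> norm (HR (Suc t) p x) \<le> K1 * HR_weight t p x"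
    using HR_uniform by blast
  obtain K2 where K2: "K2 \<ge> 0" "\<And>p x. p \<in> P \<Longrightarrow> x \<in> D p \<Longrightarrow> norm (R p x) \<le> K2 * (V p * (r p x / M p) ^ (2 * n + 1))"
    using symbol_dominated[OF symbol_R] by (rule dominatedE) blast
  obtain K3 where K3: "K3 \<ge> 0" and K3_tail: "\<forall>p\<in>P. \<forall>s t. s \<le> t \<longrightarrow> {s..t} \<subseteq> {a p..b p} \<longrightarrow> (\<forall>x\<in>{s..t}. r p x \<ge> M p / sqrt (T p)) \<longrightarrow>
     norm (integral {s..t} (\<lambda>x. of_real (R p x) * ef p x) - (QR (n + 2) p t - QR (n + 2) p s)) \<le> K3 * central_error p"
    using R_integral_tail by (elim exE conjE)
  show ?thesis
  \<comment> \<open>The middle gives 2 K2. Each side gives K3 for the tail, (n+2) K1 for the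
    boundary sum at the cut and K1 for the term H_(n+2) at the endpoint.\<close>
  proof (intro exI[of _ "2 * K2 + 2 * (K3 + (n + 3) * K1)"] conjI ballI)
    show "0 \<le> 2 * K2 + 2 * (K3 + (n + 3) * K1)" using K1 K2 K3 by simp
    fix p assume p: "p \<in> P"
    let ?F = "\<lambda>x. of_real (R p x) * ef p x"
    define \<delta> where "\<delta> = M p / sqrt (T p)"
    note pos = M_pos[OF p] T_pos[OF p] V_pos[OF p] and e0 = central_error_nonneg[OF p]
    have \<delta>: "\<delta> > 0" using pos by (simp add: \<delta>_def)
    have ac: "a p < c p" "c p < b p" using a_less_c[OF p] c_less_b[OF p] by auto
    \<comment> \<open>H_1 to H_(n+1) are small within distance \<delta>, H_(n+2) beyond it; at
      distance exactly \<delta> all n + 2 of them are.\<close>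
    have HRb: "norm (HR (Suc t) p x) \<le> K1 * central_error p"
      if "x \<in> D p" "t \<le> n \<and> r p x \<le> \<delta> \<or> t = n + 1 \<and> r p x \<ge> \<delta>" for t x
    proof -
      have "HR_weight t p x \<le> central_error p"
        using HR_weight_small[OF p that(1), of t] HR_weight_large[OF p that(1)] that(2) by (auto simp: \<delta>_def)
      then have "K1 * HR_weight t p x \<le> K1 * central_error p" using K1(1) by (intro mult_left_mono)
      then show ?thesis using K1(2)[of t, OF _ p that(1)] that(2) by fastforce
    qed
    have QRs: "norm (QR m p x) \<le> real m * (K1 * central_error p)" if "\<And>t. t < m \<Longrightarrow> norm (HR (Suc t) p x) \<le> K1 * central_error p" for m x
    proof -
      have "norm (QR m p x) = norm (\<Sum>t<m. HR (Suc t) p x)"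
        by (simp add: QR_def norm_mult sum.atLeast1_atMost_eq)
      also have "\<dots> \<le> (\<Sum>t<m. K1 * central_error p)" by (intro sum_norm_le that) auto
      finally show ?thesis by simp
    qed
    have tail: "norm (QR (n + 1) p x) \<le> (K3 + (n + 3) * K1) * central_error p" if "x \<in> D p" "r p x \<le> \<delta>" for x
    proof -
      have "norm (QR (n + 1) p x) \<le> real (n + 1) * (K1 * central_error p)" using that by (intro QRs HRb) auto
      also have "\<dots> \<le> (K3 + (n + 3) * K1) * central_error p"
        using mult_nonneg_nonneg[OF K1(1) e0] mult_nonneg_nonneg[OF K3 e0] by (simp add: algebra_simps)
      finally show ?thesis .
    qed
    have QR_near: "norm (QR (n + 2) p x') \<le> real (n + 2) * (K1 * central_error p)"
      and QR_step: "norm (QR (n + 2) p x - QR (n + 1) p x) \<le> K1 * central_error p"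
      if "x \<in> D p" "x' \<in> D p" "r p x \<ge> \<delta>" "r p x' = \<delta>" "norm (I - (QR (n + 2) p x - QR (n + 2) p x')) \<le> K3 * central_error p" for x x' and I :: complex
    proof -
      have Q: "QR (n + 2) p x - QR (n + 1) p x = ef p x * HR (Suc (n + 1)) p x"
        by (simp add: QR_def algebra_simps)
      show 4: "norm (QR (n + 2) p x - QR (n + 1) p x) \<le> K1 * central_error p"
        unfolding Q using HRb[OF that(1), of "n + 1"] that by (simp add: norm_mult)
      show "norm (QR (n + 2) p x') \<le> real (n + 2) * (K1 * central_error p)"
        using that by (intro QRs HRb) (auto simp: less_Suc_eq)
    qed
    have int: "?F integrable_on {s..t}" if "{s..t} \<subseteq> {a p..b p}" for s t
      by (rule integrable_subinterval_real[OF has_integral_integrable[OF R_has_integral[OF p]] that])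
    \<comment> \<open>The cuts are clipped, since \<delta> may exceed the distance to an
      endpoint.\<close>
    define x1 where "x1 = max (a p) (c p - \<delta>)"
    define x2 where "x2 = min (b p) (c p + \<delta>)"
    have x: "a p \<le> x1" "x1 < c p" "c p < x2" "x2 \<le> b p" using ac \<delta> by (auto simp: x1_def x2_def)
    have aD: "a p \<in> D p" "b p \<in> D p" "x1 \<in> D p" "x2 \<in> D p" using ac x by (auto simp: D_def)
    have mid: "norm (integral {x1..x2} ?F) \<le> 2 * K2 * central_error p"
    proof -
      have q: "(\<delta> / M p) ^ (2 * n + 1) * \<delta> = M p / T p ^ (n + 1)"
      proof -
        have "(\<delta> / M p)\<^sup>2 = 1 / T p" using pos by (simp add: \<delta>_def power_divide)
        then have "(\<delta> / M p) ^ (2 * (n + 1)) = 1 / T p ^ (n + 1)"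
          by (simp only: power_mult power_one_over)
        moreover have "(\<delta> / M p) ^ (2 * n + 1) * \<delta> = (\<delta> / M p) ^ (2 * (n + 1)) * M p"
          using pos by simp
        ultimately show ?thesis by simp
      qed
      \<comment> \<open>The bound on R holds off c only, hence the exceptional point; the length is
        at most 2 \<delta>.\<close>
      have "norm (integral {x1..x2} ?F) \<le> K2 * (V p * (\<delta> / M p) ^ (2 * n + 1)) * measure lborel (cbox x1 x2)"
      proof (rule has_integral_bound_spike_finite[where S = "{c p}"])
        show "(?F has_integral integral {x1..x2} ?F) (cbox x1 x2)"
          using int[of x1 x2] x by (auto intro: integrable_integral)
        show "0 \<le> K2 * (V p * (\<delta> / M p) ^ (2 * n + 1))" using K2 pos \<delta> by simp
        fix t assume t: "t \<in> cbox x1 x2 - {c p}"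
        then have tD: "t \<in> D p" and rt: "r p t \<le> \<delta>" using x by (auto simp: D_def x1_def x2_def)
        have "norm (?F t) \<le> K2 * (V p * (r p t / M p) ^ (2 * n + 1))"
          using K2(2)[OF p tD] by (simp add: norm_mult del: power_Suc)
        also have "\<dots> \<le> K2 * (V p * (\<delta> / M p) ^ (2 * n + 1))"
          using K2(1) pos rt by (intro mult_left_mono power_mono divide_right_mono) auto
        finally show "norm (?F t) \<le> K2 * (V p * (\<delta> / M p) ^ (2 * n + 1))" .
      qed simp
      also have "\<dots> \<le> K2 * (V p * (\<delta> / M p) ^ (2 * n + 1)) * (2 * \<delta>)"
        using K2(1) pos \<delta> x by (intro mult_left_mono) (auto simp: x1_def x2_def)
      also have "\<dots> = 2 * K2 * (V p * ((\<delta> / M p) ^ (2 * n + 1) * \<delta>))" by (simp only: mult_ac)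
      also have "\<dots> = 2 * K2 * central_error p" unfolding q by (simp add: central_error_def)
      finally show ?thesis .
    qed
    \<comment> \<open>If b is within \<delta> of c, the outer integral is empty and the boundary sum
      at b is itself small. Otherwise the tail estimate with n + 2 terms is converted to n + 1 terms
      at b.\<close>
    have right: "norm (integral {x2..b p} ?F - QR (n + 1) p (b p)) \<le> (K3 + (n + 3) * K1) * central_error p"
    proof (cases "b p \<le> c p + \<delta>")
      case True
      then have "x2 = b p" "r p (b p) \<le> \<delta>" using ac by (auto simp: x2_def)
      then show ?thesis using tail[OF aD(2)] by simp
    next
      case False
      then have x2: "x2 = c p + \<delta>" "r p (b p) \<ge> \<delta>" "r p x2 = \<delta>" using ac \<delta> by (auto simp: x2_def)
      have "norm (integral {x2..b p} ?F - (QR (n + 2) p (b p) - QR (n + 2) p x2)) \<le> K3 * central_error p"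
        by (rule K3_tail[rule_format, OF p]) (use x x2 in \<open>auto simp: \<delta>_def\<close>)
      note t = QR_near[OF aD(2,4) x2(2,3) this] QR_step[OF aD(2,4) x2(2,3) this] this
      have "norm (integral {x2..b p} ?F - QR (n + 1) p (b p)) \<le>
          norm (integral {x2..b p} ?F - (QR (n + 2) p (b p) - QR (n + 2) p x2)) + norm (QR (n + 2) p (b p) - QR (n + 1) p (b p)) + norm (QR (n + 2) p x2)"
        by (rule order.trans[OF _ order.trans[OF norm_triangle_ineq4 add_right_mono[OF norm_triangle_ineq]]]) simp
      also have "\<dots> \<le> K3 * central_error p + K1 * central_error p + real (n + 2) * (K1 * central_error p)"
        using t by (intro add_mono)
      also have "\<dots> = (K3 + (n + 3) * K1) * central_error p" by (simp add: algebra_simps)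
      finally show ?thesis .
    qed
    have left: "norm (integral {a p..x1} ?F + QR (n + 1) p (a p)) \<le> (K3 + (n + 3) * K1) * central_error p"
    proof (cases "a p \<ge> c p - \<delta>")
      case True
      then have "x1 = a p" "r p (a p) \<le> \<delta>" using ac by (auto simp: x1_def)
      then show ?thesis using tail[OF aD(1)] by simp
    next
      case False
      then have x1: "x1 = c p - \<delta>" "r p (a p) \<ge> \<delta>" "r p x1 = \<delta>" using ac \<delta> by (auto simp: x1_def)
      have I: "norm (integral {a p..x1} ?F - (QR (n + 2) p x1 - QR (n + 2) p (a p))) \<le> K3 * central_error p"
        by (rule K3_tail[rule_format, OF p]) (use x x1 in \<open>auto simp: \<delta>_def\<close>)
      then have "norm (- integral {a p..x1} ?F - (QR (n + 2) p (a p) - QR (n + 2) p x1)) \<le> K3 * central_error p"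
        by (subst norm_minus_cancel[symmetric]) (simp add: algebra_simps)
      note t = QR_near[OF aD(1,3) x1(2,3) this] QR_step[OF aD(1,3) x1(2,3) this]
      have "norm (integral {a p..x1} ?F + QR (n + 1) p (a p)) \<le>
          norm (integral {a p..x1} ?F - (QR (n + 2) p x1 - QR (n + 2) p (a p)) + QR (n + 2) p x1) + norm (QR (n + 2) p (a p) - QR (n + 1) p (a p))"
        by (rule order.trans[OF _ norm_triangle_ineq4]) simp
      also have "\<dots> \<le> (norm (integral {a p..x1} ?F - (QR (n + 2) p x1 - QR (n + 2) p (a p))) + norm (QR (n + 2) p x1)) + norm (QR (n + 2) p (a p) - QR (n + 1) p (a p))"
        by (intro add_right_mono norm_triangle_ineq)
      also have "\<dots> \<le> (K3 * central_error p + real (n + 2) * (K1 * central_error p)) + K1 * central_error p"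
        using t I by (intro add_mono)
      also have "\<dots> = (K3 + (n + 3) * K1) * central_error p" by (simp add: algebra_simps)
      finally show ?thesis .
    qed
    have "integral {a p..b p} ?F = integral {a p..x1} ?F + integral {x1..x2} ?F + integral {x2..b p} ?F"
      using x int by (simp add: Henstock_Kurzweil_Integration.integral_combine)
    then have "integral {a p..b p} ?F - (QR (n + 1) p (b p) - QR (n + 1) p (a p)) =
        (integral {a p..x1} ?F + QR (n + 1) p (a p)) + integral {x1..x2} ?F + (integral {x2..b p} ?F - QR (n + 1) p (b p))"
      by simp
    then have "norm (integral {a p..b p} ?F - (QR (n + 1) p (b p) - QR (n + 1) p (a p))) \<le>
        norm (integral {a p..x1} ?F + QR (n + 1) p (a p)) + norm (integral {x1..x2} ?F) + norm (integral {x2..b p} ?F - QR (n + 1) p (b p))"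
      by (simp only:) (rule order.trans[OF norm_triangle_ineq add_right_mono[OF norm_triangle_ineq]])
    also have "\<dots> \<le> (K3 + (n + 3) * K1) * central_error p + 2 * K2 * central_error p + (K3 + (n + 3) * K1) * central_error p"
      by (intro add_mono left mid right)
    also have "\<dots> = (2 * K2 + 2 * (K3 + (n + 3) * K1)) * central_error p" by (simp add: algebra_simps)
    finally show "norm (integral {a p..b p} ?F - (QR (n + 1) p (b p) - QR (n + 1) p (a p))) \<le> (2 * K2 + 2 * (K3 + (n + 3) * K1)) * central_error p" .
  qed
qed

text \<open>Splitting the power of 1 + M/N into its two extreme terms produces the last error term
  of the theorem.\<close>

lemma central_error_le: "p \<in> P \<Longrightarrow> central_error p \<le> 2 ^ (2 * n + 1) * (U p / T p ^ (n + 1) * (M p ^ (2 * n + 2) / N p ^ (2 * n + 1) + M p))"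
proof -
  assume p: "p \<in> P"
  note pos = M_pos[OF p] T_pos[OF p] U_pos[OF p] N_pos[OF p]
  have "central_error p = U p * M p / T p ^ (n + 1) * (1 + M p / N p) ^ (2 * n + 1)"
    by (simp add: central_error_def V_def rho_def)
  also have "\<dots> \<le> U p * M p / T p ^ (n + 1) * (2 ^ (2 * n + 1) * (1 + (M p / N p) ^ (2 * n + 1)))"
    using pos by (intro mult_left_mono one_plus_power_le) auto
  also have "\<dots> = 2 ^ (2 * n + 1) * (U p / T p ^ (n + 1) * (M p * (1 + (M p / N p) ^ (2 * n + 1))))"
    by simp
  also have "M p * (1 + (M p / N p) ^ (2 * n + 1)) = M p ^ (2 * n + 2) / N p ^ (2 * n + 1) + M p"
    by (simp add: power_divide distrib_left)
  finally show ?thesis .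
qed

section \<open>Fresnel tails at the endpoints\<close>

definition tail_error :: "'p \<Rightarrow> real" where
  "tail_error p = U p * M p ^ (2 * n + 4) / T p ^ (n + 2) * (1 / (c p - a p) ^ (2 * n + 3) + 1 / (b p - c p) ^ (2 * n + 3))
    + U p * M p ^ (2 * n + 4) / (T p ^ (n + 2) * N p ^ (2 * n)) * (1 / (c p - a p) ^ 3 + 1 / (b p - c p) ^ 3)"

text \<open>For d \<le> M one has rho d / M \<le> 1 + d/N. Its power 2j is at most the power 2n of 1
  + d/N, and the two extreme terms of that give 1/d^(2n+3) and 1/(N^(2n) d^3).\<close>

lemma side_bound:
  assumes p: "p \<in> P" and d: "0 < d" "d \<le> M p" and j: "j \<le> n"
  shows "U p * rho p ^ (2 * j) / M p ^ (2 * j) * (1 / tau p) ^ (n + 2) * (1 / d ^ (2 * (n + 1 - j) + 1)) \<le>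
    2 ^ (2 * n) * (U p * M p ^ (2 * n + 4) / T p ^ (n + 2) * (1 / d ^ (2 * n + 3))
       + U p * M p ^ (2 * n + 4) / (T p ^ (n + 2) * N p ^ (2 * n)) * (1 / d ^ 3))"
proof -
  note pos = M_pos[OF p] T_pos[OF p] U_pos[OF p] N_pos[OF p]
  let ?A = "U p * M p ^ (2 * n + 4) / T p ^ (n + 2)"
  have tau: "(1 / tau p) ^ (n + 2) = M p ^ (2 * n + 4) / T p ^ (n + 2)"
  proof -
    have "(M p)\<^sup>2 ^ (n + 2) = M p ^ (2 * n + 4)"
      unfolding power_mult[symmetric] by (rule arg_cong[where f = "\<lambda>k. M p ^ k"]) simp
    then show ?thesis by (simp only: tau_def power_divide) simp
  qed
  have dd: "d ^ (2 * n + 3) = d ^ (2 * j) * d ^ (2 * (n + 1 - j) + 1)" "d ^ (2 * n + 3) = d ^ (2 * n) * d ^ 3"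
    unfolding power_add[symmetric] using j by (intro arg_cong[where f = "\<lambda>k. d ^ k"]; simp)+
  have "(rho p * d / M p) ^ (2 * j) \<le> (1 + d / N p) ^ (2 * j)"
  proof (rule power_mono)
    have "rho p * d / M p = d / M p + d / N p" using pos by (simp add: rho_def field_simps)
    then show "rho p * d / M p \<le> 1 + d / N p" using d pos by simp
    show "0 \<le> rho p * d / M p" using d pos rho_ge_1[OF p] by simp
  qed
  also have "\<dots> \<le> (1 + d / N p) ^ (2 * n)" using d pos j by (intro power_increasing) auto
  also have "\<dots> \<le> 2 ^ (2 * n) * (1 + (d / N p) ^ (2 * n))" using d pos by (intro one_plus_power_le) simp
  finally have *: "(rho p * d / M p) ^ (2 * j) \<le> 2 ^ (2 * n) * (1 + (d / N p) ^ (2 * n))" .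
  have "U p * rho p ^ (2 * j) / M p ^ (2 * j) * (1 / tau p) ^ (n + 2) * (1 / d ^ (2 * (n + 1 - j) + 1)) =
      ?A / d ^ (2 * n + 3) * (rho p * d / M p) ^ (2 * j)"
    unfolding tau unfolding dd(1) power_mult_distrib power_divide using d by (simp add: field_simps del: power_Suc)
  also have "\<dots> \<le> ?A / d ^ (2 * n + 3) * (2 ^ (2 * n) * (1 + (d / N p) ^ (2 * n)))"
    using pos d by (intro mult_left_mono *) auto
  also have "\<dots> = 2 ^ (2 * n) * (?A * (1 / d ^ (2 * n + 3)) + ?A * (d ^ (2 * n) / d ^ (2 * n + 3)) / N p ^ (2 * n))"
    by (simp only: power_divide) (simp add: algebra_simps add_divide_distrib del: power_Suc)
  also have "d ^ (2 * n) / d ^ (2 * n + 3) = 1 / d ^ 3" unfolding dd(2) using d by simp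
  also have "?A * (1 / d ^ 3) / N p ^ (2 * n) = U p * M p ^ (2 * n + 4) / (T p ^ (n + 2) * N p ^ (2 * n)) * (1 / d ^ 3)"
    by (simp only: divide_inverse inverse_mult_distrib mult_ac)
  finally show ?thesis .
qed

lemma y_lower:
  assumes "p \<in> P" "x \<in> D p"
  shows "r p x / C 2 \<le> \<bar>y p x\<bar>" "sgn (y p x) = sgn (x - c p)"
proof -
  have "sqrt (1 / (C 2)\<^sup>2) \<le> sqrt (1 + z p x)" using z_bounds[OF assms] by (intro real_sqrt_le_mono) auto
  then have s: "1 / C 2 \<le> sqrt (1 + z p x)" using C2_pos by (simp add: real_sqrt_divide)
  then have "r p x * (1 / C 2) \<le> r p x * sqrt (1 + z p x)" by (intro mult_left_mono) auto
  moreover have "sqrt (1 + z p x) > 0" using s C2_pos by (meson divide_pos_pos less_le_trans zero_less_one)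
  ultimately show "r p x / C 2 \<le> \<bar>y p x\<bar>" "sgn (y p x) = sgn (x - c p)"
    by (simp_all add: y_eq(1)[OF assms] abs_mult sgn_mult)
qed

abbreviation defect :: "nat \<Rightarrow> 'p \<Rightarrow> complex \<Rightarrow> complex" where
  "defect k p \<equiv> gdefect (fresnel_prim (lam p 2)) (mu p) k (n + 1)"

abbreviation defect_diff :: "nat \<Rightarrow> 'p \<Rightarrow> complex" where
  "defect_diff k p \<equiv> defect k p (of_real (y p (b p))) - defect k p (of_real (y p (a p)))"

definition gauss_coeff :: "nat \<Rightarrow> 'p \<Rightarrow> complex" where
  "gauss_coeff j p = (- 1) ^ j * of_nat (odd_double_fact j) / mu p ^ j"

text \<open>Of the n + 1 integrations by parts, j reduce y^(2j) to 1; the tail left by the others is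
  of order 2(n+1-j)+1 in 1/|y|, and |y| is at least a multiple of the distance to c.\<close>

lemma even_term_bound:
  assumes j: "j \<le> n"
  shows "\<exists>K\<ge>0. \<forall>p\<in>P. norm (of_real (w p (2 * j)) * (defect_diff (2 * j) p
      - e (1 / 8) / of_real (sqrt (2 * lam p 2)) * gauss_coeff j p)) \<le> K * tail_error p"
proof -
  let ?m = "2 * (n + 1 - j) + 1"
  obtain Kw where Kw: "Kw \<ge> 0" "\<And>p x. p \<in> P \<Longrightarrow> x \<in> D p \<Longrightarrow> norm (w p (2 * j)) \<le> Kw * (U p * rho p ^ (2 * j) / M p ^ (2 * j))"
    by (rule dominatedE[OF dominated_w[of "2 * j"]]) (use j in auto)
  obtain Kg where Kg: "Kg \<ge> 0" "\<And>\<nu> A B. \<nu> > 0 \<Longrightarrow> A > 0 \<Longrightarrow> B > 0 \<Longrightarrow>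
    norm (gdefect (fresnel_prim \<nu>) (quad_mu \<nu>) (2 * j) (n + 1) (of_real B)
        - gdefect (fresnel_prim \<nu>) (quad_mu \<nu>) (2 * j) (n + 1) (- of_real A)
        - e (1 / 8) / of_real (sqrt (2 * \<nu>)) * ((- 1) ^ j * of_nat (odd_double_fact j) / quad_mu \<nu> ^ j))
      \<le> Kg / \<nu> ^ (n + 1 + 1) * (1 / A ^ ?m + 1 / B ^ ?m)"
    using gdefect_even_bound[of j "n + 1"] j by (metis le_SucI Suc_eq_plus1)
  let ?K = "Kw * Kg * (2 * C 2) ^ (n + 2) * C 2 ^ ?m * 2 ^ (2 * n)"
  show ?thesis
  proof (intro exI[of _ ?K] conjI ballI)
    show "0 \<le> ?K" using Kw(1) Kg(1) C2_pos by simp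
    fix p assume p: "p \<in> P"
    note pos = M_pos[OF p] T_pos[OF p] U_pos[OF p] N_pos[OF p] tau_pos[OF p] and l = lam_2_bounds[OF p]
    have ac: "a p < c p" "c p < b p" "b p - a p \<le> M p" using a_less_c[OF p] c_less_b[OF p] length_le[OF p] by auto
    have D: "a p \<in> D p" "b p \<in> D p" using ac by (auto simp: D_def)
    define A where "A = - y p (a p)"
    define B where "B = y p (b p)"
    have "sgn (y p (a p)) < 0" "sgn (y p (b p)) > 0"
      using y_lower(2)[OF p D(1)] y_lower(2)[OF p D(2)] ac by simp_all
    then have AB: "A > 0" "B > 0" by (simp_all add: A_def B_def)
    have A: "(c p - a p) / C 2 \<le> A" and B: "(b p - c p) / C 2 \<le> B"
      using y_lower(1)[OF p D(1)] y_lower(1)[OF p D(2)] AB ac by (simp_all add: A_def B_def)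
    have inv: "1 / X ^ ?m \<le> C 2 ^ ?m * (1 / d ^ ?m)" if "d > 0" "d / C 2 \<le> X" for X d
    proof -
      have "1 / X ^ ?m \<le> 1 / (d / C 2) ^ ?m"
        using that C2_pos by (intro divide_left_mono power_mono mult_pos_pos zero_less_power) (auto intro: less_le_trans[rotated])
      then show ?thesis by (simp only: power_divide) simp
    qed
    let ?w = "U p * rho p ^ (2 * j) / M p ^ (2 * j)"
    have w0: "?w \<ge> 0" using pos rho_ge_1[OF p] by simp
    have lam: "Kg / lam p 2 ^ (n + 2) \<le> Kg * ((2 * C 2) ^ (n + 2) * (1 / tau p) ^ (n + 2))"
    proof -
      have "Kg / lam p 2 ^ (n + 2) \<le> Kg / (tau p / (2 * C 2)) ^ (n + 2)"
        using Kg(1) l pos C2_pos by (intro divide_left_mono power_mono mult_pos_pos zero_less_power) auto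
      also have "\<dots> = Kg * ((2 * C 2) ^ (n + 2) * (1 / tau p) ^ (n + 2))"
        by (simp only: power_divide) simp
      finally show ?thesis .
    qed
    have "norm (defect_diff (2 * j) p - e (1 / 8) / of_real (sqrt (2 * lam p 2)) * gauss_coeff j p)
        \<le> Kg / lam p 2 ^ (n + 2) * (1 / A ^ ?m + 1 / B ^ ?m)"
      using Kg(2)[OF l(3) AB] by (simp add: A_def B_def gauss_coeff_def)
    also have "\<dots> \<le> Kg * ((2 * C 2) ^ (n + 2) * (1 / tau p) ^ (n + 2)) * (C 2 ^ ?m * (1 / (c p - a p) ^ ?m) + C 2 ^ ?m * (1 / (b p - c p) ^ ?m))"
      using lam Kg(1) pos C2_pos AB A B ac by (intro mult_mono add_mono inv) auto
    finally have "norm (of_real (w p (2 * j)) * (defect_diff (2 * j) p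
        - e (1 / 8) / of_real (sqrt (2 * lam p 2)) * gauss_coeff j p)) \<le>
        (Kw * ?w) * (Kg * ((2 * C 2) ^ (n + 2) * (1 / tau p) ^ (n + 2)) * (C 2 ^ ?m * (1 / (c p - a p) ^ ?m) + C 2 ^ ?m * (1 / (b p - c p) ^ ?m)))"
      unfolding norm_mult norm_of_real using Kw(2)[OF p D(1)] Kw(1) w0 by (intro mult_mono) auto
    also have "\<dots> = Kw * Kg * (2 * C 2) ^ (n + 2) * C 2 ^ ?m *
        (?w * (1 / tau p) ^ (n + 2) * (1 / (c p - a p) ^ ?m) + ?w * (1 / tau p) ^ (n + 2) * (1 / (b p - c p) ^ ?m))"
      by (simp only: distrib_left mult_ac)
    also have "\<dots> \<le> Kw * Kg * (2 * C 2) ^ (n + 2) * C 2 ^ ?m * (2 ^ (2 * n) * tail_error p)"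
    proof (rule mult_left_mono)
      have "?w * (1 / tau p) ^ (n + 2) * (1 / (c p - a p) ^ ?m) + ?w * (1 / tau p) ^ (n + 2) * (1 / (b p - c p) ^ ?m) \<le>
        2 ^ (2 * n) * (U p * M p ^ (2 * n + 4) / T p ^ (n + 2) * (1 / (c p - a p) ^ (2 * n + 3))
         + U p * M p ^ (2 * n + 4) / (T p ^ (n + 2) * N p ^ (2 * n)) * (1 / (c p - a p) ^ 3)) +
        2 ^ (2 * n) * (U p * M p ^ (2 * n + 4) / T p ^ (n + 2) * (1 / (b p - c p) ^ (2 * n + 3))
         + U p * M p ^ (2 * n + 4) / (T p ^ (n + 2) * N p ^ (2 * n)) * (1 / (b p - c p) ^ 3))"
        using ac by (intro add_mono side_bound p j) auto
      also have "\<dots> = 2 ^ (2 * n) * tail_error p"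
        unfolding tail_error_def by (simp only: distrib_left add.assoc add.left_commute)
      finally show "?w * (1 / tau p) ^ (n + 2) * (1 / (c p - a p) ^ ?m) + ?w * (1 / tau p) ^ (n + 2) * (1 / (b p - c p) ^ ?m) \<le> 2 ^ (2 * n) * tail_error p" .
    qed (use Kw(1) Kg(1) C2_pos in auto)
    finally show "norm (of_real (w p (2 * j)) * (defect_diff (2 * j) p
      - e (1 / 8) / of_real (sqrt (2 * lam p 2)) * gauss_coeff j p)) \<le> ?K * tail_error p"
      by (simp only: mult.assoc)
  qed
qed

section \<open>Assembly of the asymptotic formula\<close>

abbreviation main_term :: "'p \<Rightarrow> complex" where
  "main_term p \<equiv> e (f p (c p) + 1 / 8) / of_real (sqrt (deriv_on {a p..b p} 2 (f p) (c p))) *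
         (of_real (g p (c p)) + (\<Sum>j=1..n. of_real (varpi (\<lambda>k l j. (- (real k + 1) / 2) gchoose j) n (lam p) (eta p) (2 * j)) *
          ((- 1) ^ j * of_nat (odd_double_fact j) / (4 * of_real pi * \<i> * of_real (lam p 2)) ^ j)))"

abbreviation endpoint_term :: "'p \<Rightarrow> complex" where
  "endpoint_term p \<equiv> bracket (\<lambda>x. ef p x * (\<Sum>t=1..n + 1. H {a p..b p} (f p) (g p) t x)) (a p) (b p)"

text \<open>Subtracting the endpoint terms turns each primitive into a defect; the defects for odd k
  vanish after n + 1 integrations by parts because k \<le> 2n - 1.\<close>

lemma integral_eq:
  assumes p: "p \<in> P"
  shows "g_integral p
     - endpoint_term p =
    ef p (c p) * (\<Sum>j\<le>n. of_real (w p (2 * j)) * defect_diff (2 * j) p)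
     + (R_integral p - (QR (n + 1) p (b p) - QR (n + 1) p (a p)))"
proof -
  have D: "a p \<in> D p" "b p \<in> D p" using a_less_c[OF p] c_less_b[OF p] by (auto simp: D_def)
  let ?h = "\<lambda>k x. gphase (mu p) (of_real (y p x)) * (\<Sum>t=1..n + 1. hmon (mu p) k t (of_real (y p x)))"
  have br: "ef p x * (\<Sum>t=1..n + 1. H {a p..b p} (f p) (g p) t x) =
      (\<Sum>k<2 * n + 1. of_real (w p k) * (ef p (c p) * ?h k x)) + QR (n + 1) p x" if x: "x \<in> D p" for x
  proof -
    have "(\<Sum>t=1..n + 1. H {a p..b p} (f p) (g p) t x) =
        (\<Sum>t=1..n + 1. (\<Sum>k<2 * n + 1. of_real (w p k) * hmon (mu p) k t (of_real (y p x))) + HR t p x)"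
    proof (rule sum.cong[OF refl])
      fix t assume "t \<in> {1..n + 1}"
      then obtain t' where "t = Suc t'" "t' \<le> n + 1" by (cases t) auto
      then show "H {a p..b p} (f p) (g p) t x = (\<Sum>k<2 * n + 1. of_real (w p k) * hmon (mu p) k t (of_real (y p x))) + HR t p x"
        using H_decomposition[OF p _ x, of t'] by (simp only:)
    qed
    also have "\<dots> = (\<Sum>k<2 * n + 1. of_real (w p k) * (\<Sum>t=1..n + 1. hmon (mu p) k t (of_real (y p x)))) + (\<Sum>t=1..n + 1. HR t p x)"
      unfolding sum.distrib sum_distrib_left by (subst sum.swap) (rule refl)
    finally have "ef p x * (\<Sum>t=1..n + 1. H {a p..b p} (f p) (g p) t x) =
        (\<Sum>k<2 * n + 1. ef p x * (of_real (w p k) * (\<Sum>t=1..n + 1. hmon (mu p) k t (of_real (y p x))))) + QR (n + 1) p x"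
      by (simp only: distrib_left QR_def sum_distrib_left[of "ef p x" _ "{..<2 * n + 1}"])
    then show ?thesis unfolding ef_eq_gphase[OF p x] by (simp only: mult_ac)
  qed
  have R: "g_integral p = R_integral p +
     (\<Sum>k<2 * n + 1. of_real (w p k) * (ef p (c p) * prim_diff k p))"
    using integral_unique[OF R_has_integral[OF p]] by simp
  let ?G = "\<lambda>k. of_real (w p k) * (ef p (c p) * defect_diff k p)"
  have "(\<Sum>k<2 * n + 1. of_real (w p k) * (ef p (c p) * prim_diff k p)) -
     ((\<Sum>k<2 * n + 1. of_real (w p k) * (ef p (c p) * ?h k (b p))) - (\<Sum>k<2 * n + 1. of_real (w p k) * (ef p (c p) * ?h k (a p)))) = (\<Sum>k<2 * n + 1. ?G k)"
    unfolding sum_subtractf[symmetric] gdefect_def by (intro sum.cong refl) (simp only: algebra_simps)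
  moreover have "(\<Sum>k<2 * n + 1. ?G k) = (\<Sum>j\<le>n. ?G (2 * j))"
  proof -
    note l = lam_2_bounds(3)[OF p]
    have odd: "?G (2 * j + 1) = 0" if "j < n" for j
      using gdefect_odd[OF quad_mu_neq_0[OF l], of "of_real (y p (b p))" j "n + 1"]
        gdefect_odd[OF quad_mu_neq_0[OF l], of "of_real (y p (a p))" j "n + 1"]
        y_eq(2)[OF p D(1)] y_eq(2)[OF p D(2)] that by simp
    have "(\<Sum>j<n. ?G (2 * j + 1)) = 0"
      by (rule sum.neutral) (use odd in blast)
    then show ?thesis by (simp only: sum_even_odd add_0_right)
  qed
  moreover have "(\<Sum>j\<le>n. ?G (2 * j)) = ef p (c p) * (\<Sum>j\<le>n. of_real (w p (2 * j)) * defect_diff (2 * j) p)"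
    unfolding sum_distrib_left by (intro sum.cong refl) (simp only: mult_ac)
  ultimately show ?thesis
    unfolding bracket_def br[OF D(1)] br[OF D(2)] R by (simp add: algebra_simps del: sum.lessThan_Suc)
qed

text \<open>Here 2 \<lambda>_2 = f''(\<gamma>) matches the prefactors, and g(\<gamma>) is the term j
  = 0.\<close>

lemma main_term_eq:
  assumes p: "p \<in> P"
  shows "main_term p =
    ef p (c p) * (\<Sum>j\<le>n. of_real (w p (2 * j)) * (e (1 / 8) / of_real (sqrt (2 * lam p 2)) * gauss_coeff j p))"
proof -
  have w0: "w p 0 = g p (c p)"
    by (simp add: w_def lagrange_coeff_def taylor_coeff_def)
  have k0: "gauss_coeff 0 p = 1" by (simp add: gauss_coeff_def odd_double_fact_def)
  have "(\<Sum>j=1..n. of_real (varpi (\<lambda>k l j. (- (real k + 1) / 2) gchoose j) n (lam p) (eta p) (2 * j)) *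
          ((- 1) ^ j * of_nat (odd_double_fact j) / (4 * of_real pi * \<i> * of_real (lam p 2)) ^ j)) =
      (\<Sum>j=1..n. of_real (w p (2 * j)) * gauss_coeff j p)"
  proof (intro sum.cong refl)
    fix j assume "j \<in> {1..n}"
    then have "varpi (\<lambda>k l j. (- (real k + 1) / 2) gchoose j) n (lam p) (eta p) (2 * j) = w p (2 * j)"
      unfolding w_def by (intro varpi_eq_lagrange_coeff) auto
    then show "of_real (varpi (\<lambda>k l j. (- (real k + 1) / 2) gchoose j) n (lam p) (eta p) (2 * j)) *
          ((- 1) ^ j * of_nat (odd_double_fact j) / (4 * of_real pi * \<i> * of_real (lam p 2)) ^ j) = of_real (w p (2 * j)) * gauss_coeff j p"
      by (simp only: gauss_coeff_def quad_mu_def)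
  qed
  moreover have "{..n} = insert 0 {1..n}" by auto
  then have "of_real (g p (c p)) + (\<Sum>j=1..n. of_real (w p (2 * j)) * gauss_coeff j p) = (\<Sum>j\<le>n. of_real (w p (2 * j)) * gauss_coeff j p)"
    by (simp add: w0 k0)
  ultimately show ?thesis
    by (simp only: e_add lam_2 sum_distrib_left) (intro sum.cong refl, simp add: mult_ac)
qed

lemma stationary_phase_bound:
  "\<exists>K\<ge>0. \<forall>p\<in>P. norm (g_integral p - (main_term p + endpoint_term p))
    \<le> K * (tail_error p + U p / T p ^ (n + 1) * (M p ^ (2 * n + 2) / N p ^ (2 * n + 1) + M p))"
proof -
  let ?Ej = "\<lambda>p j. of_real (w p (2 * j)) * (defect_diff (2 * j) p
      - e (1 / 8) / of_real (sqrt (2 * lam p 2)) * gauss_coeff j p)"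
  let ?E4 = "\<lambda>p. U p / T p ^ (n + 1) * (M p ^ (2 * n + 2) / N p ^ (2 * n + 1) + M p)"
  have "\<forall>j\<in>{..n}. \<exists>K\<ge>0. \<forall>p\<in>P. norm (?Ej p j) \<le> K * tail_error p" using even_term_bound by auto
  then obtain K where K: "\<And>j. j \<le> n \<Longrightarrow> K j \<ge> 0" "\<And>j p. j \<le> n \<Longrightarrow> p \<in> P \<Longrightarrow> norm (?Ej p j) \<le> K j * tail_error p"
    by (metis atMost_iff)
  obtain L where L: "L \<ge> 0" "\<And>p. p \<in> P \<Longrightarrow> norm (R_integral p - (QR (n + 1) p (b p) - QR (n + 1) p (a p))) \<le> L * central_error p"
    using R_integral_bound by blast
  define K1 where "K1 = (\<Sum>j\<le>n. K j)"
  have K1: "K1 \<ge> 0" unfolding K1_def by (intro sum_nonneg K) auto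
  show ?thesis
  proof (intro exI[of _ "K1 + L * 2 ^ (2 * n + 1)"] conjI ballI)
    show "0 \<le> K1 + L * 2 ^ (2 * n + 1)" using K1 L by simp
    fix p assume p: "p \<in> P"
    note pos = M_pos[OF p] T_pos[OF p] U_pos[OF p] N_pos[OF p]
    have tail_error: "tail_error p \<ge> 0" using pos a_less_c[OF p] c_less_b[OF p] by (simp add: tail_error_def)
    have E4: "?E4 p \<ge> 0" using pos by simp
    let ?Rt = "R_integral p - (QR (n + 1) p (b p) - QR (n + 1) p (a p))"
    let ?X = "g_integral p - (main_term p + endpoint_term p)"
    have split: "(\<Sum>j\<le>n. ?Ej p j) = (\<Sum>j\<le>n. of_real (w p (2 * j)) * defect_diff (2 * j) p) -
        (\<Sum>j\<le>n. of_real (w p (2 * j)) * (e (1 / 8) / of_real (sqrt (2 * lam p 2)) * gauss_coeff j p))"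
      unfolding sum_subtractf[symmetric] by (intro sum.cong refl) (simp only: right_diff_distrib)
    have X: "?X = ef p (c p) * (\<Sum>j\<le>n. ?Ej p j) + ?Rt"
      unfolding main_term_eq[OF p] split using integral_eq[OF p] by (simp add: algebra_simps)
    have "norm ?X \<le> norm (\<Sum>j\<le>n. ?Ej p j) + norm ?Rt"
      unfolding X by (rule order.trans[OF norm_triangle_ineq]) (simp add: norm_mult)
    also have "\<dots> \<le> (\<Sum>j\<le>n. K j * tail_error p) + L * central_error p"
      by (intro add_mono sum_norm_le K L p) auto
    also have "\<dots> \<le> K1 * tail_error p + L * (2 ^ (2 * n + 1) * ?E4 p)"
      using L(1) by (intro add_mono mult_left_mono central_error_le p) (simp_all add: K1_def sum_distrib_right)
    also have "\<dots> \<le> (K1 + L * 2 ^ (2 * n + 1)) * (tail_error p + ?E4 p)"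
    proof -
      have "0 \<le> K1 * ?E4 p" by (rule mult_nonneg_nonneg[OF K1 E4])
      moreover have "0 \<le> L * 2 ^ (2 * n + 1) * tail_error p"
        by (intro mult_nonneg_nonneg L(1) tail_error zero_le_power) simp
      ultimately show ?thesis by (simp only: distrib_left distrib_right mult.assoc)
    qed
    finally show "norm ?X \<le> (K1 + L * 2 ^ (2 * n + 1)) * (tail_error p + ?E4 p)" .
  qed
qed

end

text \<open>All data of the theorem in one index type, so that a bound uniform over a family becomes
  the quantifier order of an O-constant.\<close>

type_synonym phase_data =
  "real \<times> real \<times> real \<times> real \<times> real \<times> real \<times> real \<times> (real \<Rightarrow> real) \<times> (real \<Rightarrow> real)"

theorem theorem1p2:
  "\<exists>c :: nat \<Rightarrow> nat \<Rightarrow> nat \<Rightarrow> real.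
    \<forall>(n::nat) (C :: nat \<Rightarrow> real). n \<ge> 2 \<longrightarrow> (\<forall>r\<le>2 * n + 3. C r > 0) \<longrightarrow>
    (\<exists>K::real. \<forall>(\<alpha>::real) (\<beta>::real) (\<gamma>::real) (M::real) (N::real) (T::real) (U::real)
        (f :: real \<Rightarrow> real) (g :: real \<Rightarrow> real).
      (let I = {\<alpha>..\<beta>};
           lam = taylor_coeff I f \<gamma>;
           eta = taylor_coeff I g \<gamma>
       in
        \<alpha> < \<gamma> \<and> \<gamma> < \<beta> \<and>
        Ck_on (2 * n + 3) f I \<and> Ck_on (2 * n + 1) g I \<and>
        M > 0 \<and> N > 0 \<and> T > 0 \<and> U > 0 \<and> M \<ge> \<beta> - \<alpha> \<and>
        (\<forall>x\<in>I. \<forall>r\<in>{2..2 * n + 3}. \<bar>deriv_on I r f x\<bar> \<le> C r * (T / M ^ r)) \<and>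
        (\<forall>x\<in>I. deriv_on I 2 f x \<ge> T / (C 2 * M\<^sup>2)) \<and>
        (\<forall>x\<in>I. \<forall>s\<le>2 * n + 1. \<bar>deriv_on I s g x\<bar> \<le> C s * (U / N ^ s)) \<and>
        (\<forall>x\<in>{\<alpha>..<\<gamma>}. deriv_on I 1 f x < 0) \<and>
        (\<forall>x\<in>{\<gamma><..\<beta>}. deriv_on I 1 f x > 0) \<and>
        T powr (1 / (2 * real n + 3)) * Delta n C > 1
        \<longrightarrow>
        norm (integral I (\<lambda>x. of_real (g x) * e (f x))
              - (e (f \<gamma> + 1 / 8) / of_real (sqrt (deriv_on I 2 f \<gamma>)) *
                   (of_real (g \<gamma>)
                    + (\<Sum>j=1..n. of_real (varpi c n lam eta (2 * j)) *
                         ((- 1) ^ j * of_nat (odd_double_fact j)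
                          / (4 * of_real pi * \<i> * of_real (lam 2)) ^ j)))
                 + bracket (\<lambda>x. e (f x) * (\<Sum>t=1..n + 1. H I f g t x)) \<alpha> \<beta>))
        \<le> K * (U * M ^ (2 * n + 5) / (T ^ (n + 2) * N ^ (n + 2))
                  * (1 / (\<gamma> - \<alpha>) ^ (n + 2) + 1 / (\<beta> - \<gamma>) ^ (n + 2))
               + U * M ^ (2 * n + 4) / T ^ (n + 2)
                  * (1 / (\<gamma> - \<alpha>) ^ (2 * n + 3) + 1 / (\<beta> - \<gamma>) ^ (2 * n + 3))
               + U * M ^ (2 * n + 4) / (T ^ (n + 2) * N ^ (2 * n))
                  * (1 / (\<gamma> - \<alpha>) ^ 3 + 1 / (\<beta> - \<gamma>) ^ 3)
               + U / T ^ (n + 1) * (M ^ (2 * n + 2) / N ^ (2 * n + 1) + M))))"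
proof (intro exI[of _ "\<lambda>k l j. (- (real k + 1) / 2) gchoose j"] allI impI, goal_cases)
  case h: (1 n C)
  define a :: "phase_data \<Rightarrow> real" where "a = (\<lambda>(\<alpha>, \<beta>, \<gamma>, M, N, T, U, f, g). \<alpha>)"
  define b :: "phase_data \<Rightarrow> real" where "b = (\<lambda>(\<alpha>, \<beta>, \<gamma>, M, N, T, U, f, g). \<beta>)"
  define c :: "phase_data \<Rightarrow> real" where "c = (\<lambda>(\<alpha>, \<beta>, \<gamma>, M, N, T, U, f, g). \<gamma>)"
  define M :: "phase_data \<Rightarrow> real" where "M = (\<lambda>(\<alpha>, \<beta>, \<gamma>, M, N, T, U, f, g). M)"
  define N :: "phase_data \<Rightarrow> real" where "N = (\<lambda>(\<alpha>, \<beta>, \<gamma>, M, N, T, U, f, g). N)"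
  define T :: "phase_data \<Rightarrow> real" where "T = (\<lambda>(\<alpha>, \<beta>, \<gamma>, M, N, T, U, f, g). T)"
  define U :: "phase_data \<Rightarrow> real" where "U = (\<lambda>(\<alpha>, \<beta>, \<gamma>, M, N, T, U, f, g). U)"
  define f :: "phase_data \<Rightarrow> real \<Rightarrow> real" where "f = (\<lambda>(\<alpha>, \<beta>, \<gamma>, M, N, T, U, f, g). f)"
  define g :: "phase_data \<Rightarrow> real \<Rightarrow> real" where "g = (\<lambda>(\<alpha>, \<beta>, \<gamma>, M, N, T, U, f, g). g)"
  note proj = a_def b_def c_def M_def N_def T_def U_def f_def g_def
  \<comment> \<open>Only \<open>n\<close> and \<open>C\<close> are fixed at this point, so the
    constant obtained over \<open>P\<close> depends on nothing else.\<close>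
  define P where "P = {p. a p < c p \<and> c p < b p \<and>
      Ck_on (2 * n + 3) (f p) {a p..b p} \<and> Ck_on (2 * n + 1) (g p) {a p..b p} \<and>
      N p > 0 \<and> T p > 0 \<and> U p > 0 \<and> M p \<ge> b p - a p \<and>
      (\<forall>x\<in>{a p..b p}. \<forall>r\<in>{2..2 * n + 3}. \<bar>deriv_on {a p..b p} r (f p) x\<bar> \<le> C r * (T p / M p ^ r)) \<and>
      (\<forall>x\<in>{a p..b p}. deriv_on {a p..b p} 2 (f p) x \<ge> T p / (C 2 * (M p)\<^sup>2)) \<and>
      (\<forall>x\<in>{a p..b p}. \<forall>s\<le>2 * n + 1. \<bar>deriv_on {a p..b p} s (g p) x\<bar> \<le> C s * (U p / N p ^ s)) \<and>
      (\<forall>x\<in>{a p..<c p}. deriv_on {a p..b p} 1 (f p) x < 0) \<and>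
      (\<forall>x\<in>{c p<..b p}. deriv_on {a p..b p} 1 (f p) x > 0)}"
  interpret stationary_phase_family P a b c M n C N T U f g
    by unfold_locales (use h in \<open>simp_all add: P_def\<close>)
  obtain K where K: "K \<ge> 0" "\<forall>p\<in>P. norm (g_integral p - (main_term p + endpoint_term p))
      \<le> K * (tail_error p + U p / T p ^ (n + 1) * (M p ^ (2 * n + 2) / N p ^ (2 * n + 1) + M p))"
    using stationary_phase_bound by (elim exE conjE)
  show ?case
  proof (intro exI[of _ K] allI, unfold Let_def, intro impI, goal_cases)
    case h: (1 \<alpha> \<beta> \<gamma> M' N' T' U' f' g')
    define p :: phase_data where "p = (\<alpha>, \<beta>, \<gamma>, M', N', T', U', f', g')"
    have pr: "a p = \<alpha>" "b p = \<beta>" "c p = \<gamma>" "M p = M'" "N p = N'" "T p = T'" "U p = U'" "f p = f'" "g p = g'"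
      by (simp_all add: p_def proj)
    have "p \<in> P" unfolding P_def mem_Collect_eq pr using h by (elim conjE) (intro conjI)
    note bound = K(2)[rule_format, OF this, unfolded pr tail_error_def]
    let ?E = "\<lambda>E1. E1 + U' * M' ^ (2 * n + 4) / T' ^ (n + 2)
                  * (1 / (\<gamma> - \<alpha>) ^ (2 * n + 3) + 1 / (\<beta> - \<gamma>) ^ (2 * n + 3))
               + U' * M' ^ (2 * n + 4) / (T' ^ (n + 2) * N' ^ (2 * n))
                  * (1 / (\<gamma> - \<alpha>) ^ 3 + 1 / (\<beta> - \<gamma>) ^ 3)
               + U' / T' ^ (n + 1) * (M' ^ (2 * n + 2) / N' ^ (2 * n + 1) + M')"
    let ?E1 = "U' * M' ^ (2 * n + 5) / (T' ^ (n + 2) * N' ^ (n + 2))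
                  * (1 / (\<gamma> - \<alpha>) ^ (n + 2) + 1 / (\<beta> - \<gamma>) ^ (n + 2))"
    \<comment> \<open>The bound at hand consists of the last three error terms; adding a nonnegative
      one only weakens it.\<close>
    have "0 \<le> ?E1"
      using h by (intro mult_nonneg_nonneg divide_nonneg_nonneg add_nonneg_nonneg zero_le_power) auto
    then have "K * ?E 0 \<le> K * ?E ?E1"
      using K(1) by (intro mult_left_mono add_right_mono) auto
    then have "K * (U' * M' ^ (2 * n + 4) / T' ^ (n + 2)
                  * (1 / (\<gamma> - \<alpha>) ^ (2 * n + 3) + 1 / (\<beta> - \<gamma>) ^ (2 * n + 3))
               + U' * M' ^ (2 * n + 4) / (T' ^ (n + 2) * N' ^ (2 * n))
                  * (1 / (\<gamma> - \<alpha>) ^ 3 + 1 / (\<beta> - \<gamma>) ^ 3)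
               + U' / T' ^ (n + 1) * (M' ^ (2 * n + 2) / N' ^ (2 * n + 1) + M')) \<le> K * ?E ?E1"
      by (simp only: add_0)
    from order.trans[OF bound this]
    show ?case .
  qed
qed

end
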